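(* Let $\bar G$ be the group $$\bar G=\langle a,b,c \mid a^{2}b=ba^{2},\ a^{2}c=ca^{2},\ b^{2}a=ab^{2},\ c^{2}a=ac^{2},\ abc=cba,\ cab=bac\rangle ,$$ and put $b'=aba^{-1}$ and $c'=aca^{-1}$ in $\bar G$ (so that also $b'=a^{-1}ba$ and $c'=a^{-1}ca$). For an oriented long knot diagram $K$ on the cylinder, let $\bar\phi(K)\in\bar G$ be the product, in the order in which they are met along the orientation of $K$, of the letters assigned to the endpoints of the chords of the linear Gauss diagram $G(K)$ by the following rule, where $i(d)\in\{+1,-1\}$ is the sign of the chord $d$: - if $d$ is even, its over-endpoint gets $a^{i(d)}$ and its under-endpoint gets $a^{-i(d)}$; - if $d$ is odd of the first type, its over-endpoint gets $b^{i(d)}$ and its under-endpoint gets $c^{-i(d)}$; - if $d$ is odd of the second type, its over-endpoint gets $(b')^{i(d)}$ and its under-endpoint gets $(c')^{-i(d)}$. Then $\bar\phi$ is an invariant of (oriented) long knots in the full torus; that is, if $K$ and $K'$ are oriented long knot diagrams on the cylinder related by a finite sequence of Reidemeister moves, then $\bar\phi(K)=\bar\phi(K')$ in $\bar G$.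
   Context: **Long knot diagrams on the cylinder.** The cylinder is $C=\mathbb{R}\times S^1$ (equivalently, a twice-punctured sphere), with a fixed orientation. A long knot diagram $K$ on the cylinder is a generic smooth immersion $f:\mathbb{R}\to C$ (finitely many singular points, all transverse double points) with over/under information at each double point, such that for some $r>0$ one has $f(x)=(x,\ast)$ for all $|x|>r$, where $\ast\in S^1$ is a fixed base point; so the two ends of the curve go to the two different ends of the cylinder. It is oriented by the orientation of $\mathbb{R}$. Oriented long knots in the full torus (thickened cylinder) are equivalence classes of such diagrams under the usual oriented Reidemeister moves $R_1,R_2,R_3$ (performed in discs in the cylinder) and planar isotopy of the compact part of the diagram. **Linear Gauss diagram.** The linear Gauss diagram $G(K)$ consists of the oriented line $\mathbb{R}$ together with one chord for each crossing of $K$, joining the two preimages of that crossing; one endpoint of the chord is the over-endpoint (preimage on the overcrossing strand) and the other is the under-endpoint (preimage on the undercrossing strand). Two chords are linked if their endpoints alternate along the line. **Sign.** The sign $i(d)$ of a chord $d$ is the usual sign ($+1$ or $-1$) of the corresponding crossing of the oriented diagram $K$: it is $+1$ if (tangent vector of the over strand, tangent vector of the under strand) is a positively oriented basis, and $-1$ otherwise. **Parity.** A chord (crossing) is odd if it is linked with an odd number of chords of $G(K)$, and even if it is linked with an even number of chords of $G(K)$. **Type.** An odd chord is of the first type if it is linked with an even number of even chords, and of the second type if it is linked with an odd number of even chords. *)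

theory Defs
  imports "HOL-Analysis.Analysis" "HOL-Algebra.Group"
begin

section \<open>Groups given by generators and relations\<close>

text \<open>A word is a list of letters; \<open>(g, True)\<close> is the generator \<open>g\<close> and \<open>(g, False)\<close> its
  formal inverse. A pair \<open>(u, v)\<close> in \<open>R\<close> is the relation \<open>u = v\<close>.\<close>

type_synonym 'g word = "('g \<times> bool) list"

inductive_set pres_rel :: "('g word \<times> 'g word) set \<Rightarrow> ('g word \<times> 'g word) set"
  for R :: "('g word \<times> 'g word) set" where
  refl: "(u, u) \<in> pres_rel R"
| sym: "(u, v) \<in> pres_rel R \<Longrightarrow> (v, u) \<in> pres_rel R"
| trans: "(u, v) \<in> pres_rel R \<Longrightarrow> (v, w) \<in> pres_rel R \<Longrightarrow> (u, w) \<in> pres_rel R"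
| cancel: "(x @ [(g, e), (g, \<not> e)] @ y, x @ y) \<in> pres_rel R"
| rel: "(u, v) \<in> R \<Longrightarrow> (x @ u @ y, x @ v @ y) \<in> pres_rel R"

definition presented_group :: "('g word \<times> 'g word) set \<Rightarrow> 'g word set monoid" where
  "presented_group R =
    \<lparr>carrier = UNIV // pres_rel R,
     mult = (\<lambda>X Y. \<Union>u\<in>X. \<Union>v\<in>Y. pres_rel R `` {u @ v}),
     one = pres_rel R `` {[]}\<rparr>"

lemma equiv_pres_rel: "equiv UNIV (pres_rel R)"
proof (rule equivI)
  show "refl (pres_rel R)"
    by (rule refl_onI) (rule pres_rel.refl)
  show "sym (pres_rel R)"
    by (rule symI) (rule pres_rel.sym)
  show "trans (pres_rel R)"
    by (rule transI) (rule pres_rel.trans)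
qed simp

lemma pres_rel_append:
  assumes "(u, u') \<in> pres_rel R" "(v, v') \<in> pres_rel R"
  shows "(u @ v, u' @ v') \<in> pres_rel R"
proof -
  have l: "(x @ s, x @ t) \<in> pres_rel R" if "(s, t) \<in> pres_rel R" for x s t
    using that
  proof (induction rule: pres_rel.induct)
    case (cancel y g e z)
    then show ?case using pres_rel.cancel[of "x @ y" g e z R] by simp
  next
    case (rel s t y z)
    then show ?case using pres_rel.rel[OF rel, of "x @ y" z] by simp
  next
    case (trans s t w)
    then show ?case by (metis pres_rel.trans)
  qed (rule pres_rel.refl, rule pres_rel.sym)
  have r: "(s @ x, t @ x) \<in> pres_rel R" if "(s, t) \<in> pres_rel R" for x s t
    using that
  proof (induction rule: pres_rel.induct)
    case (cancel y g e z)
    then show ?case using pres_rel.cancel[of y g e "z @ x" R] by simp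
  next
    case (rel s t y z)
    then show ?case using pres_rel.rel[OF rel, of y "z @ x"] by simp
  next
    case (trans s t w)
    then show ?case by (metis pres_rel.trans)
  qed (rule pres_rel.refl, rule pres_rel.sym)
  show ?thesis
    using r[OF assms(1), of v] l[OF assms(2), of u'] by (rule pres_rel.trans)
qed

lemma presented_group_mult:
  "pres_rel R `` {u} \<otimes>\<^bsub>presented_group R\<^esub> pres_rel R `` {v} = pres_rel R `` {u @ v}"
proof -
  have "pres_rel R `` {s @ t} = pres_rel R `` {u @ v}"
    if "s \<in> pres_rel R `` {u}" "t \<in> pres_rel R `` {v}" for s t
  proof -
    have "(u @ v, s @ t) \<in> pres_rel R"
      using that by (simp add: pres_rel_append)
    from equiv_class_eq[OF equiv_pres_rel this] show ?thesis by simp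
  qed
  moreover have "u \<in> pres_rel R `` {u}" "v \<in> pres_rel R `` {v}"
    by (simp_all add: pres_rel.refl)
  ultimately have "(\<Union>s\<in>pres_rel R `` {u}. \<Union>t\<in>pres_rel R `` {v}. pres_rel R `` {s @ t})
      = pres_rel R `` {u @ v}"
    by blast
  then show ?thesis
    by (simp add: presented_group_def)
qed

lemma presented_group_carrierE:
  assumes "X \<in> carrier (presented_group R)"
  obtains u where "X = pres_rel R `` {u}"
  using assms by (auto simp: presented_group_def quotient_def)

lemma presented_group_class_closed [simp]:
  "pres_rel R `` {u} \<in> carrier (presented_group R)"
  by (auto simp: presented_group_def quotient_def)

lemma pres_rel_inverse:
  "(rev (map (\<lambda>(g, e). (g, \<not> e)) u) @ u, []) \<in> pres_rel R"
proof (induction u)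
  case Nil
  then show ?case by (simp add: pres_rel.refl)
next
  case (Cons l u)
  obtain g e where l: "l = (g, e)" by fastforce
  show ?case
    using pres_rel.trans[OF pres_rel.cancel[of "rev (map (\<lambda>(g, e). (g, \<not> e)) u)" g "\<not> e" u R] Cons]
    by (simp add: l)
qed

theorem group_presented_group: "group (presented_group R)"
proof (rule groupI)
  have one: "\<one>\<^bsub>presented_group R\<^esub> = pres_rel R `` {[]}"
    by (simp add: presented_group_def)
  show "\<one>\<^bsub>presented_group R\<^esub> \<in> carrier (presented_group R)"
    by (simp add: one)
  show "X \<otimes>\<^bsub>presented_group R\<^esub> Y \<in> carrier (presented_group R)"
    if "X \<in> carrier (presented_group R)" "Y \<in> carrier (presented_group R)" for X Y
    using that by (elim presented_group_carrierE) (simp add: presented_group_mult)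
  show "X \<otimes>\<^bsub>presented_group R\<^esub> Y \<otimes>\<^bsub>presented_group R\<^esub> Z
      = X \<otimes>\<^bsub>presented_group R\<^esub> (Y \<otimes>\<^bsub>presented_group R\<^esub> Z)"
    if "X \<in> carrier (presented_group R)" "Y \<in> carrier (presented_group R)"
       "Z \<in> carrier (presented_group R)" for X Y Z
    using that by (elim presented_group_carrierE) (simp add: presented_group_mult)
  show "\<one>\<^bsub>presented_group R\<^esub> \<otimes>\<^bsub>presented_group R\<^esub> X = X"
    if "X \<in> carrier (presented_group R)" for X
    using that by (elim presented_group_carrierE) (simp add: one presented_group_mult)
  show "\<exists>Y\<in>carrier (presented_group R). Y \<otimes>\<^bsub>presented_group R\<^esub> X = \<one>\<^bsub>presented_group R\<^esub>"
    if X: "X \<in> carrier (presented_group R)" for X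
  proof -
    obtain u where u: "X = pres_rel R `` {u}"
      using X by (rule presented_group_carrierE)
    have "pres_rel R `` {rev (map (\<lambda>(g, e). (g, \<not> e)) u)} \<otimes>\<^bsub>presented_group R\<^esub> X
        = \<one>\<^bsub>presented_group R\<^esub>"
      by (simp add: u one presented_group_mult
          equiv_class_eq[OF equiv_pres_rel pres_rel_inverse])
    then show ?thesis by (meson presented_group_class_closed)
  qed
qed

section \<open>The target group\<close>

datatype gen = GA | GB | GC

definition pos_word :: "gen list \<Rightarrow> gen word" where
  "pos_word gs = map (\<lambda>g. (g, True)) gs"

definition Gbar_relations :: "(gen word \<times> gen word) set" where
  "Gbar_relations = map_prod pos_word pos_word `
    {([GA, GA, GB], [GB, GA, GA]),
     ([GA, GA, GC], [GC, GA, GA]),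
     ([GB, GB, GA], [GA, GB, GB]),
     ([GA, GC, GC], [GC, GC, GA]),
     ([GA, GB, GC], [GC, GB, GA]),
     ([GC, GA, GB], [GB, GA, GC])}"

definition Gbar :: "gen word set monoid" where
  "Gbar = presented_group Gbar_relations"

definition gen_elem :: "gen \<Rightarrow> gen word set" where
  "gen_elem g = pres_rel Gbar_relations `` {[(g, True)]}"

definition a :: "gen word set" where "a = gen_elem GA"
definition b :: "gen word set" where "b = gen_elem GB"
definition c :: "gen word set" where "c = gen_elem GC"

definition b' :: "gen word set" where
  "b' = a \<otimes>\<^bsub>Gbar\<^esub> b \<otimes>\<^bsub>Gbar\<^esub> inv\<^bsub>Gbar\<^esub> a"
definition c' :: "gen word set" where
  "c' = a \<otimes>\<^bsub>Gbar\<^esub> c \<otimes>\<^bsub>Gbar\<^esub> inv\<^bsub>Gbar\<^esub> a"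

hide_const (open) a b c b' c'

lemma group_Gbar: "group Gbar"
  unfolding Gbar_def by (rule group_presented_group)

lemma gen_elem_closed [simp]: "gen_elem g \<in> carrier Gbar"
  unfolding gen_elem_def Gbar_def by simp

lemma conj_eq_inverse_conj:
  assumes "g = GB \<or> g = GC"
  shows "gen_elem GA \<otimes>\<^bsub>Gbar\<^esub> gen_elem g \<otimes>\<^bsub>Gbar\<^esub> inv\<^bsub>Gbar\<^esub> gen_elem GA
    = inv\<^bsub>Gbar\<^esub> gen_elem GA \<otimes>\<^bsub>Gbar\<^esub> gen_elem g \<otimes>\<^bsub>Gbar\<^esub> gen_elem GA"
proof -
  interpret group Gbar by (rule group_Gbar)
  have "(pos_word [GA, GA, g], pos_word [g, GA, GA]) \<in> Gbar_relations"
    using assms by (auto simp: Gbar_relations_def)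
  from pres_rel.rel[OF this, of "[]" "[]"]
  have "(pos_word [GA, GA, g], pos_word [g, GA, GA]) \<in> pres_rel Gbar_relations"
    by simp
  from equiv_class_eq[OF equiv_pres_rel this]
  have eq: "gen_elem GA \<otimes>\<^bsub>Gbar\<^esub> gen_elem GA \<otimes>\<^bsub>Gbar\<^esub> gen_elem g
      = gen_elem g \<otimes>\<^bsub>Gbar\<^esub> gen_elem GA \<otimes>\<^bsub>Gbar\<^esub> gen_elem GA"
    by (simp add: gen_elem_def Gbar_def presented_group_mult pos_word_def)
  let ?x = "gen_elem GA" and ?y = "gen_elem g"
  have "?x \<otimes>\<^bsub>Gbar\<^esub> ?y = inv\<^bsub>Gbar\<^esub> ?x \<otimes>\<^bsub>Gbar\<^esub> (?x \<otimes>\<^bsub>Gbar\<^esub> ?x \<otimes>\<^bsub>Gbar\<^esub> ?y)"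
    by (simp add: m_assoc inv_solve_left)
  also have "\<dots> = inv\<^bsub>Gbar\<^esub> ?x \<otimes>\<^bsub>Gbar\<^esub> ?y \<otimes>\<^bsub>Gbar\<^esub> ?x \<otimes>\<^bsub>Gbar\<^esub> ?x"
    by (simp add: eq m_assoc)
  finally show ?thesis
    by (simp add: m_assoc)
qed

lemma b'_alt: "Defs.b' = inv\<^bsub>Gbar\<^esub> Defs.a \<otimes>\<^bsub>Gbar\<^esub> Defs.b \<otimes>\<^bsub>Gbar\<^esub> Defs.a"
  using conj_eq_inverse_conj[of GB] by (simp add: b'_def a_def b_def)

lemma c'_alt: "Defs.c' = inv\<^bsub>Gbar\<^esub> Defs.a \<otimes>\<^bsub>Gbar\<^esub> Defs.c \<otimes>\<^bsub>Gbar\<^esub> Defs.a"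
  using conj_eq_inverse_conj[of GC] by (simp add: c'_def a_def c_def)

section \<open>Smooth maps\<close>

text \<open>Meant for open \<open>S\<close> in a finite-dimensional space, where \<open>Ck_on n S f\<close> says that \<open>f\<close> is
  of class \<open>C\<close> to the \<open>n\<close> on \<open>S\<close>.\<close>

primrec Ck_on :: "nat \<Rightarrow> 'v::real_normed_vector set \<Rightarrow> ('v \<Rightarrow> 'w::real_normed_vector) \<Rightarrow> bool" where
  "Ck_on 0 S f \<longleftrightarrow> continuous_on S f"
| "Ck_on (Suc n) S f \<longleftrightarrow> (\<forall>x\<in>S. f differentiable (at x)) \<and>
     (\<forall>v. Ck_on n S (\<lambda>x. frechet_derivative f (at x) v))"

definition smooth_on :: "'v::real_normed_vector set \<Rightarrow> ('v \<Rightarrow> 'w::real_normed_vector) \<Rightarrow> bool" where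
  "smooth_on S f \<longleftrightarrow> (\<forall>n. Ck_on n S f)"

section \<open>Long knot diagrams on the cylinder\<close>

text \<open>The cylinder is the submanifold \<open>\<real> \<times> S\<^sup>1\<close> of \<open>\<real> \<times> \<complex>\<close>. A map into it is smooth iff it is smooth
  as a map into \<open>\<real> \<times> \<complex>\<close>, and a map out of it is smooth iff its composition with the
  local diffeomorphism \<open>cyl_cover\<close> is.\<close>

definition cylinder :: "(real \<times> complex) set" where
  "cylinder = UNIV \<times> sphere 0 1"

definition cyl_cover :: "real \<times> real \<Rightarrow> real \<times> complex" where
  "cyl_cover = (\<lambda>(x, \<theta>). (x, cis \<theta>))"

text \<open>The area form \<open>dx \<and> d\<theta>\<close>: a tangent vector at \<open>(x, z)\<close> has the form \<open>(s, \<i> * z * t)\<close> with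
  \<open>s\<close> and \<open>t\<close> real, and these are its coordinates.\<close>

definition area_form :: "real \<times> complex \<Rightarrow> real \<times> complex \<Rightarrow> real \<times> complex \<Rightarrow> real" where
  "area_form q v w =
     fst v * Re (snd w / (\<i> * snd q)) - fst w * Re (snd v / (\<i> * snd q))"

text \<open>\<open>over_params K\<close> is the set of those preimages of double points that lie on the over strand.\<close>

record diagram =
  curve :: "real \<Rightarrow> real \<times> complex"
  over_params :: "real set"

definition double_pairs :: "(real \<Rightarrow> real \<times> complex) \<Rightarrow> (real \<times> real) set" where
  "double_pairs f = {(s, t). s \<noteq> t \<and> f s = f t}"

definition tangent :: "(real \<Rightarrow> real \<times> complex) \<Rightarrow> real \<Rightarrow> real \<times> complex" where
  "tangent f t = vector_derivative f (at t)"

definition generic_immersion :: "(real \<Rightarrow> real \<times> complex) \<Rightarrow> bool" where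
  "generic_immersion f \<longleftrightarrow>
     range f \<subseteq> cylinder \<and> smooth_on UNIV f \<and> (\<forall>t. tangent f t \<noteq> 0) \<and>
     finite (double_pairs f) \<and>
     (\<forall>r s t. f r = f s \<and> f s = f t \<longrightarrow> r = s \<or> s = t \<or> r = t) \<and>
     (\<forall>(s, t) \<in> double_pairs f. area_form (f s) (tangent f s) (tangent f t) \<noteq> 0)"

text \<open>\<open>p\<close> is the base point of the circle.\<close>

definition long_knot_diagram :: "complex \<Rightarrow> diagram \<Rightarrow> bool" where
  "long_knot_diagram p K \<longleftrightarrow>
     generic_immersion (curve K) \<and>
     (\<exists>r>0. \<forall>x. \<bar>x\<bar> > r \<longrightarrow> curve K x = (x, p)) \<and>
     over_params K \<subseteq> fst ` double_pairs (curve K) \<and>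
     (\<forall>(s, t) \<in> double_pairs (curve K). s \<in> over_params K \<longleftrightarrow> t \<notin> over_params K)"

section \<open>Planar isotopy and Reidemeister moves\<close>

text \<open>A compactly supported ambient isotopy of the cylinder, together with a change of
  parameter that is the identity near infinity. Only times in the unit interval matter;
  letting \<open>H\<close> be smooth in all real times avoids one-sided derivatives.\<close>

definition planar_isotopic :: "diagram \<Rightarrow> diagram \<Rightarrow> bool" where
  "planar_isotopic K K' \<longleftrightarrow> (\<exists>H \<phi> r.
     smooth_on UNIV (\<lambda>(t, y). H t (cyl_cover y)) \<and>
     (\<forall>t\<in>{0..1}. bij_betw (H t) cylinder cylinder \<and>
        (\<forall>y. inj (frechet_derivative (\<lambda>y. H t (cyl_cover y)) (at y)))) \<and>
     (\<forall>q\<in>cylinder. H 0 q = q) \<and>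
     (\<forall>t\<in>{0..1}. \<forall>q\<in>cylinder. \<bar>fst q\<bar> > r \<longrightarrow> H t q = q) \<and>
     smooth_on UNIV \<phi> \<and> (\<forall>x. deriv \<phi> x > 0) \<and> (\<forall>x::real. \<bar>x\<bar> > r \<longrightarrow> \<phi> x = x) \<and>
     curve K' = H (1::real) \<circ> curve K \<circ> \<phi> \<and> over_params K' = \<phi> -` over_params K)"

abbreviation square :: "(real \<times> real) set" where
  "square \<equiv> {-1..1} \<times> {-1..1}"

text \<open>A disc in the cylinder, parametrized by an embedding of a neighbourhood of the square.
  It may preserve or reverse the orientation.\<close>

definition disc_chart :: "(real \<times> real \<Rightarrow> real \<times> complex) \<Rightarrow> bool" where
  "disc_chart h \<longleftrightarrow> (\<exists>U. open U \<and> square \<subseteq> U \<and> smooth_on U h \<and> inj_on h U \<and>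
     h ` U \<subseteq> cylinder \<and> (\<forall>y\<in>U. inj (frechet_derivative h (at y))))"

definition same_outside :: "(real \<times> real \<Rightarrow> real \<times> complex) \<Rightarrow> real set \<Rightarrow> diagram \<Rightarrow> diagram \<Rightarrow> bool" where
  "same_outside h J K K' \<longleftrightarrow>
     curve K -` (h ` square) = J \<and> curve K' -` (h ` square) = J \<and>
     (\<forall>t. t \<notin> J \<longrightarrow> curve K t = curve K' t \<and> (t \<in> over_params K \<longleftrightarrow> t \<in> over_params K'))"

text \<open>\<open>f\<close> restricted to \<open>I\<close> runs once, in either direction, along the graph of \<open>g\<close> in the disc.\<close>

definition graph_strand ::
  "(real \<times> real \<Rightarrow> real \<times> complex) \<Rightarrow> (real \<Rightarrow> real \<times> complex) \<Rightarrow> real set \<Rightarrow> (real \<Rightarrow> real) \<Rightarrow> bool" where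
  "graph_strand h f I g \<longleftrightarrow> (\<exists>v. smooth_on UNIV v \<and> (\<forall>t\<in>I. deriv v t \<noteq> 0) \<and>
     bij_betw v I {-1..1} \<and> (\<forall>t\<in>I. f t = h (v t, g (v t))))"

text \<open>An arc in a disc with a single double point is, up to isotopy in the disc, an embedded arc
  with one curl, so all oriented variants of the first move are covered.\<close>

definition R1 :: "diagram \<Rightarrow> diagram \<Rightarrow> bool" where
  "R1 K K' \<longleftrightarrow> (\<exists>h \<alpha> \<beta>. disc_chart h \<and> \<alpha> < \<beta> \<and> same_outside h {\<alpha>..\<beta>} K K' \<and>
     inj_on (curve K) {\<alpha>..\<beta>} \<and>
     card {(s, t). \<alpha> \<le> s \<and> s < t \<and> t \<le> \<beta> \<and> curve K' s = curve K' t} = 1)"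

text \<open>Second move: the strand along the graph of \<open>g\<close>, disjoint from the horizontal strand, is
  pushed across it with two crossings, being over at both or under at both.\<close>

definition R2 :: "diagram \<Rightarrow> diagram \<Rightarrow> bool" where
  "R2 K K' \<longleftrightarrow> (\<exists>h \<alpha>1 \<beta>1 \<alpha>2 \<beta>2 g k.
     disc_chart h \<and> {\<alpha>1..\<beta>1} \<inter> {\<alpha>2..\<beta>2} = {} \<and>
     same_outside h ({\<alpha>1..\<beta>1} \<union> {\<alpha>2..\<beta>2}) K K' \<and>
     smooth_on UNIV g \<and> (\<forall>x\<in>{-1..1}. 0 < g x \<and> g x < 1) \<and>
     smooth_on UNIV k \<and> (\<forall>x\<in>{-1..1}. \<bar>k x\<bar> < 1) \<and> card {x\<in>{-1..1}. k x = 0} = 2 \<and>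
     (\<forall>t\<in>{\<alpha>1..\<beta>1}. curve K t = curve K' t) \<and>
     graph_strand h (curve K) {\<alpha>1..\<beta>1} (\<lambda>_. 0) \<and>
     graph_strand h (curve K) {\<alpha>2..\<beta>2} g \<and>
     graph_strand h (curve K') {\<alpha>2..\<beta>2} k \<and>
     (\<exists>is_over. \<forall>s\<in>{\<alpha>1..\<beta>1}. \<forall>t\<in>{\<alpha>2..\<beta>2}.
        curve K' s = curve K' t \<longrightarrow> (t \<in> over_params K' \<longleftrightarrow> is_over)))"

text \<open>\<open>lev i\<close> is the level of the strand with parameter interval \<open>I i\<close>; of two strands, the one
  of the higher level is over where they cross.\<close>

definition layered :: "diagram \<Rightarrow> (nat \<Rightarrow> real set) \<Rightarrow> (nat \<Rightarrow> nat) \<Rightarrow> bool" where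
  "layered K I lev \<longleftrightarrow> (\<forall>i\<in>{1..3}. \<forall>j\<in>{1..3}. \<forall>s\<in>I i. \<forall>t\<in>I j.
     i \<noteq> j \<and> curve K s = curve K t \<longrightarrow> (s \<in> over_params K \<longleftrightarrow> lev j < lev i))"

text \<open>Third move: the third strand passes from one side of the crossing of the first two to the
  other side. By the bound on the slopes it crosses each of the lines \<open>y = x/2\<close> and \<open>y = -x/2\<close>
  exactly once.\<close>

definition R3 :: "diagram \<Rightarrow> diagram \<Rightarrow> bool" where
  "R3 K K' \<longleftrightarrow> (\<exists>h \<alpha> \<beta> I lev g k.
     disc_chart h \<and> I = (\<lambda>i::nat. {\<alpha> i..\<beta> i}) \<and> disjoint_family_on I {1..3} \<and>
     same_outside h (\<Union>i\<in>{1..3}. I i) K K' \<and>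
     smooth_on UNIV g \<and> (\<forall>x\<in>{-1..1}. \<bar>deriv g x\<bar> < 1/2) \<and> g (-1) = 0 \<and> g 1 = 0 \<and> g 0 > 0 \<and>
     smooth_on UNIV k \<and> (\<forall>x\<in>{-1..1}. \<bar>deriv k x\<bar> < 1/2) \<and> k (-1) = 0 \<and> k 1 = 0 \<and> k 0 < 0 \<and>
     (\<forall>t \<in> I 1 \<union> I 2. curve K t = curve K' t) \<and>
     graph_strand h (curve K) (I 1) (\<lambda>x. x/2) \<and>
     graph_strand h (curve K) (I 2) (\<lambda>x. - x/2) \<and>
     graph_strand h (curve K) (I 3) g \<and>
     graph_strand h (curve K') (I 3) k \<and>
     inj_on lev {1..3} \<and> layered K I lev \<and> layered K' I lev)"

definition elementary_move :: "complex \<Rightarrow> diagram \<Rightarrow> diagram \<Rightarrow> bool" where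
  "elementary_move p K K' \<longleftrightarrow> long_knot_diagram p K \<and> long_knot_diagram p K' \<and>
     (planar_isotopic K K' \<or> R1 K K' \<or> R2 K K' \<or> R3 K K')"

definition equivalent_diagrams :: "complex \<Rightarrow> diagram \<Rightarrow> diagram \<Rightarrow> bool" where
  "equivalent_diagrams p = equivclp (elementary_move p)"

section \<open>The linear Gauss diagram\<close>

text \<open>A chord is the pair of its over-endpoint and its under-endpoint.\<close>

definition chords :: "diagram \<Rightarrow> (real \<times> real) set" where
  "chords K = {(s, t) \<in> double_pairs (curve K). s \<in> over_params K}"

definition endpoints :: "(real \<times> real) set \<Rightarrow> real set" where
  "endpoints G = fst ` G \<union> snd ` G"

text \<open>\<open>orient\<close> is \<open>1\<close> or \<open>-1\<close>: the fixed orientation of the cylinder is the one given by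
  \<open>orient\<close> times the area form.\<close>

definition crossing_sign :: "int \<Rightarrow> diagram \<Rightarrow> real \<times> real \<Rightarrow> int" where
  "crossing_sign orient K = (\<lambda>(s, t).
     if of_int orient * area_form (curve K s) (tangent (curve K) s) (tangent (curve K) t) > 0
     then 1 else -1)"

definition linked :: "real \<times> real \<Rightarrow> real \<times> real \<Rightarrow> bool" where
  "linked = (\<lambda>(s, t) (s', t').
     let l = min s t; r = max s t; l' = min s' t'; r' = max s' t'
     in l < l' \<and> l' < r \<and> r < r' \<or> l' < l \<and> l < r' \<and> r' < r)"

definition even_chord :: "(real \<times> real) set \<Rightarrow> real \<times> real \<Rightarrow> bool" where
  "even_chord G d \<longleftrightarrow> even (card {e\<in>G. linked d e})"

definition first_type :: "(real \<times> real) set \<Rightarrow> real \<times> real \<Rightarrow> bool" where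
  "first_type G d \<longleftrightarrow> \<not> even_chord G d \<and> even (card {e\<in>G. linked d e \<and> even_chord G e})"

definition over_elem :: "(real \<times> real) set \<Rightarrow> real \<times> real \<Rightarrow> gen word set" where
  "over_elem G d = (if even_chord G d then Defs.a else if first_type G d then Defs.b else Defs.b')"

definition under_elem :: "(real \<times> real) set \<Rightarrow> real \<times> real \<Rightarrow> gen word set" where
  "under_elem G d = (if even_chord G d then Defs.a else if first_type G d then Defs.c else Defs.c')"

definition chord_at :: "(real \<times> real) set \<Rightarrow> real \<Rightarrow> real \<times> real" where
  "chord_at G t = (THE d. d \<in> G \<and> (fst d = t \<or> snd d = t))"

definition endpoint_letter :: "int \<Rightarrow> diagram \<Rightarrow> real \<Rightarrow> gen word set" where
  "endpoint_letter orient K t =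
    (let G = chords K; d = chord_at G t; i = crossing_sign orient K d
     in if fst d = t then over_elem G d [^]\<^bsub>Gbar\<^esub> i else under_elem G d [^]\<^bsub>Gbar\<^esub> (- i))"

definition phi_bar :: "int \<Rightarrow> diagram \<Rightarrow> gen word set" where
  "phi_bar orient K =
     foldr (\<lambda>t x. endpoint_letter orient K t \<otimes>\<^bsub>Gbar\<^esub> x)
       (sorted_list_of_set (endpoints (chords K))) \<one>\<^bsub>Gbar\<^esub>"

end

theory Submission
  imports Defs
begin

text \<open>
  For an endpoint \<open>t\<close> of a chord let its rank be the number of endpoints before it. A chord is even
  iff the sum of the ranks of its two ends is odd, and an odd chord is of the first type iff the sum
  of its ranks among the endpoints of even chords is even. A Reidemeister move changes the endpoints
  only in one, two or three disjoint intervals of the line and preserves the parity of the number of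
  (even) endpoints in each of them, so every chord away from the disc keeps its letters and it is
  enough to compare the product over each interval. For the first two moves the new letters cancel
  in adjacent pairs. For the third move each interval contains two endpoints, which are swapped.
  The number of even chords in the triangle is odd, since the sum of the six ranks is, hence the
  three chords keep their parity and the odd ones change their type; the relations of the group say
  precisely that \<open>x\<^sup>n y\<^sup>m = y'\<^sup>m x'\<^sup>n\<close> for any two letters \<open>x\<close>, \<open>y\<close> and exponents
  \<open>n\<close>, \<open>m\<close> equal to \<open>1\<close> or \<open>-1\<close>, where the prime changes the type of an odd letter.

  The signs are read off from the Jacobian of a chart, which does not vanish and so has a constant
  sign on a connected set: the disc of a move, or the whole universal cover for a planar isotopy,
  which is the identity far out.
\<close>

section \<open>Products along an ordered finite set\<close>

text \<open>The parity and the type of a chord are defined by counting linked chords, a global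
  condition that is awkward to follow through a move. Ranks replace it by data of single endpoints.
  Modulo 2, the number of endpoints strictly between the two ends of a chord is the number of chords
  linked with it, since an unlinked chord contributes 0 or 2. Passing from this number to the sum of
  the two ranks costs one, because the earlier end is itself counted by the rank of the later one;
  hence the odd sum for an even chord. The correction is absent for the type, where only ends of
  even chords are counted and the chord itself is odd. A second obstacle is that the chart of a move
  may reverse the orientation and that the strands may run in either direction. Every crossing sign
  inside a disc is therefore factored into the directions of the two strands, the sign of the
  Jacobian and the sign of a difference of slopes, so that the two sides of a move are compared
  without listing its oriented variants.\<close>

lemma sorted_list_of_set_Un_less:
  fixes A B :: "'a::linorder set"
  assumes "finite A" "finite B" "\<And>x y. x \<in> A \<Longrightarrow> y \<in> B \<Longrightarrow> x < y"
  shows "sorted_list_of_set (A \<union> B) = sorted_list_of_set A @ sorted_list_of_set B"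
proof (rule sorted_distinct_set_unique)
  show "sorted (sorted_list_of_set A @ sorted_list_of_set B)"
    using assms by (simp add: sorted_append less_imp_le)
  show "distinct (sorted_list_of_set A @ sorted_list_of_set B)"
    using assms by fastforce
qed (use assms in simp_all)

context monoid
begin

text \<open>Has the shape of the product in \<open>phi_bar\<close>, so that unfolding both is enough
  to match them.\<close>

definition ordered_prod :: "'i::linorder set \<Rightarrow> ('i \<Rightarrow> 'a) \<Rightarrow> 'a" where
  "ordered_prod E f =
     foldr (\<lambda>t x. f t \<otimes> x) (sorted_list_of_set E) \<one>"

lemma foldr_mult_closed:
  assumes "\<And>t. t \<in> set ts \<Longrightarrow> f t \<in> carrier G"
  shows "foldr (\<lambda>t x. f t \<otimes> x) ts \<one> \<in> carrier G"
  using assms by (induction ts) auto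

lemma foldr_mult_append:
  assumes "\<And>t. t \<in> set (ts @ us) \<Longrightarrow> f t \<in> carrier G"
  shows "foldr (\<lambda>t x. f t \<otimes> x) (ts @ us) \<one>
    = foldr (\<lambda>t x. f t \<otimes> x) ts \<one>
      \<otimes> foldr (\<lambda>t x. f t \<otimes> x) us \<one>"
  using assms
proof (induction ts)
  case Nil
  then show ?case using foldr_mult_closed[of us f] by simp
next
  case (Cons t ts)
  then show ?case
    using foldr_mult_closed[of us f] foldr_mult_closed[of ts f] by (simp add: m_assoc)
qed

lemma ordered_prod_empty [simp]: "ordered_prod {} f = \<one>"
  by (simp add: ordered_prod_def)

lemma ordered_prod_Un:
  assumes "finite A" "finite B" "\<And>x y. x \<in> A \<Longrightarrow> y \<in> B \<Longrightarrow> x < y"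
    and "\<And>t. t \<in> A \<union> B \<Longrightarrow> f t \<in> carrier G"
  shows "ordered_prod (A \<union> B) f = ordered_prod A f \<otimes> ordered_prod B f"
proof -
  have "sorted_list_of_set (A \<union> B) = sorted_list_of_set A @ sorted_list_of_set B"
    using assms(1-3) by (rule sorted_list_of_set_Un_less)
  have "\<And>t. t \<in> set (sorted_list_of_set A @ sorted_list_of_set B) \<Longrightarrow> f t \<in> carrier G"
    using assms by simp
  from foldr_mult_append[OF this] show ?thesis
    by (simp only: ordered_prod_def \<open>sorted_list_of_set (A \<union> B) = _\<close>)
qed

lemma ordered_prod_pair:
  assumes "x < y" "f x \<in> carrier G" "f y \<in> carrier G"
  shows "ordered_prod {x, y} f = f x \<otimes> f y"
proof -
  have "sorted_list_of_set {x, y} = [x, y]"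
    using assms(1) by (intro sorted_distinct_set_unique) auto
  then show ?thesis
    using assms by (simp add: ordered_prod_def)
qed

lemma ordered_prod_cong:
  assumes "finite E" "E = E'" "\<And>t. t \<in> E \<Longrightarrow> f t = f' t"
  shows "ordered_prod E f = ordered_prod E' f'"
  unfolding ordered_prod_def assms(2)[symmetric]
  using assms by (intro foldr_cong) simp_all

lemma ordered_prod_reindex:
  assumes "finite E" "strict_mono \<phi>"
  shows "ordered_prod (\<phi> ` E) f = ordered_prod E (f \<circ> \<phi>)"
proof -
  have "sorted_list_of_set (\<phi> ` E) = map \<phi> (sorted_list_of_set E)"
    using assms
    by (intro sorted_distinct_set_unique)
      (auto simp: sorted_map distinct_map strict_mono_less_eq
        intro: inj_on_subset[OF strict_mono_imp_inj_on])
  then show ?thesis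
    by (simp add: ordered_prod_def foldr_map comp_def)
qed

lemma ordered_prod_split:
  assumes "finite E" "\<alpha> \<le> \<beta>" "\<And>t. t \<in> E \<Longrightarrow> f t \<in> carrier G"
  shows "ordered_prod E f = ordered_prod (E \<inter> {..<\<alpha>}) f
    \<otimes> (ordered_prod (E \<inter> {\<alpha>..\<beta>}) f \<otimes> ordered_prod (E \<inter> {\<beta><..}) f)"
proof -
  have "E = (E \<inter> {..<\<alpha>}) \<union> ((E \<inter> {\<alpha>..\<beta>}) \<union> (E \<inter> {\<beta><..}))"
    by auto
  then have "ordered_prod E f = ordered_prod ((E \<inter> {..<\<alpha>}) \<union> ((E \<inter> {\<alpha>..\<beta>}) \<union> (E \<inter> {\<beta><..}))) f"
    by simp
  also have "\<dots> = ordered_prod (E \<inter> {..<\<alpha>}) f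
      \<otimes> ordered_prod ((E \<inter> {\<alpha>..\<beta>}) \<union> (E \<inter> {\<beta><..})) f"
    using assms by (intro ordered_prod_Un) auto
  also have "ordered_prod ((E \<inter> {\<alpha>..\<beta>}) \<union> (E \<inter> {\<beta><..})) f
      = ordered_prod (E \<inter> {\<alpha>..\<beta>}) f \<otimes> ordered_prod (E \<inter> {\<beta><..}) f"
    using assms by (intro ordered_prod_Un) auto
  finally show ?thesis .
qed

lemma ordered_prod_replace_interval:
  assumes "finite E" "finite E'" "\<alpha> \<le> \<beta>"
    and "\<And>t. t \<in> E \<Longrightarrow> f t \<in> carrier G" "\<And>t. t \<in> E' \<Longrightarrow> f' t \<in> carrier G"
    and eq: "\<And>t. t \<notin> {\<alpha>..\<beta>} \<Longrightarrow> t \<in> E \<longleftrightarrow> t \<in> E'" "\<And>t. t \<in> E \<Longrightarrow> t \<notin> {\<alpha>..\<beta>} \<Longrightarrow> f t = f' t"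
    and "ordered_prod (E \<inter> {\<alpha>..\<beta>}) f = ordered_prod (E' \<inter> {\<alpha>..\<beta>}) f'"
  shows "ordered_prod E f = ordered_prod E' f'"
proof -
  have "ordered_prod (E \<inter> {..<\<alpha>}) f = ordered_prod (E' \<inter> {..<\<alpha>}) f'"
  proof (rule ordered_prod_cong)
    have "t \<in> E \<longleftrightarrow> t \<in> E'" if "t < \<alpha>" for t
      using that by (intro eq(1)) auto
    then show "E \<inter> {..<\<alpha>} = E' \<inter> {..<\<alpha>}"
      by blast
    show "f t = f' t" if "t \<in> E \<inter> {..<\<alpha>}" for t
      using that by (intro eq(2)) auto
  qed (use assms(1) in simp)
  moreover have "ordered_prod (E \<inter> {\<beta><..}) f = ordered_prod (E' \<inter> {\<beta><..}) f'"
  proof (rule ordered_prod_cong)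
    have "t \<in> E \<longleftrightarrow> t \<in> E'" if "\<beta> < t" for t
      using that by (intro eq(1)) auto
    then show "E \<inter> {\<beta><..} = E' \<inter> {\<beta><..}"
      by blast
    show "f t = f' t" if "t \<in> E \<inter> {\<beta><..}" for t
      using that by (intro eq(2)) auto
  qed (use assms(1) in simp)
  ultimately show ?thesis
    using ordered_prod_split[OF assms(1,3,4)] ordered_prod_split[OF assms(2,3,5)] assms(8) by simp
qed

lemma ordered_prod_replace_intervals:
  assumes "finite N" "finite E" "finite E'"
    and "\<And>i. i \<in> N \<Longrightarrow> \<alpha> i \<le> \<beta> i" "disjoint_family_on (\<lambda>i. {\<alpha> i..\<beta> i}) N"
    and "\<And>t. t \<in> E \<Longrightarrow> f t \<in> carrier G" "\<And>t. t \<in> E' \<Longrightarrow> f' t \<in> carrier G"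
    and "\<And>t. t \<notin> (\<Union>i\<in>N. {\<alpha> i..\<beta> i}) \<Longrightarrow> t \<in> E \<longleftrightarrow> t \<in> E'"
    and "\<And>t. t \<in> E \<Longrightarrow> t \<notin> (\<Union>i\<in>N. {\<alpha> i..\<beta> i}) \<Longrightarrow> f t = f' t"
    and "\<And>i. i \<in> N \<Longrightarrow>
      ordered_prod (E \<inter> {\<alpha> i..\<beta> i}) f = ordered_prod (E' \<inter> {\<alpha> i..\<beta> i}) f'"
  shows "ordered_prod E f = ordered_prod E' f'"
  using assms
proof (induction N arbitrary: E f rule: finite_induct)
  case empty
  then show ?case by (intro ordered_prod_cong) auto
next
  case (insert i N)
  define I where "I j = {\<alpha> j..\<beta> j}" for j
  \<comment> \<open>A hybrid of the two sides: the new data on the interval \<open>I i\<close>, the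
    old data elsewhere. It differs from the old side on that one interval only, and from the new
    side only on the intervals indexed by \<open>N\<close>, where the induction hypothesis
    applies.\<close>
  define E'' where "E'' = (E - I i) \<union> (E' \<inter> I i)"
  define f'' where "f'' = (\<lambda>t. if t \<in> I i then f' t else f t)"
  have disj: "I i \<inter> I j = {}" if "j \<in> N" for j
    using disjoint_family_onD[OF insert.prems(4), of i j] insert.hyps(2) that by (auto simp: I_def)
  have fin: "finite E''"
    using insert.prems(1,2) by (simp add: E''_def)
  have car: "f'' t \<in> carrier G" if "t \<in> E''" for t
    using that insert.prems(5,6)[of t] by (auto simp: E''_def f''_def split: if_splits)
  have "ordered_prod E f = ordered_prod E'' f''"
  proof (rule ordered_prod_replace_interval[of _ _ "\<alpha> i" "\<beta> i"])
    have "ordered_prod (E' \<inter> I i) f' = ordered_prod (E'' \<inter> I i) f''"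
      using insert.prems(2) by (intro ordered_prod_cong) (auto simp: E''_def f''_def)
    then show "ordered_prod (E \<inter> {\<alpha> i..\<beta> i}) f = ordered_prod (E'' \<inter> {\<alpha> i..\<beta> i}) f''"
      using insert.prems(9)[of i] by (simp add: I_def)
    show "t \<in> E \<longleftrightarrow> t \<in> E''" if "t \<notin> {\<alpha> i..\<beta> i}" for t
      using that by (auto simp: E''_def I_def)
    show "f t = f'' t" if "t \<notin> {\<alpha> i..\<beta> i}" for t
      using that by (auto simp: f''_def I_def)
    show "f t \<in> carrier G" if "t \<in> E" for t
      using that by (rule insert.prems(5))
  qed (use insert.prems(1,2,3) fin in \<open>simp_all add: car\<close>)
  also have "\<dots> = ordered_prod E' f'"
  proof (rule insert.IH)
    show "disjoint_family_on (\<lambda>i. {\<alpha> i..\<beta> i}) N"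
      using insert.prems(4) by (auto simp: disjoint_family_on_def)
    show "t \<in> E'' \<longleftrightarrow> t \<in> E'" if "t \<notin> (\<Union>i\<in>N. {\<alpha> i..\<beta> i})" for t
    proof (cases "t \<in> I i")
      case False
      with that insert.prems(7)[of t] show ?thesis by (auto simp: E''_def I_def)
    qed (simp add: E''_def)
    show "f'' t = f' t" if "t \<in> E''" "t \<notin> (\<Union>i\<in>N. {\<alpha> i..\<beta> i})" for t
    proof (cases "t \<in> I i")
      case False
      with that insert.prems(8)[of t] show ?thesis by (auto simp: E''_def f''_def I_def)
    qed (simp add: f''_def)
    show "f' t \<in> carrier G" if "t \<in> E'" for t
      using that by (rule insert.prems(6))
    show "\<alpha> j \<le> \<beta> j" if "j \<in> N" for j
      using that insert.prems(3) by simp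
    show "ordered_prod (E'' \<inter> {\<alpha> j..\<beta> j}) f'' = ordered_prod (E' \<inter> {\<alpha> j..\<beta> j}) f'"
      if "j \<in> N" for j
    proof -
      have "ordered_prod (E'' \<inter> I j) f'' = ordered_prod (E \<inter> I j) f"
        using disj[OF that] fin by (intro ordered_prod_cong) (auto simp: E''_def f''_def)
      then show ?thesis
        using insert.prems(9)[of j] that by (simp add: I_def)
    qed
  qed (use insert.prems(2) fin in \<open>simp_all add: car\<close>)
  finally show ?case .
qed

end

interpretation Gbar: group Gbar
  by (rule group_Gbar)

section \<open>Letters in the target group\<close>

lemma generators_closed [simp]:
  "Defs.a \<in> carrier Gbar" "Defs.b \<in> carrier Gbar" "Defs.c \<in> carrier Gbar"
  "Defs.b' \<in> carrier Gbar" "Defs.c' \<in> carrier Gbar"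
  by (simp_all add: a_def b_def c_def b'_def c'_def)

text \<open>Flags in place of the letters themselves: the change of type becomes the negation of
  \<open>first\<close>, which has no effect on an even chord, so one formula covers all kinds of
  endpoints.\<close>

definition letter_base :: "bool \<Rightarrow> bool \<Rightarrow> bool \<Rightarrow> gen word set" where
  "letter_base over ev first =
     (if ev then Defs.a
      else if over then (if first then Defs.b else Defs.b')
      else (if first then Defs.c else Defs.c'))"

lemma letter_base_closed [simp]: "letter_base over ev first \<in> carrier Gbar"
  by (simp add: letter_base_def)

lemma Gbar_rel:
  assumes "(us, vs) \<in> {([GA, GA, GB], [GB, GA, GA]), ([GA, GA, GC], [GC, GA, GA]),
     ([GB, GB, GA], [GA, GB, GB]), ([GA, GC, GC], [GC, GC, GA]),
     ([GA, GB, GC], [GC, GB, GA]), ([GC, GA, GB], [GB, GA, GC])}"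
  shows "pres_rel Gbar_relations `` {pos_word us} = pres_rel Gbar_relations `` {pos_word vs}"
proof -
  have "(pos_word us, pos_word vs) \<in> Gbar_relations"
    using imageI[OF assms, of "map_prod pos_word pos_word"]
    by (simp only: Gbar_relations_def map_prod_simp)
  from pres_rel.rel[OF this, of "[]" "[]"] show ?thesis
    by (intro equiv_class_eq[OF equiv_pres_rel]) simp
qed

lemma Gbar_triple:
  "pres_rel Gbar_relations `` {pos_word [x, y, z]}
     = gen_elem x \<otimes>\<^bsub>Gbar\<^esub> (gen_elem y \<otimes>\<^bsub>Gbar\<^esub> gen_elem z)"
  by (simp add: gen_elem_def Gbar_def presented_group_mult pos_word_def)

abbreviation gmult (infixl "\<cdot>" 70) where "x \<cdot> y \<equiv> x \<otimes>\<^bsub>Gbar\<^esub> y"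

lemma Gbar_relations_hold:
  "Defs.a \<cdot> (Defs.a \<cdot> Defs.b) = Defs.b \<cdot> (Defs.a \<cdot> Defs.a)"
  "Defs.a \<cdot> (Defs.a \<cdot> Defs.c) = Defs.c \<cdot> (Defs.a \<cdot> Defs.a)"
  "Defs.b \<cdot> (Defs.b \<cdot> Defs.a) = Defs.a \<cdot> (Defs.b \<cdot> Defs.b)"
  "Defs.a \<cdot> (Defs.c \<cdot> Defs.c) = Defs.c \<cdot> (Defs.c \<cdot> Defs.a)"
  "Defs.a \<cdot> (Defs.b \<cdot> Defs.c) = Defs.c \<cdot> (Defs.b \<cdot> Defs.a)"
  "Defs.c \<cdot> (Defs.a \<cdot> Defs.b) = Defs.b \<cdot> (Defs.a \<cdot> Defs.c)"
  using Gbar_rel[of "[GA, GA, GB]" "[GB, GA, GA]"] Gbar_rel[of "[GA, GA, GC]" "[GC, GA, GA]"]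
    Gbar_rel[of "[GB, GB, GA]" "[GA, GB, GB]"] Gbar_rel[of "[GA, GC, GC]" "[GC, GC, GA]"]
    Gbar_rel[of "[GA, GB, GC]" "[GC, GB, GA]"] Gbar_rel[of "[GC, GA, GB]" "[GB, GA, GC]"]
  by (simp_all add: Gbar_triple a_def b_def c_def)

text \<open>Conjugation in the form \<open>a b a^-1\<close> gives the first and third equations, in
  the form \<open>a^-1 b a\<close> the other two. Moving \<open>a\<close> past an odd letter thus
  toggles the prime, which is the exchange law when one of the two letters is even.\<close>

lemma primed_commute:
  "Defs.b' \<cdot> Defs.a = Defs.a \<cdot> Defs.b" "Defs.a \<cdot> Defs.b' = Defs.b \<cdot> Defs.a"
  "Defs.c' \<cdot> Defs.a = Defs.a \<cdot> Defs.c" "Defs.a \<cdot> Defs.c' = Defs.c \<cdot> Defs.a"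
proof -
  show "Defs.b' \<cdot> Defs.a = Defs.a \<cdot> Defs.b" "Defs.c' \<cdot> Defs.a = Defs.a \<cdot> Defs.c"
    by (simp_all add: b'_def c'_def Gbar.m_assoc)
  show "Defs.a \<cdot> Defs.b' = Defs.b \<cdot> Defs.a" "Defs.a \<cdot> Defs.c' = Defs.c \<cdot> Defs.a"
    by (simp_all add: b'_alt c'_alt Gbar.m_assoc[symmetric])
qed



lemma primed_commute_left:
  assumes "x \<in> carrier Gbar"
  shows "Defs.b' \<cdot> (Defs.a \<cdot> x) = Defs.a \<cdot> (Defs.b \<cdot> x)"
    "Defs.c' \<cdot> (Defs.a \<cdot> x) = Defs.a \<cdot> (Defs.c \<cdot> x)"
  using assms by (simp_all add: primed_commute Gbar.m_assoc[symmetric])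

text \<open>Multiplying by \<open>a\<close> and moving that factor through the word removes the
  primes; what remains is an identity between words in \<open>a\<close>, \<open>b\<close>,
  \<open>c\<close> that the relations decide. These are the cases of the exchange law with two odd
  letters.\<close>

lemma primed_exchange:
  "Defs.b \<cdot> Defs.b = Defs.b' \<cdot> Defs.b'" "Defs.c \<cdot> Defs.c = Defs.c' \<cdot> Defs.c'"
  "Defs.b \<cdot> Defs.c = Defs.c' \<cdot> Defs.b'" "Defs.b \<cdot> Defs.c' = Defs.c \<cdot> Defs.b'"
  "Defs.c \<cdot> Defs.b = Defs.b' \<cdot> Defs.c'" "Defs.b' \<cdot> Defs.c = Defs.c' \<cdot> Defs.b"
proof -
  have cancel: "x = y" if "x \<cdot> Defs.a = y \<cdot> Defs.a" "x \<in> carrier Gbar" "y \<in> carrier Gbar" for x y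
    using that by simp
  note simps = primed_commute primed_commute_left Gbar.m_assoc
  show "Defs.b \<cdot> Defs.b = Defs.b' \<cdot> Defs.b'" "Defs.c \<cdot> Defs.c = Defs.c' \<cdot> Defs.c'"
    by (rule cancel; simp add: simps Gbar_relations_hold)+
  show "Defs.b \<cdot> Defs.c' = Defs.c \<cdot> Defs.b'"
    by (rule cancel; simp add: simps Gbar_relations_hold)
  show "Defs.c \<cdot> Defs.b = Defs.b' \<cdot> Defs.c'"
    by (rule cancel; simp add: simps Gbar_relations_hold)
  \<comment> \<open>The prime sits on the left factor, out of reach of an \<open>a\<close> on the
    right, so the equation is multiplied by \<open>a\<close> on the left as well.\<close>
  have "Defs.a \<cdot> (Defs.b' \<cdot> Defs.c) \<cdot> Defs.a = Defs.b \<cdot> (Defs.a \<cdot> Defs.c) \<cdot> Defs.a"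
    by (simp add: primed_commute Gbar.m_assoc[symmetric])
  also have "\<dots> = Defs.c \<cdot> (Defs.a \<cdot> Defs.b) \<cdot> Defs.a"
    by (simp add: Gbar_relations_hold)
  also have "\<dots> = Defs.a \<cdot> (Defs.c' \<cdot> Defs.b) \<cdot> Defs.a"
    by (simp add: primed_commute Gbar.m_assoc[symmetric])
  finally show "Defs.b' \<cdot> Defs.c = Defs.c' \<cdot> Defs.b"
    by simp
  \<comment> \<open>Removing the primes leaves \<open>bca = acb\<close>, which is not a defining
    relation. It follows from \<open>abc = cba\<close> because the square of \<open>a\<close>
    commutes with \<open>b\<close> and with \<open>c\<close>.\<close>
  have "Defs.a \<cdot> (Defs.b \<cdot> (Defs.c \<cdot> Defs.a)) = (Defs.a \<cdot> (Defs.b \<cdot> Defs.c)) \<cdot> Defs.a"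
    by (simp add: Gbar.m_assoc)
  also have "\<dots> = Defs.c \<cdot> (Defs.b \<cdot> (Defs.a \<cdot> Defs.a))"
    by (simp add: Gbar_relations_hold Gbar.m_assoc)
  also have "\<dots> = Defs.c \<cdot> (Defs.a \<cdot> Defs.a) \<cdot> Defs.b"
    by (simp add: Gbar_relations_hold(1)[symmetric] Gbar.m_assoc)
  also have "\<dots> = Defs.a \<cdot> (Defs.a \<cdot> (Defs.c \<cdot> Defs.b))"
    by (simp add: Gbar_relations_hold(2)[symmetric] Gbar.m_assoc)
  finally have "Defs.b \<cdot> (Defs.c \<cdot> Defs.a) = Defs.a \<cdot> (Defs.c \<cdot> Defs.b)"
    by simp
  then show "Defs.b \<cdot> Defs.c = Defs.c' \<cdot> Defs.b'"
    by - (rule cancel, simp_all add: simps)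
qed

lemma letter_base_exchange:
  "letter_base o1 e1 f1 \<cdot> letter_base o2 e2 f2
    = letter_base o2 e2 (\<not> f2) \<cdot> letter_base o1 e1 (\<not> f1)"
  by (cases e1; cases e2; cases o1; cases o2; cases f1; cases f2)
    (simp_all add: letter_base_def primed_commute primed_exchange)

text \<open>With the prime as an involution, the four equations are one law, applied to the pairs
  \<open>(x, y)\<close>, \<open>(y', x)\<close>, \<open>(y, x')\<close> and \<open>(y, x)\<close>.
  Each of the four sign patterns of the exponents comes from one of them, by moving factors across
  the equation.\<close>

lemma (in group) exchange_int_pow:
  fixes n m :: int
  assumes "x \<in> carrier G" "y \<in> carrier G" "x' \<in> carrier G" "y' \<in> carrier G"
    and xy: "x \<otimes> y = y' \<otimes> x'" "y' \<otimes> x = x' \<otimes> y" "y \<otimes> x' = x \<otimes> y'" "y \<otimes> x = x' \<otimes> y'"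
    and "n \<in> {1, -1}" "m \<in> {1, -1}"
  shows "x [^] n \<otimes> y [^] m = y' [^] m \<otimes> x' [^] n"
proof -
  have flip: "u \<otimes> inv v = inv w \<otimes> z"
    if "w \<otimes> u = z \<otimes> v" "u \<in> carrier G" "v \<in> carrier G" "w \<in> carrier G" "z \<in> carrier G" for u v w z
  proof -
    have "u = inv w \<otimes> (z \<otimes> v)"
      using inv_solve_left[of u w "z \<otimes> v"] that by simp
    then show ?thesis using that(2-) by (simp add: m_assoc)
  qed
  have "inv x \<otimes> y = y' \<otimes> inv x'"
    using flip[of x y' y x'] xy(3) assms(1-4) by simp
  moreover have "x \<otimes> inv y = inv y' \<otimes> x'"
    using flip[of y' x x' y] xy(2) assms(1-4) by simp
  moreover have "inv x \<otimes> inv y = inv y' \<otimes> inv x'"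
    using arg_cong[OF xy(4), of "\<lambda>z. inv z"] assms(1-4) by (simp add: inv_mult_group)
  ultimately show ?thesis
    using assms by (auto simp: int_pow_neg int_pow_1)
qed

text \<open>This is what makes the third Reidemeister move work: it swaps two adjacent endpoints, and
  the odd ones among the three chords involved change their type.\<close>

lemma letter_base_exchange_int_pow:
  fixes n m :: int
  assumes "n \<in> {1, -1}" "m \<in> {1, -1}"
  shows "letter_base o1 e1 f1 [^]\<^bsub>Gbar\<^esub> n \<cdot> letter_base o2 e2 f2 [^]\<^bsub>Gbar\<^esub> m
    = letter_base o2 e2 (\<not> f2) [^]\<^bsub>Gbar\<^esub> m \<cdot> letter_base o1 e1 (\<not> f1) [^]\<^bsub>Gbar\<^esub> n"
  using letter_base_exchange[of o1 e1 f1 o2 e2 f2] letter_base_exchange[of o2 e2 "\<not> f2" o1 e1 f1]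
    letter_base_exchange[of o2 e2 f2 o1 e1 "\<not> f1"] letter_base_exchange[of o2 e2 f2 o1 e1 f1]
  by (intro Gbar.exchange_int_pow assms) simp_all

section \<open>Parity and type through ranks of endpoints\<close>

definition end_rank :: "real set \<Rightarrow> real \<Rightarrow> nat" where
  "end_rank E z = card {y\<in>E. y < z}"

definition even_end :: "real set \<Rightarrow> (real \<Rightarrow> real) \<Rightarrow> real \<Rightarrow> bool" where
  "even_end E m t \<longleftrightarrow> odd (end_rank E t + end_rank E (m t))"

definition even_ends :: "real set \<Rightarrow> (real \<Rightarrow> real) \<Rightarrow> real set" where
  "even_ends E m = {t\<in>E. even_end E m t}"

definition first_end :: "real set \<Rightarrow> (real \<Rightarrow> real) \<Rightarrow> real \<Rightarrow> bool" where
  "first_end E m t \<longleftrightarrow> even (end_rank (even_ends E m) t + end_rank (even_ends E m) (m t))"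

definition end_letter ::
  "real set \<Rightarrow> (real \<Rightarrow> real) \<Rightarrow> real set \<Rightarrow> (real \<Rightarrow> int) \<Rightarrow> real \<Rightarrow> gen word set" where
  "end_letter E m ov sg t = letter_base (t \<in> ov) (even_end E m t) (first_end E m t)
     [^]\<^bsub>Gbar\<^esub> (if t \<in> ov then sg t else - sg t)"

definition gauss_prod ::
  "real set \<Rightarrow> (real \<Rightarrow> real) \<Rightarrow> real set \<Rightarrow> (real \<Rightarrow> int) \<Rightarrow> gen word set" where
  "gauss_prod E m ov sg = Gbar.ordered_prod E (end_letter E m ov sg)"

lemma end_letter_closed [simp]: "end_letter E m ov sg t \<in> carrier Gbar"
  by (simp add: end_letter_def)

text \<open>A linear Gauss diagram with the chords encoded by the fixed-point-free involution
  \<open>m\<close> on the endpoints. All data are attached to points of the line, so a move becomes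
  a local change of sets and functions.\<close>

locale gauss_data =
  fixes E :: "real set" and m :: "real \<Rightarrow> real" and ov :: "real set" and sg :: "real \<Rightarrow> int"
  assumes finite_ends: "finite E"
    and mate_in: "t \<in> E \<Longrightarrow> m t \<in> E"
    and mate_mate: "t \<in> E \<Longrightarrow> m (m t) = t"
    and mate_neq: "t \<in> E \<Longrightarrow> m t \<noteq> t"
    and over_mate: "t \<in> E \<Longrightarrow> m t \<in> ov \<longleftrightarrow> t \<notin> ov"
    and sign_mate: "t \<in> E \<Longrightarrow> sg (m t) = sg t"
    and sign_unit: "sg t \<in> {1, -1}"
begin

lemma even_end_mate: "t \<in> E \<Longrightarrow> even_end E m (m t) = even_end E m t"
  by (simp add: even_end_def mate_mate add.commute)

lemma first_end_mate: "t \<in> E \<Longrightarrow> first_end E m (m t) = first_end E m t"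
  by (simp add: first_end_def mate_mate add.commute)

end

section \<open>Parities of ranks under a change confined to disjoint intervals\<close>

lemma even_sum_cong:
  fixes f g :: "'i \<Rightarrow> nat"
  assumes "\<And>i. i \<in> N \<Longrightarrow> even (f i) \<longleftrightarrow> even (g i)"
  shows "even (sum f N) \<longleftrightarrow> even (sum g N)"
  using assms by (induction N rule: infinite_finite_induct) auto

lemma rank_below:
  assumes "z < \<alpha>"
  shows "end_rank (E \<inter> {\<alpha>..\<beta>}) z = 0"
proof -
  have "{y \<in> E \<inter> {\<alpha>..\<beta>}. y < z} = {}"
    using assms by auto
  then show ?thesis
    by (simp only: end_rank_def card.empty)
qed

lemma rank_above: "\<beta> < z \<Longrightarrow> end_rank (E \<inter> {\<alpha>..\<beta>}) z = card (E \<inter> {\<alpha>..\<beta>})"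
  unfolding end_rank_def by (intro arg_cong[of _ _ card]) auto

text \<open>No endpoint lies between the two, so the ranks differ by one. Stated through parity,
  this is symmetric in \<open>x\<close> and \<open>y\<close>.\<close>

lemma rank_adjacent:
  assumes "finite E" "E \<inter> {\<alpha>..\<beta>} = {x, y}" "x \<noteq> y"
  shows "even (end_rank E x) \<longleftrightarrow> odd (end_rank E y)"
proof -
  have *: "end_rank E y = Suc (end_rank E x)" if xy: "E \<inter> {\<alpha>..\<beta>} = {x, y}" "x < y" for x y
  proof -
    have "{z\<in>E. z < y} = insert x {z\<in>E. z < x}"
    proof (rule Set.set_eqI)
      fix z
      have "x \<in> E \<inter> {\<alpha>..\<beta>}" "y \<in> E \<inter> {\<alpha>..\<beta>}"
        using xy by auto
      then have "z \<in> {x, y}" if "z \<in> E" "x \<le> z" "z < y"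
        using that unfolding xy(1)[symmetric] by simp
      then show "z \<in> {z\<in>E. z < y} \<longleftrightarrow> z \<in> insert x {z\<in>E. z < x}"
        using xy(2) \<open>x \<in> E \<inter> _\<close> by force
    qed
    then show ?thesis
      using assms(1) by (simp add: end_rank_def)
  qed
  show ?thesis
  proof (cases "x < y")
    case True
    then show ?thesis using *[of x y] assms(2) by simp
  next
    case False
    then show ?thesis using *[of y x] assms(2,3) by (simp add: insert_commute)
  qed
qed

lemma rank_empty_interval:
  assumes "E \<inter> {\<alpha>..\<beta>} = {}" "x \<in> {\<alpha>..\<beta>}" "y \<in> {\<alpha>..\<beta>}"
  shows "end_rank E x = end_rank E y"
proof -
  have "z \<notin> {\<alpha>..\<beta>}" if "z \<in> E" for z
    using that assms(1) by blast
  then have "{z\<in>E. z < x} = {z\<in>E. z < y}"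
    using assms(2,3) by force
  then show ?thesis by (simp add: end_rank_def)
qed

text \<open>Used twice for each move: with all endpoints to control the parity of chords, and with
  the endpoints of even chords to control their type. For this reason it speaks of bare sets of
  points, without a pairing.\<close>

locale interval_change =
  fixes N :: "nat set" and \<alpha> \<beta> :: "nat \<Rightarrow> real" and E E' :: "real set"
  assumes finite_N: "finite N"
    and \<alpha>_le_\<beta>: "i \<in> N \<Longrightarrow> \<alpha> i \<le> \<beta> i"
    and disjoint: "disjoint_family_on (\<lambda>i. {\<alpha> i..\<beta> i}) N"
    and finite_E: "finite E" and finite_E': "finite E'"
    and same_ends: "t \<notin> (\<Union>i\<in>N. {\<alpha> i..\<beta> i}) \<Longrightarrow> t \<in> E \<longleftrightarrow> t \<in> E'"
    and same_parity: "i \<in> N \<Longrightarrow>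
      even (card (E \<inter> {\<alpha> i..\<beta> i})) \<longleftrightarrow> even (card (E' \<inter> {\<alpha> i..\<beta> i}))"
begin

abbreviation J :: "real set" where "J \<equiv> (\<Union>i\<in>N. {\<alpha> i..\<beta> i})"

lemma rank_split:
  assumes "finite F"
  shows "end_rank F z = end_rank (F - J) z + (\<Sum>i\<in>N. end_rank (F \<inter> {\<alpha> i..\<beta> i}) z)"
proof -
  have "{y\<in>F. y < z} = {y\<in>F - J. y < z} \<union> (\<Union>i\<in>N. {y\<in>F \<inter> {\<alpha> i..\<beta> i}. y < z})"
    by blast
  then have "end_rank F z = card ({y\<in>F - J. y < z} \<union> (\<Union>i\<in>N. {y\<in>F \<inter> {\<alpha> i..\<beta> i}. y < z}))"
    by (simp add: end_rank_def)
  also have "\<dots> = card {y\<in>F - J. y < z} + card (\<Union>i\<in>N. {y\<in>F \<inter> {\<alpha> i..\<beta> i}. y < z})"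
    using assms finite_N by (intro card_Un_disjoint) auto
  also have "card (\<Union>i\<in>N. {y\<in>F \<inter> {\<alpha> i..\<beta> i}. y < z})
      = (\<Sum>i\<in>N. card {y\<in>F \<inter> {\<alpha> i..\<beta> i}. y < z})"
  proof (rule card_UN_disjoint[OF finite_N], use assms in simp, intro ballI impI)
    fix i j assume "i \<in> N" "j \<in> N" "i \<noteq> j"
    then have "{\<alpha> i..\<beta> i} \<inter> {\<alpha> j..\<beta> j} = {}"
      by (rule disjoint_family_onD[OF disjoint])
    then show "{y\<in>F \<inter> {\<alpha> i..\<beta> i}. y < z} \<inter> {y\<in>F \<inter> {\<alpha> j..\<beta> j}. y < z} = {}"
      by blast
  qed
  finally show ?thesis by (simp add: end_rank_def)
qed

lemma rank_interval_parity:
  assumes "i \<in> N" "z \<notin> {\<alpha> i..\<beta> i}" "z' \<notin> {\<alpha> i..\<beta> i}" "z < \<alpha> i \<longleftrightarrow> z' < \<alpha> i"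
  shows "even (end_rank (E \<inter> {\<alpha> i..\<beta> i}) z) \<longleftrightarrow> even (end_rank (E' \<inter> {\<alpha> i..\<beta> i}) z')"
proof (cases "z < \<alpha> i")
  case True
  then show ?thesis using assms(4) by (simp add: rank_below)
next
  case False
  then show ?thesis
    using assms same_parity[OF assms(1)] by (simp add: rank_above)
qed

lemma rank_outside:
  assumes "z \<notin> J"
  shows "even (end_rank E z) \<longleftrightarrow> even (end_rank E' z)"
proof -
  have "E - J = E' - J"
    using same_ends by blast
  moreover have "even (\<Sum>i\<in>N. end_rank (E \<inter> {\<alpha> i..\<beta> i}) z) \<longleftrightarrow> even (\<Sum>i\<in>N. end_rank (E' \<inter> {\<alpha> i..\<beta> i}) z)"
    using assms by (intro even_sum_cong rank_interval_parity) blast+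
  ultimately show ?thesis
    by (simp add: rank_split[OF finite_E] rank_split[OF finite_E'])
qed

text \<open>Modulo 2, adding the rank within the interval removes its contribution to the full rank.
  What is left counts endpoints before the interval, so it does not depend on the choice of
  \<open>z\<close> and \<open>z'\<close>: only the order inside the interval can make a difference.
  A sum stands in for a difference of natural numbers.\<close>

lemma rank_inside:
  assumes "j \<in> N" "z \<in> {\<alpha> j..\<beta> j}" "z' \<in> {\<alpha> j..\<beta> j}"
  shows "even (end_rank E z + end_rank (E \<inter> {\<alpha> j..\<beta> j}) z)
    \<longleftrightarrow> even (end_rank E' z' + end_rank (E' \<inter> {\<alpha> j..\<beta> j}) z')"
proof -
  have *: "y < z \<longleftrightarrow> y < z'" if "y \<notin> {\<alpha> j..\<beta> j}" for y
    using that assms by auto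
  have "{y\<in>E - J. y < z} = {y\<in>E' - J. y < z'}"
    using same_ends * assms(1) by blast
  then have 1: "end_rank (E - J) z = end_rank (E' - J) z'"
    by (simp add: end_rank_def)
  have 2: "even (\<Sum>i\<in>N - {j}. end_rank (E \<inter> {\<alpha> i..\<beta> i}) z)
      \<longleftrightarrow> even (\<Sum>i\<in>N - {j}. end_rank (E' \<inter> {\<alpha> i..\<beta> i}) z')"
  proof (intro even_sum_cong rank_interval_parity)
    fix i assume i: "i \<in> N - {j}"
    have disj: "{\<alpha> i..\<beta> i} \<inter> {\<alpha> j..\<beta> j} = {}"
      using i assms(1) disjoint_family_onD[OF disjoint, of i j] by simp
    show "i \<in> N" using i by simp
    show "z \<notin> {\<alpha> i..\<beta> i}" "z' \<notin> {\<alpha> i..\<beta> i}"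
      using disj assms by blast+
    \<comment> \<open>An interval disjoint from that of index \<open>j\<close> lies wholly to one
      side of it, hence on the same side of \<open>z\<close> and of \<open>z'\<close>.\<close>
    have "\<alpha> i \<notin> {\<alpha> j..\<beta> j}"
      using disj \<alpha>_le_\<beta>[of i] i by (meson DiffD1 atLeastAtMost_iff disjoint_iff order_refl)
    then show "z < \<alpha> i \<longleftrightarrow> z' < \<alpha> i"
      using assms(2,3) by auto
  qed
  show ?thesis
    using 1 2 finite_N assms(1)
    by (simp add: rank_split[OF finite_E, of z] rank_split[OF finite_E', of z'] sum.remove[of N j])
      blast
qed

end

locale gauss_move =
  G: gauss_data E m ov sg + G': gauss_data E' m' ov' sg' + interval_change N \<alpha> \<beta> E E'
  for N \<alpha> \<beta> E m ov sg E' m' ov' sg' +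
  assumes same_mate: "t \<in> E \<Longrightarrow> t \<notin> J \<Longrightarrow> m' t = m t \<and> m t \<notin> J"
    and same_over: "t \<in> E \<Longrightarrow> t \<notin> J \<Longrightarrow> t \<in> ov \<longleftrightarrow> t \<in> ov'"
    and same_sign: "t \<in> E \<Longrightarrow> t \<notin> J \<Longrightarrow> sg' t = sg t"
begin

lemma even_end_outside:
  assumes "t \<in> E" "t \<notin> J"
  shows "even_end E m t \<longleftrightarrow> even_end E' m' t"
  using same_mate[OF assms] rank_outside[OF assms(2)] rank_outside[of "m t"]
  by (simp add: even_end_def)

lemma gauss_prod_eqI:
  assumes evens: "\<And>i. i \<in> N \<Longrightarrow> even (card (even_ends E m \<inter> {\<alpha> i..\<beta> i}))
      \<longleftrightarrow> even (card (even_ends E' m' \<inter> {\<alpha> i..\<beta> i}))"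
    and inside: "\<And>i. i \<in> N \<Longrightarrow>
      Gbar.ordered_prod (E \<inter> {\<alpha> i..\<beta> i}) (end_letter E m ov sg)
        = Gbar.ordered_prod (E' \<inter> {\<alpha> i..\<beta> i}) (end_letter E' m' ov' sg')"
  shows "gauss_prod E m ov sg = gauss_prod E' m' ov' sg'"
proof -
  \<comment> \<open>Chords away from the intervals keep their parity, so the even endpoints also
    change inside the intervals only, and \<open>evens\<close> supplies the parity of their number
    there.\<close>
  interpret ev: interval_change N \<alpha> \<beta> "even_ends E m" "even_ends E' m'"
    using finite_N \<alpha>_le_\<beta> disjoint finite_E finite_E' evens same_ends even_end_outside
    by unfold_locales (auto simp: even_ends_def)
  show ?thesis
    unfolding gauss_prod_def
  proof (rule Gbar.ordered_prod_replace_intervals[OF finite_N finite_E finite_E' \<alpha>_le_\<beta> disjoint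
        end_letter_closed end_letter_closed same_ends _ inside])
    fix t assume t: "t \<in> E" "t \<notin> J"
    have "first_end E m t \<longleftrightarrow> first_end E' m' t"
      using same_mate[OF t] ev.rank_outside[OF t(2)] ev.rank_outside[of "m t"]
      by (simp add: first_end_def)
    then show "end_letter E m ov sg t = end_letter E' m' ov' sg' t"
      using even_end_outside[OF t] same_over[OF t] same_sign[OF t] by (simp add: end_letter_def)
  qed
qed

end

section \<open>Reidemeister moves on the line\<close>

lemma ordered_prod_inverse_pair:
  assumes "x \<noteq> y" "f x \<in> carrier Gbar" "f y = inv\<^bsub>Gbar\<^esub> f x"
  shows "Gbar.ordered_prod {x, y} f = \<one>\<^bsub>Gbar\<^esub>"
  using assms Gbar.ordered_prod_pair[of x y f] Gbar.ordered_prod_pair[of y x f]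
  by (cases "x < y") (simp_all add: insert_commute)

text \<open>The ends of a curl are adjacent, so their ranks have an odd sum and the new chord is
  even. Both of its letters are powers of \<open>a\<close>, with opposite exponents because exactly
  one end is over. The number of even ends in the interval goes from 0 to 2.\<close>

lemma gauss_prod_R1:
  assumes "gauss_move {i} \<alpha> \<beta> E m ov sg E' m' ov' sg'"
    and "E \<inter> {\<alpha> i..\<beta> i} = {}" "E' \<inter> {\<alpha> i..\<beta> i} = {s, t}" "s \<noteq> t" "m' s = t"
  shows "gauss_prod E m ov sg = gauss_prod E' m' ov' sg'"
proof -
  interpret gauss_move "{i}" \<alpha> \<beta> E m ov sg E' m' ov' sg'
    by fact
  have s: "s \<in> E'" "t \<in> E'"
    using assms(3) by auto
  have ev: "even_end E' m' s" "even_end E' m' t"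
    using rank_adjacent[OF finite_E' assms(3,4)] G'.mate_mate[OF s(1)] assms(5)
    by (auto simp: even_end_def)
  have "even_ends E m \<inter> {\<alpha> i..\<beta> i} = {}" "even_ends E' m' \<inter> {\<alpha> i..\<beta> i} = {s, t}"
    using assms(2,3) ev by (auto simp: even_ends_def)
  moreover have "end_letter E' m' ov' sg' t = inv\<^bsub>Gbar\<^esub> end_letter E' m' ov' sg' s"
    using ev G'.over_mate[OF s(1)] G'.sign_mate[OF s(1)] assms(5)
    by (simp add: end_letter_def letter_base_def Gbar.int_pow_neg)
  ultimately show ?thesis
    using assms(2-4) by (intro gauss_prod_eqI) (simp_all add: ordered_prod_inverse_pair)
qed

text \<open>Going from the first new chord to the second, the rank changes parity at both ends, so
  the two chords are both even or both odd. If they are odd, the intervals contain no even end at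
  all, ranks among the even ends are constant on each of them, and the types agree. The letters on
  one strand then have the same base and, by the opposite signs, inverse exponents.\<close>

lemma gauss_prod_R2:
  assumes "gauss_move {i, j} \<alpha> \<beta> E m ov sg E' m' ov' sg'"
    and "E \<inter> {\<alpha> i..\<beta> i} = {}" "E \<inter> {\<alpha> j..\<beta> j} = {}"
    and p: "E' \<inter> {\<alpha> i..\<beta> i} = {p1, p2}" "p1 \<noteq> p2"
    and q: "E' \<inter> {\<alpha> j..\<beta> j} = {q1, q2}" "q1 \<noteq> q2"
    and m: "m' p1 = q1" "m' p2 = q2"
    and over: "p1 \<in> ov' \<longleftrightarrow> p2 \<in> ov'" and sign: "sg' p2 = - sg' p1"
  shows "gauss_prod E m ov sg = gauss_prod E' m' ov' sg'"
proof -
  interpret gauss_move "{i, j}" \<alpha> \<beta> E m ov sg E' m' ov' sg'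
    by fact
  have in_E': "p1 \<in> E'" "p2 \<in> E'" "q1 \<in> E'" "q2 \<in> E'"
    and mem: "p1 \<in> {\<alpha> i..\<beta> i}" "p2 \<in> {\<alpha> i..\<beta> i}" "q1 \<in> {\<alpha> j..\<beta> j}" "q2 \<in> {\<alpha> j..\<beta> j}"
    using p q by blast+
  have mq: "m' q1 = p1" "m' q2 = p2"
    using m G'.mate_mate[OF in_E'(1)] G'.mate_mate[OF in_E'(2)] by auto
  note adj = rank_adjacent[OF finite_E' p] rank_adjacent[OF finite_E' q]
  have ev: "even_end E' m' p2 = even_end E' m' p1" "even_end E' m' q1 = even_end E' m' p1"
    "even_end E' m' q2 = even_end E' m' p1"
    using adj m mq by (auto simp: even_end_def)
  have first: "first_end E' m' p2 = first_end E' m' p1" "first_end E' m' q1 = first_end E' m' p1"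
    "first_end E' m' q2 = first_end E' m' p1" if "\<not> even_end E' m' p1"
  proof -
    have "even_ends E' m' \<inter> {\<alpha> i..\<beta> i} = {}" "even_ends E' m' \<inter> {\<alpha> j..\<beta> j} = {}"
      using that p q ev by (auto simp: even_ends_def)
    then have "end_rank (even_ends E' m') p1 = end_rank (even_ends E' m') p2"
      "end_rank (even_ends E' m') q1 = end_rank (even_ends E' m') q2"
      using mem by (metis rank_empty_interval)+
    then show "first_end E' m' p2 = first_end E' m' p1" "first_end E' m' q1 = first_end E' m' p1"
      "first_end E' m' q2 = first_end E' m' p1"
      using m mq by (simp_all add: first_end_def add.commute)
  qed
  have base: "letter_base b (even_end E' m' x) (first_end E' m' x)
      = letter_base b (even_end E' m' p1) (first_end E' m' p1)" if "x \<in> {p1, p2, q1, q2}" for b x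
    using that ev first by (auto simp: letter_base_def)
  have over': "q1 \<in> ov' \<longleftrightarrow> p1 \<notin> ov'" "q2 \<in> ov' \<longleftrightarrow> p2 \<notin> ov'"
    and sign': "sg' q1 = sg' p1" "sg' q2 = sg' p2"
    using G'.over_mate G'.sign_mate in_E' m by metis+
  have "end_letter E' m' ov' sg' p2 = inv\<^bsub>Gbar\<^esub> end_letter E' m' ov' sg' p1"
    "end_letter E' m' ov' sg' q2 = inv\<^bsub>Gbar\<^esub> end_letter E' m' ov' sg' q1"
    using over over' sign sign' unfolding end_letter_def
    by (simp_all add: base[of p2] base[of q1] base[of q2] Gbar.int_pow_neg)
  then have prods: "Gbar.ordered_prod {p1, p2} (end_letter E' m' ov' sg') = \<one>\<^bsub>Gbar\<^esub>"
    "Gbar.ordered_prod {q1, q2} (end_letter E' m' ov' sg') = \<one>\<^bsub>Gbar\<^esub>"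
    using p q by (simp_all add: ordered_prod_inverse_pair)
  have "even_ends E' m' \<inter> {\<alpha> i..\<beta> i} = (if even_end E' m' p1 then {p1, p2} else {})"
    "even_ends E' m' \<inter> {\<alpha> j..\<beta> j} = (if even_end E' m' p1 then {q1, q2} else {})"
    using p q ev by (auto simp: even_ends_def)
  moreover have "even_ends E m \<inter> {\<alpha> i..\<beta> i} = {}" "even_ends E m \<inter> {\<alpha> j..\<beta> j} = {}"
    using assms(2,3) by (auto simp: even_ends_def)
  ultimately show ?thesis
    using assms(2-7) prods by (intro gauss_prod_eqI) auto
qed

section \<open>The third move on the line\<close>

lemma end_rank_pair:
  assumes "x \<noteq> y"
  shows "end_rank {x, y} x = (if y < x then 1 else 0)"
    "end_rank {x} y = (if x < y then 1 else 0)" "end_rank {x} x = 0" "end_rank {} x = 0"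
proof -
  have "{z \<in> {x, y}. z < x} = (if y < x then {y} else {})"
    "{z \<in> {x}. z < y} = (if x < y then {x} else {})" "{z \<in> {x}. z < x} = {}" "{z \<in> {}. z < x} = {}"
    by auto
  then show "end_rank {x, y} x = (if y < x then 1 else 0)"
    "end_rank {x} y = (if x < y then 1 else 0)" "end_rank {x} x = 0" "end_rank {} x = 0"
    unfolding end_rank_def by (simp_all split: if_splits)
qed

text \<open>The equation \<open>{i, j, k} = {1, 2, 3}\<close> is the device for quantifying over all
  permutations of the three strands; cardinality turns it into distinctness.\<close>

lemma triple_distinct:
  assumes "{i, j, k} = {1::nat, 2, 3}"
  shows "i \<in> {1, 2, 3}" "j \<in> {1, 2, 3}" "k \<in> {1, 2, 3}" "i \<noteq> j" "i \<noteq> k" "j \<noteq> k"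
proof -
  show "i \<in> {1, 2, 3}" "j \<in> {1, 2, 3}" "k \<in> {1, 2, 3}"
    using assms by blast+
  have "card {i, j, k} = 3"
    unfolding assms by simp
  then show "i \<noteq> j" "i \<noteq> k" "j \<noteq> k"
    by (auto simp: card_insert_if simp del: One_nat_def split: if_splits)
qed

lemma triple_exists:
  assumes "i \<in> {1..3}"
  obtains j k where "{i, j, k} = {1::nat, 2, 3}"
proof -
  have "i \<in> {1, 2, 3}"
    using assms by auto
  moreover have "{1, 2, 3} = {1::nat, 2, 3}" "{2, 1, 3} = {1::nat, 2, 3}" "{3, 1, 2} = {1::nat, 2, 3}"
    by auto
  ultimately show ?thesis
    using that by blast
qed

text \<open>\<open>e i j\<close> is the end, on strand \<open>i\<close>, of the crossing of strands
  \<open>i\<close> and \<open>j\<close>, and \<open>e'\<close> is its analogue in the second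
  diagram. The change made by the move is \<open>swapped\<close>: on each strand the two ends trade
  places, while mates, levels and signs persist.\<close>

locale gauss_R3 = gauss_move "{1..3}" \<alpha> \<beta> E m ov sg E' m' ov' sg'
  for \<alpha> \<beta> E m ov sg E' m' ov' sg' +
  fixes e e' :: "nat \<Rightarrow> nat \<Rightarrow> real"
  assumes crossing_ends:
      "{i, j, k} = {1, 2, 3} \<Longrightarrow> E \<inter> {\<alpha> i..\<beta> i} = {e i j, e i k}"
      "{i, j, k} = {1, 2, 3} \<Longrightarrow> E' \<inter> {\<alpha> i..\<beta> i} = {e' i j, e' i k}"
    and distinct: "{i, j, k} = {1, 2, 3} \<Longrightarrow> e i j \<noteq> e i k"
      "{i, j, k} = {1, 2, 3} \<Longrightarrow> e' i j \<noteq> e' i k"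
    and swapped: "{i, j, k} = {1, 2, 3} \<Longrightarrow> e i j < e i k \<longleftrightarrow> e' i k < e' i j"
    and mate: "{i, j, k} = {1, 2, 3} \<Longrightarrow> m (e i j) = e j i \<and> m' (e' i j) = e' j i"
    and over: "{i, j, k} = {1, 2, 3} \<Longrightarrow> e i j \<in> ov \<longleftrightarrow> e' i j \<in> ov'"
    and sign: "{i, j, k} = {1, 2, 3} \<Longrightarrow> sg (e i j) = sg' (e' i j)"
begin

context
  fixes i j k assumes ijk: "{i, j, k} = {1::nat, 2, 3}"
begin

lemma perms: "{i, k, j} = {1, 2, 3}" "{j, i, k} = {1, 2, 3}" "{j, k, i} = {1, 2, 3}"
  "{k, i, j} = {1, 2, 3}" "{k, j, i} = {1, 2, 3}"
  using ijk by (simp_all add: insert_commute)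

lemma index: "i \<in> {1..3}"
  using triple_distinct(1)[OF ijk] by auto

lemma mem: "e i j \<in> E" "e i j \<in> {\<alpha> i..\<beta> i}" "e' i j \<in> E'" "e' i j \<in> {\<alpha> i..\<beta> i}"
  using crossing_ends[OF ijk] by blast+

text \<open>Within the interval the rank of this end is 0 in one diagram and 1 in the other; the
  remaining contributions agree modulo 2.\<close>

lemma rank_swapped: "even (end_rank E (e i j)) \<longleftrightarrow> odd (end_rank E' (e' i j))"
  using rank_inside[OF index mem(2,4)] distinct[OF ijk] swapped[OF ijk]
  by (auto simp: crossing_ends[OF ijk] end_rank_pair split: if_splits)

end

text \<open>A chord has its ends on two different strands, and the parity of the rank changes at
  both, so the sum keeps its parity.\<close>

lemma even_end_same:
  assumes ijk: "{i, j, k} = {1, 2, 3}"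
  shows "even_end E m (e i j) \<longleftrightarrow> even_end E' m' (e' i j)"
  using rank_swapped[OF ijk] rank_swapped[OF perms(2)[OF ijk]] mate[OF ijk]
  by (auto simp: even_end_def)

lemma even_end_sym:
  assumes ijk: "{i, j, k} = {1, 2, 3}"
  shows "even_end E m (e j i) \<longleftrightarrow> even_end E m (e i j)"
  using mate[OF ijk] mate[OF perms(2)[OF ijk]] by (simp add: even_end_def add.commute)

lemma even_ends_interval:
  assumes ijk: "{i, j, k} = {1, 2, 3}"
  shows "even_ends E m \<inter> {\<alpha> i..\<beta> i} = {x \<in> {e i j, e i k}. even_end E m x}"
    "even_ends E' m' \<inter> {\<alpha> i..\<beta> i} = {x \<in> {e' i j, e' i k}. even_end E' m' x}"
  unfolding crossing_ends[OF ijk, symmetric] by (auto simp: even_ends_def)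

lemma even_ends_parity:
  assumes ijk: "{i, j, k} = {1, 2, 3}"
  shows "card (even_ends E m \<inter> {\<alpha> i..\<beta> i}) = card (even_ends E' m' \<inter> {\<alpha> i..\<beta> i})"
proof -
  have *: "{x \<in> {u, v}. P x} = (if P u then {u} else {}) \<union> (if P v then {v} else {})"
    for u v :: real and P
    by auto
  show ?thesis
    unfolding even_ends_interval[OF ijk] *
    using even_end_same[OF ijk] even_end_same[OF perms(1)[OF ijk]] distinct[OF ijk] by simp
qed

text \<open>The three chords span a triangle with two adjacent endpoints on each of the three strands,
  so the sum of the six ranks is odd.\<close>

lemma odd_number_of_even_crossings:
  "even_end E m (e 1 2) = (even_end E m (e 1 3) = even_end E m (e 2 3))"
proof -
  have p: "{1, 2, 3} = {1, 2, 3::nat}" "{2, 1, 3} = {1, 2, 3::nat}" "{3, 1, 2} = {1, 2, 3::nat}"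
    "{1, 3, 2} = {1, 2, 3::nat}" "{2, 3, 1} = {1, 2, 3::nat}" "{3, 2, 1} = {1, 2, 3::nat}"
    by auto
  have "even (end_rank E (e 1 2)) \<longleftrightarrow> odd (end_rank E (e 1 3))"
    "even (end_rank E (e 2 1)) \<longleftrightarrow> odd (end_rank E (e 2 3))"
    "even (end_rank E (e 3 1)) \<longleftrightarrow> odd (end_rank E (e 3 2))"
    using rank_adjacent[OF finite_E crossing_ends(1) distinct(1)] p by blast+
  moreover have "m (e 1 2) = e 2 1" "m (e 1 3) = e 3 1" "m (e 2 3) = e 3 2"
    using mate p by blast+
  ultimately show ?thesis
    by (auto simp: even_end_def)
qed

lemma odd_number_of_even_crossings':
  assumes ijk: "{i, j, k} = {1, 2, 3}"
  shows "even_end E m (e i j) = (even_end E m (e i k) = even_end E m (e j k))"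
proof -
  have p: "{1, 2, 3} = {1, 2, 3::nat}" "{1, 3, 2} = {1, 2, 3::nat}" "{2, 3, 1} = {1, 2, 3::nat}"
    by auto
  show ?thesis
    using triple_distinct[OF ijk] odd_number_of_even_crossings even_end_sym[OF p(1)]
      even_end_sym[OF p(2)] even_end_sym[OF p(3)] by auto
qed

text \<open>On strand \<open>i\<close> the end \<open>e i j\<close> moves past \<open>e i k\<close>,
  which changes its rank among the even ends exactly if that other end is even; on strand
  \<open>j\<close> it is the chord of \<open>j\<close> and \<open>k\<close> that decides. When the
  chord of \<open>i\<close> and \<open>j\<close> is odd, exactly one of the other two chords is
  even, so just one of the two ranks changes parity.\<close>

lemma first_end_toggled:
  assumes ev: "interval_change {1..3} \<alpha> \<beta> (even_ends E m) (even_ends E' m')"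
    and ijk: "{i, j, k} = {1, 2, 3}" and "\<not> even_end E m (e i j)"
  shows "first_end E' m' (e' i j) \<longleftrightarrow> \<not> first_end E m (e i j)"
proof -
  have *: "(even (end_rank (even_ends E m) (e i j)) = even (end_rank (even_ends E' m') (e' i j)))
      \<longleftrightarrow> \<not> even_end E m (e i k)"
    if ijk: "{i, j, k} = {1, 2, 3}" "\<not> even_end E m (e i j)" for i j k
  proof -
    have "\<not> even_end E' m' (e' i j)" "even_end E m (e i k) = even_end E' m' (e' i k)"
      using even_end_same[OF ijk(1)] even_end_same[OF perms(1)[OF ijk(1)]] ijk(2) by auto
    then have "even_ends E m \<inter> {\<alpha> i..\<beta> i} = (if even_end E m (e i k) then {e i k} else {})"
      "even_ends E' m' \<inter> {\<alpha> i..\<beta> i} = (if even_end E m (e i k) then {e' i k} else {})"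
      using ijk(2) unfolding even_ends_interval[OF ijk(1)] by auto
    then show ?thesis
      using interval_change.rank_inside[OF ev index[OF ijk(1)] mem(2,4)[OF ijk(1)]]
        distinct[OF ijk(1)] swapped[OF ijk(1)]
      by (auto simp: end_rank_pair split: if_splits)
  qed
  note ijk' = perms(2)[OF ijk]
  have "\<not> even_end E m (e j i)" "even_end E m (e i k) \<noteq> even_end E m (e j k)"
    using assms(3) even_end_sym[OF ijk] odd_number_of_even_crossings'[OF ijk] by auto
  then show ?thesis
    using *[OF ijk assms(3)] *[OF ijk'] mate[OF ijk] by (auto simp: first_end_def)
qed

lemma gauss_prod_eq: "gauss_prod E m ov sg = gauss_prod E' m' ov' sg'"
proof (rule gauss_prod_eqI)
  show parity: "even (card (even_ends E m \<inter> {\<alpha> i..\<beta> i}))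
      \<longleftrightarrow> even (card (even_ends E' m' \<inter> {\<alpha> i..\<beta> i}))"
    if "i \<in> {1..3}" for i
    by (rule triple_exists[OF that]) (simp add: even_ends_parity)
  have ev: "interval_change {1..3} \<alpha> \<beta> (even_ends E m) (even_ends E' m')"
    using finite_N \<alpha>_le_\<beta> disjoint finite_E finite_E' parity same_ends even_end_outside
    by unfold_locales (auto simp: even_ends_def)
  fix i :: nat assume "i \<in> {1..3}"
  then obtain j k where ijk: "{i, j, k} = {1, 2, 3}"
    by (rule triple_exists)
  \<comment> \<open>The two crossings on a strand play symmetric roles, so it suffices to treat the
    order in which \<open>e i j\<close> comes first.\<close>
  have *: "Gbar.ordered_prod {e i j, e i k} (end_letter E m ov sg)
        = Gbar.ordered_prod {e' i j, e' i k} (end_letter E' m' ov' sg')"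
    if ijk: "{i, j, k} = {1, 2, 3}" and less: "e i j < e i k" for i j k
  proof -
    define n where "n x = (if x \<in> ov then sg x else - sg x)" for x
    \<comment> \<open>The negated flag is correct for even ends too, since
      \<open>letter_base\<close> ignores it there.\<close>
    have letters: "end_letter E m ov sg (e i j)
        = letter_base (e i j \<in> ov) (even_end E m (e i j)) (first_end E m (e i j))
          [^]\<^bsub>Gbar\<^esub> n (e i j)"
      "end_letter E' m' ov' sg' (e' i j)
        = letter_base (e i j \<in> ov) (even_end E m (e i j)) (\<not> first_end E m (e i j))
          [^]\<^bsub>Gbar\<^esub> n (e i j)"
      if ijk: "{i, j, k} = {1, 2, 3}" for i j k
      using even_end_same[OF ijk] first_end_toggled[OF ev ijk] over[OF ijk] sign[OF ijk]
      by (simp_all add: end_letter_def n_def letter_base_def)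
    have n: "n x \<in> {1, -1}" for x
      using G.sign_unit[of x] by (auto simp: n_def)
    have "e' i k < e' i j"
      using swapped[OF ijk] less by simp
    then have "Gbar.ordered_prod {e' i j, e' i k} (end_letter E' m' ov' sg')
        = end_letter E' m' ov' sg' (e' i k) \<cdot> end_letter E' m' ov' sg' (e' i j)"
      by (simp add: Gbar.ordered_prod_pair insert_commute[of "e' i j"])
    also have "\<dots> = end_letter E m ov sg (e i j) \<cdot> end_letter E m ov sg (e i k)"
      unfolding letters[OF ijk] letters[OF perms(1)[OF ijk]]
      by (rule letter_base_exchange_int_pow[OF n n, symmetric])
    finally show ?thesis
      using less by (simp add: Gbar.ordered_prod_pair)
  qed
  show "Gbar.ordered_prod (E \<inter> {\<alpha> i..\<beta> i}) (end_letter E m ov sg)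
        = Gbar.ordered_prod (E' \<inter> {\<alpha> i..\<beta> i}) (end_letter E' m' ov' sg')"
    unfolding crossing_ends[OF ijk]
  proof (cases "e i j < e i k")
    case True
    then show "Gbar.ordered_prod {e i j, e i k} (end_letter E m ov sg)
        = Gbar.ordered_prod {e' i j, e' i k} (end_letter E' m' ov' sg')"
      by (rule *[OF ijk])
  next
    case False
    then have "e i k < e i j"
      using distinct(1)[OF ijk] by simp
    from *[OF perms(1)[OF ijk] this]
    show "Gbar.ordered_prod {e i j, e i k} (end_letter E m ov sg)
        = Gbar.ordered_prod {e' i j, e' i k} (end_letter E' m' ov' sg')"
      by (simp only: insert_commute)
  qed
qed

end

section \<open>The Gauss data of a diagram\<close>

lemma linked_iff_odd:
  assumes "s \<noteq> t" "u \<noteq> v" "{u, v} = {s, t} \<or> {u, v} \<inter> {s, t} = {}"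
  shows "linked (s, t) (u, v) \<longleftrightarrow> odd (card ({u, v} \<inter> {min s t<..<max s t}))"
proof -
  have "{u, v} \<inter> {min s t<..<max s t} =
      (if u \<in> {min s t<..<max s t} then {u} else {}) \<union> (if v \<in> {min s t<..<max s t} then {v} else {})"
    by auto
  then have "odd (card ({u, v} \<inter> {min s t<..<max s t}))
      \<longleftrightarrow> (u \<in> {min s t<..<max s t}) \<noteq> (v \<in> {min s t<..<max s t})"
    using assms(2) by (cases "u \<in> {min s t<..<max s t}"; cases "v \<in> {min s t<..<max s t}") simp_all
  also have "\<dots> \<longleftrightarrow> linked (s, t) (u, v)"
    using assms by (auto simp: linked_def Let_def min_def max_def doubleton_eq_iff)
  finally show ?thesis ..
qed

text \<open>The rank of the larger end counts everything before the smaller one, then the smaller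
  one if it belongs to \<open>F\<close>, then what lies strictly between. This membership is the
  off-by-one that separates the two criteria: ends in \<open>F\<close> when parity is tested, ends
  outside \<open>F\<close> when the type of an odd chord is tested.\<close>

lemma end_rank_between:
  assumes "finite F" "s \<noteq> t" "s \<in> F \<longleftrightarrow> t \<in> F"
  shows "even (card (F \<inter> {min s t<..<max s t}))
    \<longleftrightarrow> (s \<in> F) = odd (end_rank F s + end_rank F t)"
proof -
  have *: "end_rank F r = end_rank F l + (if l \<in> F then 1 else 0) + card (F \<inter> {l<..<r})" if "l < r" for l r
  proof -
    have "{y \<in> F. y < r} = ({y \<in> F. y < l} \<union> (if l \<in> F then {l} else {})) \<union> F \<inter> {l<..<r}"
      using that by (auto simp: not_less le_less)
    then have "end_rank F r = card (({y \<in> F. y < l} \<union> (if l \<in> F then {l} else {})) \<union> F \<inter> {l<..<r})"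
      by (simp add: end_rank_def)
    also have "\<dots> = card ({y \<in> F. y < l} \<union> (if l \<in> F then {l} else {})) + card (F \<inter> {l<..<r})"
      using assms(1) by (intro card_Un_disjoint) auto
    also have "card ({y \<in> F. y < l} \<union> (if l \<in> F then {l} else {}))
        = end_rank F l + card (if l \<in> F then {l} else {})"
      unfolding end_rank_def using assms(1) by (intro card_Un_disjoint) auto
    finally show ?thesis by (simp split: if_splits)
  qed
  show ?thesis
  proof (cases "s < t")
    case True
    then show ?thesis using *[OF True] by auto
  next
    case False
    then have "t < s" using assms(2) by simp
    then show ?thesis using *[of t s] assms(3) by auto
  qed
qed

definition crossing_ends :: "diagram \<Rightarrow> real set" where
  "crossing_ends K = {t. \<exists>s. s \<noteq> t \<and> curve K t = curve K s}"

definition mate :: "diagram \<Rightarrow> real \<Rightarrow> real" where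
  "mate K t = (THE s. s \<noteq> t \<and> curve K t = curve K s)"

definition end_chord :: "diagram \<Rightarrow> real \<Rightarrow> real \<times> real" where
  "end_chord K t = (if t \<in> over_params K then (t, mate K t) else (mate K t, t))"

locale long_knot =
  fixes p :: complex and K :: diagram
  assumes long_knot: "long_knot_diagram p K"
begin

abbreviation f :: "real \<Rightarrow> real \<times> complex" where "f \<equiv> curve K"

lemma generic: "generic_immersion f"
  using long_knot by (simp add: long_knot_diagram_def)

lemma finite_crossing_ends: "finite (crossing_ends K)"
proof -
  have "crossing_ends K = fst ` double_pairs f"
    by (force simp: crossing_ends_def double_pairs_def)
  then show ?thesis
    using generic by (simp add: generic_immersion_def)
qed

lemma double_unique: "r = s" if "f t = f r" "f t = f s" "r \<noteq> t" "s \<noteq> t"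
proof -
  have "\<forall>r s t. f r = f s \<and> f s = f t \<longrightarrow> r = s \<or> s = t \<or> r = t"
    using generic by (simp add: generic_immersion_def)
  from this[rule_format, of r t s] show ?thesis using that by auto
qed

lemma mate_eqI: "mate K t = s" if "f t = f s" "s \<noteq> t"
  unfolding mate_def using that double_unique by (intro the_equality) auto

lemma mate_works:
  assumes "t \<in> crossing_ends K"
  shows "mate K t \<noteq> t" "f (mate K t) = f t" "mate K t \<in> crossing_ends K" "mate K (mate K t) = t"
    "t \<noteq> mate K t"
proof -
  obtain s where s: "s \<noteq> t" "f t = f s"
    using assms by (auto simp: crossing_ends_def)
  then have m: "mate K t = s"
    by (intro mate_eqI) auto
  show "mate K t \<noteq> t" "f (mate K t) = f t" "t \<noteq> mate K t"
    using s m by simp_all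
  show "mate K (mate K t) = t"
    unfolding m using s by (intro mate_eqI) auto
  show "mate K t \<in> crossing_ends K"
    unfolding m crossing_ends_def using s by (intro CollectI exI[of _ t]) auto
qed

lemma over_mate:
  assumes "t \<in> crossing_ends K"
  shows "mate K t \<in> over_params K \<longleftrightarrow> t \<notin> over_params K"
proof -
  have "(t, mate K t) \<in> double_pairs f"
    using mate_works[OF assms] by (simp add: double_pairs_def)
  moreover have "\<forall>(s, t) \<in> double_pairs f. s \<in> over_params K \<longleftrightarrow> t \<notin> over_params K"
    using long_knot by (simp add: long_knot_diagram_def)
  ultimately show ?thesis by auto
qed

lemma transverse:
  assumes "s \<noteq> t" "f s = f t"
  shows "area_form (f s) (tangent f s) (tangent f t) \<noteq> 0"
proof -
  have "\<forall>(s, t) \<in> double_pairs f. area_form (f s) (tangent f s) (tangent f t) \<noteq> 0"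
    using generic by (simp add: generic_immersion_def)
  from bspec[OF this, of "(s, t)"] show ?thesis
    using assms by (simp add: double_pairs_def)
qed

lemma chords_eq: "chords K = (\<lambda>s. (s, mate K s)) ` (crossing_ends K \<inter> over_params K)"
proof (intro Set.set_eqI iffI)
  fix d assume d: "d \<in> chords K"
  obtain s t where st: "d = (s, t)"
    by fastforce
  have "s \<noteq> t" "f s = f t" "s \<in> over_params K"
    using d by (auto simp: st chords_def double_pairs_def)
  moreover from this have "mate K s = t"
    by (intro mate_eqI) auto
  moreover have "s \<in> crossing_ends K"
    using calculation by (auto simp: crossing_ends_def)
  ultimately show "d \<in> (\<lambda>s. (s, mate K s)) ` (crossing_ends K \<inter> over_params K)"
    by (auto simp: st)
next
  fix d assume "d \<in> (\<lambda>s. (s, mate K s)) ` (crossing_ends K \<inter> over_params K)"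
  then show "d \<in> chords K"
    using mate_works by (auto simp: chords_def double_pairs_def)
qed

lemma endpoints_chords: "endpoints (chords K) = crossing_ends K"
proof
  show "endpoints (chords K) \<subseteq> crossing_ends K"
    using mate_works by (auto simp: endpoints_def chords_eq)
  show "crossing_ends K \<subseteq> endpoints (chords K)"
  proof
    fix t assume t: "t \<in> crossing_ends K"
    show "t \<in> endpoints (chords K)"
    proof (cases "t \<in> over_params K")
      case True
      then show ?thesis using t by (force simp: endpoints_def chords_eq)
    next
      case False
      then have "mate K t \<in> crossing_ends K \<inter> over_params K" "t = mate K (mate K t)"
        using t mate_works over_mate by auto
      then show ?thesis unfolding endpoints_def chords_eq by force
    qed
  qed
qed

lemma chord_at_eq:
  assumes "t \<in> crossing_ends K"
  shows "chord_at (chords K) t = end_chord K t"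
  unfolding chord_at_def
proof (rule the_equality)
  show "end_chord K t \<in> chords K \<and> (fst (end_chord K t) = t \<or> snd (end_chord K t) = t)"
    using assms mate_works[OF assms] over_mate[OF assms] by (auto simp: end_chord_def chords_eq)
  fix d assume "d \<in> chords K \<and> (fst d = t \<or> snd d = t)"
  then show "d = end_chord K t"
    using mate_works over_mate by (auto simp: end_chord_def chords_eq)
qed

text \<open>The points of \<open>F\<close> between \<open>s\<close> and \<open>t\<close> are counted
  chord by chord, each chord contributing an odd number exactly if it is linked with the given one.
  Closure under \<open>mate K\<close> makes \<open>F\<close> a disjoint union of pairs of ends; it
  will be the set of all ends or the set of even ends.\<close>

lemma card_linked_parity:
  assumes d: "(s, t) \<in> chords K" and F: "F \<subseteq> crossing_ends K" "mate K ` F \<subseteq> F"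
  shows "even (card {e \<in> chords K. linked (s, t) e \<and> fst e \<in> F})
    \<longleftrightarrow> even (card (F \<inter> {min s t<..<max s t}))"
proof -
  define C where "C = {e \<in> chords K. fst e \<in> F}"
  define I where "I = {min s t<..<max s t}"
  have finC: "finite C"
    using finite_crossing_ends by (simp add: C_def chords_eq)
  have d': "s \<in> crossing_ends K" "t = mate K s" "s \<noteq> t"
    using d mate_works by (auto simp: chords_eq)
  have C: "u \<in> F" "v = mate K u" "u \<noteq> v" "u \<in> crossing_ends K" "u \<in> over_params K" "v \<in> F"
    if "(u, v) \<in> C" for u v
    using that F mate_works by (auto simp: C_def chords_eq)
  have "F \<inter> I = (\<Union>e\<in>C. {fst e, snd e} \<inter> I)"
  proof (intro equalityI subsetI)
    fix y assume y: "y \<in> F \<inter> I"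
    then have yE: "y \<in> crossing_ends K"
      using F by blast
    have "end_chord K y \<in> C"
      using y yE mate_works[OF yE] over_mate[OF yE] F
      by (auto simp: C_def end_chord_def chords_eq)
    moreover have "y \<in> {fst (end_chord K y), snd (end_chord K y)}"
      by (auto simp: end_chord_def)
    ultimately show "y \<in> (\<Union>e\<in>C. {fst e, snd e} \<inter> I)"
      using y by blast
  qed (use C in force)
  then have "card (F \<inter> I) = card (\<Union>e\<in>C. {fst e, snd e} \<inter> I)"
    by simp
  also have "\<dots> = (\<Sum>e\<in>C. card ({fst e, snd e} \<inter> I))"
  proof (rule card_UN_disjoint[OF finC])
    show "\<forall>e\<in>C. \<forall>e'\<in>C. e \<noteq> e' \<longrightarrow> {fst e, snd e} \<inter> I \<inter> ({fst e', snd e'} \<inter> I) = {}"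
    proof (intro ballI impI)
      fix e e' assume e: "e \<in> C" "e' \<in> C" "e \<noteq> e'"
      obtain u v u' v' where uv: "e = (u, v)" "e' = (u', v')"
        by fastforce
      have "u \<noteq> u'" "u \<noteq> v'" "v \<noteq> u'" "v \<noteq> v'"
        using e C[of u v] C[of u' v'] over_mate mate_works(4) unfolding uv by metis+
      then show "{fst e, snd e} \<inter> I \<inter> ({fst e', snd e'} \<inter> I) = {}"
        by (auto simp: uv)
    qed
  qed simp
  finally have "even (card (F \<inter> I)) \<longleftrightarrow> even (card {e\<in>C. odd (card ({fst e, snd e} \<inter> I))})"
    using finC by (simp add: even_sum_iff)
  also have "{e\<in>C. odd (card ({fst e, snd e} \<inter> I))} = {e\<in>C. linked (s, t) e}"
  proof (rule Collect_cong, rule conj_cong[OF HOL.refl])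
    fix e assume e: "e \<in> C"
    obtain u v where uv: "e = (u, v)" by fastforce
    have "{u, v} = {s, t} \<or> {u, v} \<inter> {s, t} = {}"
      using e C[of u v] d' mate_works(4)[of s] mate_works(4)[of u] unfolding uv by auto
    then show "odd (card ({fst e, snd e} \<inter> I)) \<longleftrightarrow> linked (s, t) e"
      using linked_iff_odd[of s t u v] d'(3) C[of u v] e by (simp add: uv I_def)
  qed
  also have "\<dots> = {e \<in> chords K. linked (s, t) e \<and> fst e \<in> F}"
    by (auto simp: C_def)
  finally show ?thesis
    by (simp add: I_def)
qed

lemma even_chord_iff:
  assumes "(s, t) \<in> chords K"
  shows "even_chord (chords K) (s, t) \<longleftrightarrow> even_end (crossing_ends K) (mate K) s"
proof -
  have s: "s \<in> crossing_ends K" "t = mate K s"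
    using assms by (auto simp: chords_eq)
  have "{e \<in> chords K. linked (s, t) e} = {e \<in> chords K. linked (s, t) e \<and> fst e \<in> crossing_ends K}"
    by (auto simp: chords_eq)
  then show ?thesis
    using card_linked_parity[OF assms order_refl] mate_works[OF s(1)] mate_works(3) s
      end_rank_between[OF finite_crossing_ends, of s t]
    by (simp add: even_chord_def even_end_def image_subset_iff)
qed

lemma first_type_iff:
  assumes d: "(s, t) \<in> chords K" and odd: "\<not> even_chord (chords K) (s, t)"
  shows "first_type (chords K) (s, t) \<longleftrightarrow> first_end (crossing_ends K) (mate K) s"
proof -
  let ?F = "even_ends (crossing_ends K) (mate K)"
  have s: "s \<in> crossing_ends K" "t = mate K s"
    using d by (auto simp: chords_eq)
  have mate: "even_end (crossing_ends K) (mate K) (mate K x) = even_end (crossing_ends K) (mate K) x"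
    if "x \<in> crossing_ends K" for x
    using that mate_works by (simp add: even_end_def add.commute)
  then have "s \<notin> ?F" "t \<notin> ?F"
    using even_chord_iff[OF d] odd s by (auto simp: even_ends_def)
  moreover have "?F \<subseteq> crossing_ends K" "mate K ` ?F \<subseteq> ?F" "finite ?F"
    using mate mate_works(3) finite_crossing_ends by (auto simp: even_ends_def)
  moreover have "{e \<in> chords K. linked (s, t) e \<and> even_chord (chords K) e}
      = {e \<in> chords K. linked (s, t) e \<and> fst e \<in> ?F}"
    using even_chord_iff by (auto simp: even_ends_def chords_eq)
  ultimately show ?thesis
    using card_linked_parity[OF d, of ?F] mate_works(5)[OF s(1)] s odd end_rank_between[of ?F s t]
    by (simp add: first_type_def first_end_def)
qed

lemma gauss_data:
  "gauss_data (crossing_ends K) (mate K) (over_params K) (crossing_sign orient K \<circ> end_chord K)"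
proof
  show "(crossing_sign orient K \<circ> end_chord K) t \<in> {1, - 1}" for t
    by (auto simp: crossing_sign_def split: prod.splits)
  show "(crossing_sign orient K \<circ> end_chord K) (mate K t) = (crossing_sign orient K \<circ> end_chord K) t"
    if "t \<in> crossing_ends K" for t
    using mate_works[OF that] over_mate[OF that] by (simp add: end_chord_def)
qed (use finite_crossing_ends mate_works over_mate in auto)

lemma phi_bar_eq: "phi_bar orient K =
  gauss_prod (crossing_ends K) (mate K) (over_params K) (crossing_sign orient K \<circ> end_chord K)"
proof -
  interpret G: gauss_data "crossing_ends K" "mate K" "over_params K"
      "crossing_sign orient K \<circ> end_chord K"
    by (rule gauss_data)
  have "endpoint_letter orient K t =
      end_letter (crossing_ends K) (mate K) (over_params K) (crossing_sign orient K \<circ> end_chord K) t"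
    if t: "t \<in> crossing_ends K" for t
  proof -
    define s where "s = fst (end_chord K t)"
    have s: "s = (if t \<in> over_params K then t else mate K t)"
      by (simp add: s_def end_chord_def)
    have d: "end_chord K t \<in> chords K"
      using t mate_works[OF t] over_mate[OF t] by (auto simp: end_chord_def chords_eq)
    then have ev: "even_chord (chords K) (end_chord K t) \<longleftrightarrow> even_end (crossing_ends K) (mate K) t"
      using even_chord_iff[of s "snd (end_chord K t)"] G.even_end_mate[OF t] s
      by (simp add: s_def split: if_splits)
    have first: "first_type (chords K) (end_chord K t) \<longleftrightarrow> first_end (crossing_ends K) (mate K) t"
      if "\<not> even_chord (chords K) (end_chord K t)"
      using first_type_iff[of s "snd (end_chord K t)"] d G.first_end_mate[OF t] s that
      by (simp add: s_def split: if_splits)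
    have "fst (end_chord K t) = t \<longleftrightarrow> t \<in> over_params K"
      using mate_works[OF t] by (auto simp: end_chord_def)
    then show ?thesis
      using ev first
      by (simp add: endpoint_letter_def chord_at_eq[OF t] Let_def end_letter_def letter_base_def
          over_elem_def under_elem_def)
  qed
  then show ?thesis
    unfolding phi_bar_def endpoints_chords gauss_prod_def Gbar.ordered_prod_def
    using finite_crossing_ends by (intro foldr_cong) simp_all
qed

end

section \<open>Charts of the cylinder\<close>

lemma smooth_on_C1:
  assumes "smooth_on S f"
  shows "x \<in> S \<Longrightarrow> f differentiable (at x)"
    "continuous_on S (\<lambda>x. frechet_derivative f (at x) v)"
proof -
  have "Ck_on (Suc 0) S f"
    using assms by (simp only: smooth_on_def)
  then show "x \<in> S \<Longrightarrow> f differentiable (at x)"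
    "continuous_on S (\<lambda>x. frechet_derivative f (at x) v)"
    by simp_all
qed

lemma smooth_on_deriv:
  fixes v :: "real \<Rightarrow> real"
  assumes "smooth_on UNIV v"
  shows "(v has_real_derivative deriv v t) (at t)" "continuous_on UNIV (deriv v)"
proof -
  have d: "v differentiable (at t)" for t
    using smooth_on_C1(1)[OF assms] by simp
  then show "(v has_real_derivative deriv v t) (at t)"
    by (simp add: DERIV_deriv_iff_real_differentiable)
  have "frechet_derivative v (at t) 1 = deriv v t" for t
  proof -
    have "(*) (deriv v t) = frechet_derivative v (at t)"
      using d[of t] by (intro frechet_derivative_at)
        (simp add: DERIV_deriv_iff_real_differentiable[symmetric] has_field_derivative_def)
    from fun_cong[OF this, of 1] show ?thesis by simp
  qed
  then show "continuous_on UNIV (deriv v)"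
    using smooth_on_C1(2)[OF assms, of 1] by simp
qed

text \<open>The form \<open>d\<theta>\<close>: the vector \<open>(s, \<i> * z * t)\<close> at
  \<open>(x, z)\<close> has the value \<open>t\<close>.\<close>

definition angular :: "real \<times> complex \<Rightarrow> real \<times> complex \<Rightarrow> real" where
  "angular q v = Re (snd v / (\<i> * snd q))"

lemma area_form_angular: "area_form q v w = fst v * angular q w - fst w * angular q v"
  by (simp add: area_form_def angular_def)

lemma angular_linear:
  "angular q (v + w) = angular q v + angular q w" "angular q (r *\<^sub>R v) = r * angular q v"
  by (simp_all add: angular_def add_divide_distrib scaleR_conv_of_real flip: times_divide_eq_right)

lemma area_form_swap: "area_form q w v = - area_form q v w"
  by (simp add: area_form_def)

lemma linear_pair:
  fixes u :: "real \<times> real"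
  assumes "linear D"
  shows "D u = fst u *\<^sub>R D (1, 0) + snd u *\<^sub>R D (0, 1)"
proof -
  have "u = fst u *\<^sub>R (1, 0) + snd u *\<^sub>R (0, 1)"
    by (simp add: prod_eq_iff)
  from arg_cong[OF this, of D] show ?thesis
    by (simp only: linear_add[OF assms] linear_scale[OF assms])
qed

text \<open>On the image of a plane, an alternating bilinear form is a multiple of the
  determinant.\<close>

lemma area_form_linear:
  fixes u w :: "real \<times> real"
  assumes "linear D"
  shows "area_form q (D u) (D w)
    = (fst u * snd w - fst w * snd u) * area_form q (D (1, 0)) (D (0, 1))"
  unfolding linear_pair[OF assms, of u] linear_pair[OF assms, of w]
  by (simp add: area_form_angular angular_linear algebra_simps)

text \<open>The Jacobian determinant of \<open>h\<close>, that is, the coefficient of the pullback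
  of the area form.\<close>

definition orientation :: "(real \<times> real \<Rightarrow> real \<times> complex) \<Rightarrow> real \<times> real \<Rightarrow> real" where
  "orientation h y = area_form (h y) (frechet_derivative h (at y) (1, 0))
     (frechet_derivative h (at y) (0, 1))"

text \<open>Common to the discs of the moves and to maps from the whole universal cover of the
  cylinder. The latter are immersions but not injective, so injectivity is kept apart.\<close>

locale chart =
  fixes U :: "(real \<times> real) set" and h :: "real \<times> real \<Rightarrow> real \<times> complex"
  assumes open_U: "open U"
    and h_differentiable: "y \<in> U \<Longrightarrow> h differentiable (at y)"
    and h_C1: "continuous_on U (\<lambda>y. frechet_derivative h (at y) v)"
    and h_cylinder: "y \<in> U \<Longrightarrow> h y \<in> cylinder"
    and h_immersion: "y \<in> U \<Longrightarrow> inj (frechet_derivative h (at y))"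
begin

abbreviation D where "D y \<equiv> frechet_derivative h (at y)"

lemma has_derivative: "y \<in> U \<Longrightarrow> (h has_derivative D y) (at y)"
  using h_differentiable by (simp add: frechet_derivative_works)

lemma linear_D: "y \<in> U \<Longrightarrow> linear (D y)"
  by (rule has_derivative_linear[OF has_derivative])

lemma norm_snd: "y \<in> U \<Longrightarrow> cmod (snd (h y)) = 1"
  using h_cylinder[of y] by (simp add: cylinder_def mem_Times_iff)

lemma tangential:
  assumes "y \<in> U"
  shows "snd (D y v) = \<i> * snd (h y) * of_real (angular (h y) (D y v))"
proof -
  have "((\<lambda>x. snd (h x) \<bullet> snd (h x)) has_derivative
      (\<lambda>v. snd (h y) \<bullet> snd (D y v) + snd (D y v) \<bullet> snd (h y))) (at y)"
    using has_derivative[OF assms] by (auto intro!: derivative_eq_intros)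
  moreover have "((\<lambda>x. snd (h x) \<bullet> snd (h x)) has_derivative (\<lambda>v. 0)) (at y)"
  proof (rule has_derivative_transform_within_open[OF has_derivative_const open_U assms])
    show "1 = snd (h x) \<bullet> snd (h x)" if "x \<in> U" for x
      using norm_snd[OF that] by (simp add: norm_eq_1)
  qed
  ultimately have "(\<lambda>v. snd (h y) \<bullet> snd (D y v) + snd (D y v) \<bullet> snd (h y)) = (\<lambda>v. 0)"
    by (rule has_derivative_unique)
  then have "snd (h y) \<bullet> snd (D y v) = 0"
    by (auto simp: inner_commute[of "snd (D y _)"] dest: fun_cong[of _ _ v])
  define z w where "z = snd (h y)" and "w = snd (D y v)"
  have z: "Re z * Re z + Im z * Im z = 1"
    using norm_snd[OF assms] by (simp add: z_def norm_eq_1 inner_complex_def)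
  have zw: "Re z * Re w + Im z * Im w = 0"
    using \<open>snd (h y) \<bullet> snd (D y v) = 0\<close> by (simp add: z_def w_def inner_complex_def)
  have "Im w * Re (\<i> * z) - Re w * Im (\<i> * z) = 0"
    using zw by (simp add: algebra_simps)
  then have "Im (w / (\<i> * z)) = 0"
    by (simp only: Im_divide div_0)
  then have "of_real (Re (w / (\<i> * z))) = w / (\<i> * z)"
    by (simp add: complex_eq_iff)
  moreover have "z \<noteq> 0"
    using z by auto
  ultimately show ?thesis
    by (simp add: angular_def z_def w_def)
qed

text \<open>If the determinant vanished, the vectors \<open>(a2, - a1)\<close> and
  \<open>(t2, - t1)\<close> would lie in the kernel of the derivative, hence be zero. Then every
  entry of the matrix is zero and \<open>(1, 0)\<close> is in the kernel, against
  injectivity.\<close>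

lemma orientation_nonzero:
  assumes "y \<in> U"
  shows "orientation h y \<noteq> 0"
proof
  assume *: "orientation h y = 0"
  define a1 a2 t1 t2 where "a1 = fst (D y (1, 0))" and "a2 = fst (D y (0, 1))"
    and "t1 = angular (h y) (D y (1, 0))" and "t2 = angular (h y) (D y (0, 1))"
  have det: "a1 * t2 = a2 * t1"
    using * by (simp add: orientation_def area_form_angular a1_def a2_def t1_def t2_def)
  have D: "fst (D y v) = fst v * a1 + snd v * a2" "angular (h y) (D y v) = fst v * t1 + snd v * t2" for v
    using linear_pair[OF linear_D[OF assms], of v]
    by (simp_all add: a1_def a2_def t1_def t2_def angular_linear)
  have ker: "v = 0" if "fst v * a1 + snd v * a2 = 0" "fst v * t1 + snd v * t2 = 0" for v
  proof -
    have "D y v = 0"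
      using tangential[OF assms, of v] that by (simp add: prod_eq_iff D)
    then have "D y v = D y 0"
      using linear_0[OF linear_D[OF assms]] by simp
    then show ?thesis
      using h_immersion[OF assms] by (simp add: inj_eq)
  qed
  have "(a2, - a1) = 0" "(t2, - t1) = 0"
    using det by (intro ker; simp add: algebra_simps)+
  then have "(1, 0) = (0 :: real \<times> real)"
    by (intro ker) (simp_all add: prod_eq_iff)
  then show False
    by (simp add: prod_eq_iff)
qed

lemma continuous_orientation: "continuous_on U (orientation h)"
proof -
  have "continuous_on U h"
    using has_derivative has_derivative_continuous continuous_at_imp_continuous_on by blast
  moreover have "snd (h y) \<noteq> 0" if "y \<in> U" for y
    using norm_snd[OF that] by auto
  ultimately show ?thesis
    unfolding orientation_def area_form_def by (intro continuous_intros h_C1) auto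
qed

lemma orientation_same_sign:
  assumes "connected S" "S \<subseteq> U" "y \<in> S" "y' \<in> S"
  shows "sgn (orientation h y) = sgn (orientation h y')"
proof (rule ccontr)
  assume *: "\<not> ?thesis"
  have "connected (orientation h ` S)"
    using assms continuous_orientation
    by (intro connected_continuous_image) (auto intro: continuous_on_subset)
  moreover have "0 \<in> closed_segment (orientation h y) (orientation h y')"
    using * by (auto simp: closed_segment_eq_real_ivl sgn_if split: if_splits)
  moreover have "closed_segment (orientation h y) (orientation h y') \<subseteq> orientation h ` S"
    using calculation(1) assms(3,4)
    by (simp add: is_interval_connected_1[symmetric] is_interval_convex_1 convex_contains_segment)
  ultimately show False
    using orientation_nonzero assms(2) by fastforce
qed

lemma has_vector_derivative_comp:
  assumes "y t \<in> U" "(y has_vector_derivative y') (at t within I)"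
  shows "((\<lambda>\<tau>. h (y \<tau>)) has_vector_derivative D (y t) y') (at t within I)"
  using vector_derivative_diff_chain_within[OF assms(2), of h "D (y t)"]
    has_derivative_at_withinI[OF has_derivative[OF assms(1)]] by (simp add: comp_def)

text \<open>The factorization of \<open>f\<close> through the chart holds on a closed parameter
  interval that may end at \<open>t\<close>. Derivatives are therefore compared within the interval,
  where they are unique because it is not a single point.\<close>

lemma tangent_eq:
  assumes "f differentiable (at t)" "t \<in> {\<alpha>..\<beta>}" "\<alpha> < \<beta>" "y t \<in> U"
    and "\<And>\<tau>. \<tau> \<in> {\<alpha>..\<beta>} \<Longrightarrow> f \<tau> = h (y \<tau>)"
    and "(y has_vector_derivative y') (at t within {\<alpha>..\<beta>})"
  shows "tangent f t = D (y t) y'"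
proof -
  have 1: "(f has_vector_derivative D (y t) y') (at t within {\<alpha>..\<beta>})"
    by (rule has_vector_derivative_transform[OF assms(2,5)
          has_vector_derivative_comp[where y = y, OF assms(4,6)]])
  have 2: "(f has_vector_derivative tangent f t) (at t within {\<alpha>..\<beta>})"
    using assms(1) unfolding tangent_def
    by (simp add: vector_derivative_works has_vector_derivative_at_within)
  have "at t within {\<alpha>..\<beta>} \<noteq> bot"
    using assms(2,3) by (simp add: trivial_limit_within)
  then show ?thesis
    by (rule vector_derivative_unique_within[OF _ 2 1])
qed

lemma area_form_tangents:
  assumes "tangent f s = D y u" "tangent f t = D y w" "f s = h y" "y \<in> U"
  shows "area_form (f s) (tangent f s) (tangent f t)
    = (fst u * snd w - fst w * snd u) * orientation h y"
  unfolding assms(1-3) orientation_def by (rule area_form_linear[OF linear_D[OF assms(4)]])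

end

lemma disc_chartE:
  assumes "disc_chart h"
  obtains U where "chart U h" "square \<subseteq> U" "inj_on h U"
proof -
  obtain U where U: "open U" "square \<subseteq> U" "smooth_on U h" "inj_on h U" "h ` U \<subseteq> cylinder"
      "\<forall>y\<in>U. inj (frechet_derivative h (at y))"
    using assms unfolding disc_chart_def by blast
  have "chart U h"
    using U smooth_on_C1[OF U(3)] by unfold_locales auto
  then show ?thesis
    using that U by blast
qed

lemma disc_chart_orientation:
  assumes "disc_chart h"
  obtains \<epsilon> where "\<And>y. y \<in> square \<Longrightarrow> sgn (orientation h y) = \<epsilon>"
proof -
  obtain U where U: "chart U h" "square \<subseteq> U"
    using disc_chartE[OF assms] by blast
  interpret chart U h by fact
  have conn: "connected square"
    by (intro convex_connected convex_Times convex_real_interval)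
  have 0: "(0, 0) \<in> square" by simp
  show ?thesis
  proof
    show "sgn (orientation h y) = sgn (orientation h (0, 0))" if "y \<in> square" for y
      by (rule orientation_same_sign[OF conn U(2) that 0])
  qed
qed

section \<open>Strands in a disc\<close>

text \<open>\<open>\<sigma>\<close> is the direction in which the strand runs through the disc.\<close>

definition directed_strand where
  "directed_strand h f \<alpha> \<beta> g v \<sigma> \<longleftrightarrow> \<alpha> < \<beta> \<and> \<sigma> \<in> {1, -1 :: real} \<and>
     (\<forall>t\<in>{\<alpha>..\<beta>}. (v has_real_derivative deriv v t) (at t) \<and> sgn (deriv v t) = \<sigma>) \<and>
     bij_betw v {\<alpha>..\<beta>} {-1..1} \<and>
     (\<forall>s\<in>{\<alpha>..\<beta>}. \<forall>t\<in>{\<alpha>..\<beta>}. s < t \<longleftrightarrow> \<sigma> * v s < \<sigma> * v t) \<and> v \<alpha> = - \<sigma> \<and>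
     (\<forall>t\<in>{\<alpha>..\<beta>}. f t = h (v t, g (v t)))"

lemma directed_strandD:
  assumes "directed_strand h f \<alpha> \<beta> g v \<sigma>"
  shows "\<alpha> < \<beta>" "\<sigma> \<in> {1, -1}" "bij_betw v {\<alpha>..\<beta>} {-1..1}" "v \<alpha> = - \<sigma>"
    "t \<in> {\<alpha>..\<beta>} \<Longrightarrow> (v has_real_derivative deriv v t) (at t)"
    "t \<in> {\<alpha>..\<beta>} \<Longrightarrow> sgn (deriv v t) = \<sigma>"
    "s \<in> {\<alpha>..\<beta>} \<Longrightarrow> t \<in> {\<alpha>..\<beta>} \<Longrightarrow> s < t \<longleftrightarrow> \<sigma> * v s < \<sigma> * v t"
    "t \<in> {\<alpha>..\<beta>} \<Longrightarrow> f t = h (v t, g (v t))"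
    "t \<in> {\<alpha>..\<beta>} \<Longrightarrow> v t \<in> {-1..1}"
proof -
  note strand = assms[unfolded directed_strand_def]
  show "\<alpha> < \<beta>" "\<sigma> \<in> {1, -1}" "v \<alpha> = - \<sigma>"
    using strand by simp_all
  show bij: "bij_betw v {\<alpha>..\<beta>} {-1..1}"
    using strand by (elim conjE)
  show "t \<in> {\<alpha>..\<beta>} \<Longrightarrow> (v has_real_derivative deriv v t) (at t)"
    "t \<in> {\<alpha>..\<beta>} \<Longrightarrow> sgn (deriv v t) = \<sigma>"
    "s \<in> {\<alpha>..\<beta>} \<Longrightarrow> t \<in> {\<alpha>..\<beta>} \<Longrightarrow> s < t \<longleftrightarrow> \<sigma> * v s < \<sigma> * v t"
    "t \<in> {\<alpha>..\<beta>} \<Longrightarrow> f t = h (v t, g (v t))"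
    using strand by blast+
  show "t \<in> {\<alpha>..\<beta>} \<Longrightarrow> v t \<in> {-1..1}"
    by (rule bij_betwE[OF bij, rule_format])
qed

text \<open>The derivative of \<open>v\<close> is continuous without zeros on an interval, so its
  sign \<open>\<sigma>\<close> is constant and \<open>\<sigma> * v\<close> is an increasing
  bijection onto \<open>{-1..1}\<close>. At the first parameter it has its minimum, which gives
  \<open>v \<alpha> = - \<sigma>\<close>.\<close>

lemma directed_strand_exists:
  assumes "graph_strand h f {\<alpha>..\<beta>} g"
  obtains v \<sigma> where "directed_strand h f \<alpha> \<beta> g v \<sigma>"
proof -
  obtain v where v: "smooth_on UNIV v" "\<forall>t\<in>{\<alpha>..\<beta>}. deriv v t \<noteq> 0" "bij_betw v {\<alpha>..\<beta>} {-1..1}"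
      "\<forall>t\<in>{\<alpha>..\<beta>}. f t = h (v t, g (v t))"
    using assms unfolding graph_strand_def by blast
  note dv = smooth_on_deriv[OF v(1)]
  have "\<alpha> < \<beta>"
  proof (rule ccontr)
    assume "\<not> \<alpha> < \<beta>"
    then have "x = \<alpha>" if "x \<in> {\<alpha>..\<beta>}" for x using that by simp
    then have "v ` {\<alpha>..\<beta>} \<subseteq> {v \<alpha>}" by blast
    then have "{-1..1} \<subseteq> {v \<alpha>}" using v(3) by (simp add: bij_betw_def)
    then have "-1 \<in> {v \<alpha>}" "1 \<in> {v \<alpha>}" by (rule subsetD, simp)+
    then show False by simp
  qed
  define \<sigma> where "\<sigma> = sgn (deriv v \<alpha>)"
  have conn: "connected (deriv v ` {\<alpha>..\<beta>})"
    using dv(2) by (intro connected_continuous_image) (auto intro: continuous_on_subset)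
  have sgn: "sgn (deriv v t) = \<sigma>" if t: "t \<in> {\<alpha>..\<beta>}" for t
  proof (rule ccontr)
    assume *: "sgn (deriv v t) \<noteq> \<sigma>"
    have "0 \<in> closed_segment (deriv v t) (deriv v \<alpha>)"
      using * by (auto simp: closed_segment_eq_real_ivl sgn_if \<sigma>_def split: if_splits)
    moreover have "closed_segment (deriv v t) (deriv v \<alpha>) \<subseteq> deriv v ` {\<alpha>..\<beta>}"
      using conn t \<open>\<alpha> < \<beta>\<close>
      by (simp add: is_interval_connected_1[symmetric] is_interval_convex_1 convex_contains_segment)
    ultimately show False
      using v(2) by fastforce
  qed
  have \<sigma>: "\<sigma> \<in> {1, -1}"
    using v(2) \<open>\<alpha> < \<beta>\<close> by (auto simp: \<sigma>_def sgn_if)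
  have incr: "\<sigma> * v s < \<sigma> * v t" if "s \<in> {\<alpha>..\<beta>}" "t \<in> {\<alpha>..\<beta>}" "s < t" for s t
  proof (rule DERIV_pos_imp_increasing[OF that(3), of "\<lambda>t. \<sigma> * v t"])
    fix x assume "s \<le> x" "x \<le> t"
    then have "sgn (deriv v x) = \<sigma>" using sgn that by simp
    then have "\<sigma> * deriv v x > 0" using \<sigma> by (auto simp: sgn_if split: if_splits)
    moreover have "((\<lambda>t. \<sigma> * v t) has_real_derivative \<sigma> * deriv v x) (at x)"
      by (rule DERIV_cmult[OF dv(1)])
    ultimately show "\<exists>y. ((\<lambda>t. \<sigma> * v t) has_real_derivative y) (at x) \<and> 0 < y"
      by blast
  qed
  have less: "s < t \<longleftrightarrow> \<sigma> * v s < \<sigma> * v t" if "s \<in> {\<alpha>..\<beta>}" "t \<in> {\<alpha>..\<beta>}" for s t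
    using incr[of s t] incr[of t s] that by (cases s t rule: linorder_cases) auto
  have "v \<alpha> = - \<sigma>"
  proof -
    have img: "v ` {\<alpha>..\<beta>} = {-1..1}"
      using v(3) by (simp add: bij_betw_def)
    have "- \<sigma> \<in> v ` {\<alpha>..\<beta>}"
      unfolding img using \<sigma> by auto
    then obtain t where t: "t \<in> {\<alpha>..\<beta>}" "v t = - \<sigma>" by auto
    have "\<alpha> \<in> {\<alpha>..\<beta>}"
      using \<open>\<alpha> < \<beta>\<close> by simp
    then have "v \<alpha> \<in> {-1..1}"
      unfolding img[symmetric] by (rule imageI)
    then show ?thesis
      using less[of \<alpha> t] t \<sigma> \<open>\<alpha> < \<beta>\<close> by (cases "\<alpha> = t") auto
  qed
  have "directed_strand h f \<alpha> \<beta> g v \<sigma>"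
    unfolding directed_strand_def
    by (intro conjI ballI dv(1) sgn less v(3) \<open>\<alpha> < \<beta>\<close> \<sigma> \<open>v \<alpha> = - \<sigma>\<close> v(4)[rule_format])
  then show ?thesis
    by (rule that)
qed

text \<open>Two curves are allowed so that the same statement serves self-crossings, crossings of
  two strands, and the comparison of one strand in two diagrams.\<close>

lemma strands_meet:
  assumes "disc_chart h"
    and "directed_strand h f \<alpha>1 \<beta>1 g1 v1 \<sigma>1" "directed_strand h f' \<alpha>2 \<beta>2 g2 v2 \<sigma>2"
    and "\<And>x. x \<in> {-1..1} \<Longrightarrow> \<bar>g1 x\<bar> \<le> 1" "\<And>x. x \<in> {-1..1} \<Longrightarrow> \<bar>g2 x\<bar> \<le> 1"
    and "s \<in> {\<alpha>1..\<beta>1}" "t \<in> {\<alpha>2..\<beta>2}"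
  shows "f s = f' t \<longleftrightarrow> v1 s = v2 t \<and> g1 (v1 s) = g2 (v1 s)"
proof -
  obtain U where U: "square \<subseteq> U" "inj_on h U"
    using disc_chartE[OF assms(1)] by blast
  have v: "v1 s \<in> {-1..1}" "v2 t \<in> {-1..1}"
    using directed_strandD(9)[OF assms(2,6)] directed_strandD(9)[OF assms(3,7)] .
  then have "(v1 s, g1 (v1 s)) \<in> square" "(v2 t, g2 (v2 t)) \<in> square"
    using assms(4,5)[of "v1 s"] assms(4,5)[of "v2 t"] by (auto simp: abs_le_iff)
  then have "h (v1 s, g1 (v1 s)) = h (v2 t, g2 (v2 t)) \<longleftrightarrow> (v1 s, g1 (v1 s)) = (v2 t, g2 (v2 t))"
    using U by (intro inj_on_eq_iff[OF U(2)]) auto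
  then show ?thesis
    unfolding directed_strandD(8)[OF assms(2,6)] directed_strandD(8)[OF assms(3,7)] by auto
qed

text \<open>In chart coordinates the tangents are multiples of \<open>(1, deriv g1 x)\<close> and
  \<open>(1, deriv g2 x)\<close> at the common abscissa \<open>x\<close>, with factors of signs
  \<open>\<sigma>1\<close> and \<open>\<sigma>2\<close>. Their determinant is the difference of the
  slopes times these factors, and the chart contributes the sign \<open>\<epsilon>\<close> of its
  Jacobian.\<close>

lemma strands_area_form:
  assumes "disc_chart h"
    and \<epsilon>: "\<And>y. y \<in> square \<Longrightarrow> sgn (orientation h y) = \<epsilon>"
    and 1: "directed_strand h f \<alpha>1 \<beta>1 g1 v1 \<sigma>1" and 2: "directed_strand h f \<alpha>2 \<beta>2 g2 v2 \<sigma>2"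
    and g1: "\<And>x. x \<in> {-1..1} \<Longrightarrow> \<bar>g1 x\<bar> \<le> 1" and g2: "\<And>x. x \<in> {-1..1} \<Longrightarrow> \<bar>g2 x\<bar> \<le> 1"
    and g: "\<And>x. (g1 has_real_derivative deriv g1 x) (at x)"
      "\<And>x. (g2 has_real_derivative deriv g2 x) (at x)"
    and st: "s \<in> {\<alpha>1..\<beta>1}" "t \<in> {\<alpha>2..\<beta>2}" "f s = f t"
    and diff: "f differentiable (at s)" "f differentiable (at t)"
  shows "sgn (area_form (f s) (tangent f s) (tangent f t))
    = \<sigma>1 * \<sigma>2 * \<epsilon> * sgn (deriv g2 (v1 s) - deriv g1 (v1 s))"
proof -
  obtain U where U: "chart U h" "square \<subseteq> U"
    using disc_chartE[OF assms(1)] by blast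
  interpret chart U h by fact
  have meet: "v1 s = v2 t" "g1 (v2 t) = g2 (v2 t)"
    using iffD1[OF strands_meet[OF assms(1) 1 2 g1 g2 st(1,2)] st(3)] by (metis, metis)
  have v: "v1 s \<in> {-1..1}"
    by (rule directed_strandD(9)[OF 1 st(1)])
  define y where "y = (v1 s, g1 (v1 s))"
  have y: "y \<in> square"
    using v g1[OF v] by (auto simp: y_def abs_le_iff)
  have tan: "tangent f \<tau> = D (v \<tau>, g (v \<tau>)) (deriv v \<tau>, deriv g (v \<tau>) * deriv v \<tau>)"
    if str: "directed_strand h f \<alpha> \<beta> g v \<sigma>" and \<tau>: "\<tau> \<in> {\<alpha>..\<beta>}" and diff: "f differentiable (at \<tau>)"
      and in_U: "(v \<tau>, g (v \<tau>)) \<in> U" and g: "(g has_real_derivative deriv g (v \<tau>)) (at (v \<tau>))"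
    for \<alpha> \<beta> g v \<sigma> \<tau>
  proof -
    note dv = directed_strandD(5)[OF str \<tau>]
    have "((\<lambda>t. (v t, g (v t))) has_vector_derivative
        (deriv v \<tau>, deriv g (v \<tau>) * deriv v \<tau>)) (at \<tau> within {\<alpha>..\<beta>})"
      using has_vector_derivative_Pair[OF
          dv[unfolded has_real_derivative_iff_has_vector_derivative]
          DERIV_chain2[OF g dv, unfolded has_real_derivative_iff_has_vector_derivative]]
      by (rule has_vector_derivative_at_within)
    from tangent_eq[where y = "\<lambda>t. (v t, g (v t))", OF diff \<tau> directed_strandD(1)[OF str]
        in_U directed_strandD(8)[OF str] this]
    show ?thesis .
  qed
  have "(v1 s, g1 (v1 s)) \<in> U" "(v2 t, g2 (v2 t)) \<in> U"
    using subsetD[OF U(2) y] meet unfolding y_def by (metis, metis)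
  then have tangents: "tangent f s = D y (deriv v1 s, deriv g1 (v1 s) * deriv v1 s)"
    "tangent f t = D y (deriv v2 t, deriv g2 (v2 t) * deriv v2 t)"
    using tan[OF 1 st(1) diff(1) _ g(1)] tan[OF 2 st(2) diff(2) _ g(2)] unfolding y_def meet
    by blast+
  have "f s = h y"
    unfolding y_def by (rule directed_strandD(8)[OF 1 st(1)])
  from area_form_tangents[OF tangents this subsetD[OF U(2) y]]
  have "area_form (f s) (tangent f s) (tangent f t)
      = (deriv v1 s * (deriv g2 (v2 t) * deriv v2 t) - deriv v2 t * (deriv g1 (v1 s) * deriv v1 s))
        * orientation h y"
    by (simp only: fst_conv snd_conv)
  also have "\<dots> = deriv v1 s * deriv v2 t * orientation h y * (deriv g2 (v1 s) - deriv g1 (v1 s))"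
    by (simp add: meet algebra_simps)
  finally show ?thesis
    by (simp add: sgn_mult \<epsilon>[OF y] directed_strandD(6)[OF 1 st(1)] directed_strandD(6)[OF 2 st(2)])
qed

section \<open>Planar isotopy\<close>

lemma crossing_endsI: "s \<noteq> t \<Longrightarrow> curve K t = curve K s \<Longrightarrow> t \<in> crossing_ends K"
  by (auto simp: crossing_ends_def)

text \<open>An increasing change of parameter preserves ranks, both among all ends and among the
  even ones.\<close>

lemma gauss_prod_reindex:
  assumes "strict_mono \<phi>" "finite E"
    and m: "\<And>t. t \<in> E \<Longrightarrow> m (\<phi> t) = \<phi> (m' t)"
    and over: "\<And>t. t \<in> E \<Longrightarrow> \<phi> t \<in> ov \<longleftrightarrow> t \<in> ov'"
    and sign: "\<And>t. t \<in> E \<Longrightarrow> sg (\<phi> t) = sg' t"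
  shows "gauss_prod (\<phi> ` E) m ov sg = gauss_prod E m' ov' sg'"
proof -
  have inj: "inj_on \<phi> A" for A
    using assms(1) strict_mono_imp_inj_on inj_on_subset by blast
  have rank: "end_rank (\<phi> ` F) (\<phi> z) = end_rank F z" for F z
  proof -
    have "{y \<in> \<phi> ` F. y < \<phi> z} = \<phi> ` {y \<in> F. y < z}"
      using assms(1) by (auto simp: strict_mono_less)
    then show ?thesis
      by (simp add: end_rank_def card_image[OF inj])
  qed
  have ev: "even_end (\<phi> ` E) m (\<phi> t) \<longleftrightarrow> even_end E m' t" if "t \<in> E" for t
    by (simp add: even_end_def m[OF that] rank)
  then have evs: "even_ends (\<phi> ` E) m = \<phi> ` even_ends E m'"
    by (auto simp: even_ends_def)
  have "end_letter (\<phi> ` E) m ov sg (\<phi> t) = end_letter E m' ov' sg' t" if "t \<in> E" for t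
    by (simp add: end_letter_def ev[OF that] over[OF that] sign[OF that] first_end_def evs
        m[OF that] rank)
  then have "Gbar.ordered_prod E (end_letter (\<phi> ` E) m ov sg \<circ> \<phi>)
      = Gbar.ordered_prod E (end_letter E m' ov' sg')"
    using assms(2) by (intro Gbar.ordered_prod_cong) simp_all
  then show ?thesis
    unfolding gauss_prod_def by (simp add: Gbar.ordered_prod_reindex[OF assms(2,1)])
qed

section \<open>Lifts to the universal cover of the cylinder\<close>

lemma has_derivative_cyl_cover:
  "(cyl_cover has_derivative (\<lambda>v. (fst v, snd v *\<^sub>R (\<i> * cis (snd y))))) (at y)"
proof -
  have "((\<lambda>y. (fst y, cis (snd y))) has_derivative (\<lambda>v. (fst v, snd v *\<^sub>R (\<i> * cis (snd y))))) (at y)"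
    by (auto intro!: derivative_eq_intros)
  then show ?thesis
    by (simp add: cyl_cover_def case_prod_unfold)
qed

lemma frechet_derivative_cyl_cover:
  "frechet_derivative cyl_cover (at y) = (\<lambda>v. (fst v, snd v *\<^sub>R (\<i> * cis (snd y))))"
  using frechet_derivative_at[OF has_derivative_cyl_cover] by simp

lemma chart_cyl_cover: "chart UNIV cyl_cover"
proof
  show "cyl_cover differentiable (at y)" for y
    by (rule differentiableI[OF has_derivative_cyl_cover])
  show "continuous_on UNIV (\<lambda>y. frechet_derivative cyl_cover (at y) v)" for v
    unfolding frechet_derivative_cyl_cover by (intro continuous_intros)
  show "cyl_cover y \<in> cylinder" for y
    by (simp add: cyl_cover_def cylinder_def case_prod_unfold)
  show "inj (frechet_derivative cyl_cover (at y))" for y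
    unfolding frechet_derivative_cyl_cover
    by (rule injI) (auto simp: prod_eq_iff)
qed simp

lemma orientation_cyl_cover: "orientation cyl_cover y = 1"
  unfolding orientation_def frechet_derivative_cyl_cover
  by (simp add: area_form_def cyl_cover_def case_prod_unfold)

text \<open>The angle is measured from that of \<open>f s\<close>, for which \<open>\<theta>\<close>
  is a chosen value. The branch cut of \<open>Arg\<close> may make the lift discontinuous elsewhere,
  but whenever \<open>f t = f s\<close> the quotient is 1, away from the cut. So the lift is
  differentiable at both preimages of a double point and has the same value at them.\<close>

definition cyl_lift :: "(real \<Rightarrow> real \<times> complex) \<Rightarrow> real \<Rightarrow> real \<Rightarrow> real \<Rightarrow> real \<times> real" where
  "cyl_lift f \<theta> s t = (fst (f t), \<theta> + Arg (snd (f t) / snd (f s)))"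

lemma lift_through_cyl_cover:
  assumes "range f \<subseteq> cylinder" "cis \<theta> = snd (f s)"
  shows "cyl_cover (cyl_lift f \<theta> s t) = f t"
    and "f differentiable (at t) \<Longrightarrow> f t = f s \<Longrightarrow>
      \<exists>y'. (cyl_lift f \<theta> s has_vector_derivative y') (at t)"
proof -
  have norm: "cmod (snd (f t)) = 1" for t
    using subsetD[OF assms(1) rangeI[of f t]] by (simp add: cylinder_def mem_Times_iff)
  then have nz: "snd (f t) \<noteq> 0" for t
    by (metis norm_zero zero_neq_one)
  show "cyl_cover (cyl_lift f \<theta> s t) = f t"
    using norm nz assms(2)
    by (simp add: cyl_lift_def cyl_cover_def cis_mult[symmetric] cis_Arg sgn_eq norm_divide)
  assume diff: "f differentiable (at t)" and eq: "f t = f s"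
  obtain f' where f': "(f has_vector_derivative f') (at t)"
    using diff by (auto simp: vector_derivative_works)
  define q where "q = (\<lambda>t. snd (f t) / snd (f s))"
  have "q t = 1"
    using nz eq by (simp add: q_def)
  have q: "(q has_vector_derivative snd f' / snd (f s)) (at t)"
    unfolding q_def using bounded_linear.has_vector_derivative[OF bounded_linear_snd f']
    by (rule has_vector_derivative_divide)
  have "(Ln has_field_derivative inverse (q t)) (at (q t))"
    using \<open>q t = 1\<close> by (intro has_field_derivative_Ln) simp
  from field_vector_diff_chain_at[OF q this]
  have "((\<lambda>t. Im (Ln (q t))) has_vector_derivative Im (snd f' / snd (f s))) (at t)"
    using bounded_linear.has_vector_derivative[OF bounded_linear_Im] \<open>q t = 1\<close>
    by (fastforce simp: comp_def)
  moreover have "Im (Ln (q t)) = Arg (q t)" for t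
    using nz by (simp add: Arg_eq_Im_Ln q_def)
  ultimately have "((\<lambda>t. \<theta> + Arg (q t)) has_vector_derivative Im (snd f' / snd (f s))) (at t)"
    by (auto intro!: derivative_eq_intros)
  from has_vector_derivative_Pair[OF bounded_linear.has_vector_derivative[OF bounded_linear_fst f'] this]
  show "\<exists>y'. (cyl_lift f \<theta> s has_vector_derivative y') (at t)"
    unfolding cyl_lift_def q_def by blast
qed

lemma strict_mono_isotopy_parameter:
  fixes \<phi> :: "real \<Rightarrow> real"
  assumes "\<And>x. (\<phi> has_real_derivative deriv \<phi> x) (at x)" "\<And>x. deriv \<phi> x > 0"
    and far: "\<And>x. \<bar>x\<bar> > r \<Longrightarrow> \<phi> x = x"
  shows "strict_mono \<phi>" "surj \<phi>"
proof -
  show "strict_mono \<phi>"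
  proof (rule strict_monoI)
    fix x y :: real assume "x < y"
    then show "\<phi> x < \<phi> y"
      by (rule DERIV_pos_imp_increasing) (use assms(1,2) in blast)
  qed
  have cont: "isCont \<phi> x" for x
    using assms(1) DERIV_isCont by blast
  have "\<exists>x. \<phi> x = y" for y
  proof -
    \<comment> \<open>Large enough that \<open>\<phi>\<close> fixes both \<open>M\<close> and
      \<open>- M\<close> and that \<open>y\<close> lies between them, whatever the sign of
      \<open>r\<close>.\<close>
    define M where "M = max \<bar>r\<bar> \<bar>y\<bar> + 1"
    have "\<phi> (- M) = - M" "\<phi> M = M" "- M \<le> y" "y \<le> M" "- M \<le> M"
      using far[of M] far[of "- M"] by (auto simp: M_def)
    then show ?thesis
      using IVT[of \<phi> "- M" y M] cont by auto
  qed
  then show "surj \<phi>"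
    by (metis surj_def)
qed

text \<open>Smoothness of the isotopy is joint in time and position. The derivative at time 1 is
  obtained from the joint one on vectors \<open>(0, v)\<close>, tangent to the time slice, and
  inherits its continuity.\<close>

lemma isotopy_chart:
  assumes H: "smooth_on UNIV (\<lambda>(t :: real, y). H t (cyl_cover y))"
    and bij: "bij_betw (H 1) cylinder cylinder"
    and imm: "\<forall>y. inj (frechet_derivative (\<lambda>y. H 1 (cyl_cover y)) (at y))"
  shows "chart UNIV (\<lambda>y. H 1 (cyl_cover y))"
proof -
  let ?H = "\<lambda>(t :: real, y). H t (cyl_cover y)" and ?F = "\<lambda>y. H 1 (cyl_cover y)"
  interpret cover: chart UNIV cyl_cover
    by (rule chart_cyl_cover)
  have F: "(?F has_derivative (\<lambda>v. frechet_derivative ?H (at (1, y)) (0, v))) (at y)" for y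
  proof -
    have 1: "(?H has_derivative frechet_derivative ?H (at (1, y))) (at (1, y))"
      using smooth_on_C1(1)[OF H] by (simp add: frechet_derivative_works)
    have 2: "((\<lambda>y. (1, y)) has_derivative (\<lambda>v. (0, v))) (at y)"
      by (auto intro!: derivative_eq_intros)
    from has_derivative_compose[OF 2 1] show ?thesis
      by simp
  qed
  show ?thesis
  proof
    show "?F differentiable (at y)" for y
      by (rule differentiableI[OF F])
    show "continuous_on UNIV (\<lambda>y. frechet_derivative ?F (at y) v)" for v
    proof -
      have "continuous_on UNIV ((\<lambda>x. frechet_derivative ?H (at x) (0, v)) \<circ> (\<lambda>y. (1, y)))"
        using smooth_on_C1(2)[OF H, of "(0, v)"]
        by (intro continuous_on_compose continuous_intros) (auto intro: continuous_on_subset)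
      then show ?thesis
        by (simp add: comp_def frechet_derivative_at[OF F, symmetric])
    qed
    show "?F y \<in> cylinder" for y
      by (rule bij_betw_apply[OF bij]) (rule cover.h_cylinder, simp)
  qed (use imm in auto)
qed

lemma isotopy_orientation:
  assumes "chart UNIV F" and far: "\<And>y. \<bar>fst y\<bar> > r \<Longrightarrow> F y = cyl_cover y"
  shows "sgn (orientation F y) = 1"
proof -
  interpret chart UNIV F by fact
  \<comment> \<open>A point in the region where the isotopy is the identity, together with a whole
    neighbourhood, so that derivatives can be compared there.\<close>
  define y0 :: "real \<times> real" where "y0 = (\<bar>r\<bar> + 1, 0)"
  have "open {y :: real \<times> real. r < fst y}"
    by (intro open_Collect_less continuous_intros)
  then have "(F has_derivative (\<lambda>v. (fst v, snd v *\<^sub>R (\<i> * cis (snd y0))))) (at y0)"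
    using has_derivative_transform_within_open[OF has_derivative_cyl_cover[of y0],
        of "{y. r < fst y}" F] far
    by (force simp: y0_def)
  from frechet_derivative_at[OF this] have "orientation F y0 = orientation cyl_cover y0"
    using far[of y0] by (simp add: orientation_def frechet_derivative_cyl_cover y0_def)
  moreover have "sgn (orientation F y) = sgn (orientation F y0)"
    by (rule orientation_same_sign[of UNIV]) auto
  ultimately show ?thesis
    by (simp add: orientation_cyl_cover)
qed

lemma (in long_knot) curve_differentiable: "f differentiable (at t)"
  using generic smooth_on_C1(1)[of UNIV f t] by (simp add: generic_immersion_def)

lemma (in long_knot) curve_cylinder: "range f \<subseteq> cylinder"
  using generic by (simp add: generic_immersion_def)

text \<open>Both curves factor through a lift of the first one to the universal cover, which turns both
  area forms into the same determinant times a positive factor.\<close>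

lemma isotopy_area_form:
  assumes "chart UNIV (\<lambda>y. H (cyl_cover y))" and orient: "\<And>y. sgn (orientation (\<lambda>y. H (cyl_cover y)) y) = 1"
    and f: "range f \<subseteq> cylinder" "\<And>t. f differentiable (at t)" and f': "\<And>t. (H \<circ> f \<circ> \<phi>) differentiable (at t)"
    and \<phi>: "\<And>x. (\<phi> has_real_derivative deriv \<phi> x) (at x)" "\<And>x. deriv \<phi> x > 0"
    and double: "f (\<phi> s) = f (\<phi> t)"
  shows "sgn (area_form ((H \<circ> f \<circ> \<phi>) s) (tangent (H \<circ> f \<circ> \<phi>) s) (tangent (H \<circ> f \<circ> \<phi>) t))
    = sgn (area_form (f (\<phi> s)) (tangent f (\<phi> s)) (tangent f (\<phi> t)))"
proof -
  interpret cover: chart UNIV cyl_cover by (rule chart_cyl_cover)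
  interpret F: chart UNIV "\<lambda>y. H (cyl_cover y)" by fact
  define \<theta> where "\<theta> = Arg (snd (f (\<phi> s)))"
  have "cmod (snd (f (\<phi> s))) = 1"
    using subsetD[OF f(1) rangeI[of f "\<phi> s"]] by (simp add: cylinder_def mem_Times_iff)
  moreover from this have "snd (f (\<phi> s)) \<noteq> 0"
    by (metis norm_zero zero_neq_one)
  ultimately have \<theta>: "cis \<theta> = snd (f (\<phi> s))"
    by (simp add: \<theta>_def cis_Arg sgn_eq)
  define y where "y = cyl_lift f \<theta> (\<phi> s)"
  note lift = lift_through_cyl_cover[OF f(1) \<theta>, folded y_def]
  obtain u where u: "(y has_vector_derivative u) (at (\<phi> s))"
    using lift(2)[OF f(2)] by blast
  obtain w where w: "(y has_vector_derivative w) (at (\<phi> t))"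
    using lift(2)[OF f(2)] double by metis
  define q where "q = y (\<phi> s)"
  have q: "y (\<phi> t) = q"
    using double by (simp add: q_def y_def cyl_lift_def)
  have tangent1: "tangent f \<tau> = cover.D (y \<tau>) v" if "(y has_vector_derivative v) (at \<tau>)" for \<tau> v
    by (rule cover.tangent_eq[of f \<tau> "\<tau> - 1" "\<tau> + 1" y])
      (use that f(2) lift(1) in \<open>auto intro: has_vector_derivative_at_within\<close>)
  have tangent2: "tangent (H \<circ> f \<circ> \<phi>) \<tau> = F.D (y (\<phi> \<tau>)) (deriv \<phi> \<tau> *\<^sub>R v)"
    if v: "(y has_vector_derivative v) (at (\<phi> \<tau>))" for \<tau> v
  proof (rule F.tangent_eq[of _ \<tau> "\<tau> - 1" "\<tau> + 1" "\<lambda>\<tau>. y (\<phi> \<tau>)"])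
    have "((y \<circ> \<phi>) has_vector_derivative deriv \<phi> \<tau> *\<^sub>R v) (at \<tau>)"
      using \<phi>(1)[of \<tau>] v
      by (intro vector_diff_chain_at) (simp_all add: has_real_derivative_iff_has_vector_derivative)
    then show "((\<lambda>\<tau>. y (\<phi> \<tau>)) has_vector_derivative deriv \<phi> \<tau> *\<^sub>R v) (at \<tau> within {\<tau> - 1..\<tau> + 1})"
      by (auto simp: comp_def intro: has_vector_derivative_at_within)
  qed (use f' lift(1) in auto)
  have "area_form (f (\<phi> s)) (tangent f (\<phi> s)) (tangent f (\<phi> t)) = fst u * snd w - fst w * snd u"
    using cover.area_form_tangents[OF tangent1[OF u, folded q_def] tangent1[OF w, unfolded q]]
    by (simp add: orientation_cyl_cover q_def lift(1))
  moreover have "area_form ((H \<circ> f \<circ> \<phi>) s) (tangent (H \<circ> f \<circ> \<phi>) s) (tangent (H \<circ> f \<circ> \<phi>) t)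
      = deriv \<phi> s * deriv \<phi> t * (fst u * snd w - fst w * snd u) * orientation (\<lambda>y. H (cyl_cover y)) q"
    using F.area_form_tangents[OF tangent2[OF u, folded q_def] tangent2[OF w, unfolded q]]
    by (simp add: q_def lift(1) algebra_simps)
  ultimately show ?thesis
    using \<phi>(2) by (simp add: sgn_mult orient)
qed

lemma phi_bar_planar_isotopic:
  assumes "long_knot_diagram p K" "long_knot_diagram p K'" "planar_isotopic K K'" "orient \<in> {1, -1}"
  shows "phi_bar orient K = phi_bar orient K'"
proof -
  interpret K: long_knot p K by unfold_locales fact
  interpret K': long_knot p K' by unfold_locales fact
  obtain H \<phi> r where H: "smooth_on UNIV (\<lambda>(t :: real, y). H t (cyl_cover y))"
      "\<forall>t\<in>{0..1}. bij_betw (H t) cylinder cylinder \<and>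
        (\<forall>y. inj (frechet_derivative (\<lambda>y. H t (cyl_cover y)) (at y)))"
      "\<forall>t\<in>{0..1}. \<forall>q\<in>cylinder. \<bar>fst q\<bar> > r \<longrightarrow> H t q = q"
    and \<phi>: "smooth_on UNIV \<phi>" "\<forall>x. deriv \<phi> x > 0" "\<forall>x::real. \<bar>x\<bar> > r \<longrightarrow> \<phi> x = x"
    and K': "curve K' = H 1 \<circ> curve K \<circ> \<phi>" "over_params K' = \<phi> -` over_params K"
    using assms(3) unfolding planar_isotopic_def by (elim exE conjE) (rule that)
  have bij: "bij_betw (H 1) cylinder cylinder"
    and imm: "\<forall>y. inj (frechet_derivative (\<lambda>y. H 1 (cyl_cover y)) (at y))"
    using bspec[OF H(2), of 1] by auto
  note chart = isotopy_chart[OF H(1) bij imm]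
  have "H 1 (cyl_cover y) = cyl_cover y" if "\<bar>fst y\<bar> > r" for y
    using H(3)[rule_format, of 1 "cyl_cover y"] that chart.h_cylinder[OF chart_cyl_cover, of y]
    by (simp add: cyl_cover_def case_prod_unfold)
  note orientation = isotopy_orientation[OF chart this]
  have d\<phi>: "(\<phi> has_real_derivative deriv \<phi> x) (at x)" "deriv \<phi> x > 0" for x
    using smooth_on_deriv(1)[OF \<phi>(1)] \<phi>(2) by auto
  have mono: "strict_mono \<phi>" and surj: "surj \<phi>"
    using strict_mono_isotopy_parameter[OF d\<phi>] \<phi>(3) by blast+
  have inj: "\<phi> s = \<phi> t \<longleftrightarrow> s = t" for s t
    using mono by (simp add: strict_mono_eq)
  have double: "curve K' s = curve K' t \<longleftrightarrow> curve K (\<phi> s) = curve K (\<phi> t)" for s t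
    using inj_on_eq_iff[OF bij_betw_imp_inj_on[OF bij], of "curve K (\<phi> s)" "curve K (\<phi> t)"]
      K.curve_cylinder by (auto simp: K')
  have ends: "crossing_ends K = \<phi> ` crossing_ends K'"
  proof (intro equalityI subsetI)
    fix t assume "t \<in> crossing_ends K"
    then obtain s where s: "s \<noteq> t" "curve K t = curve K s"
      by (auto simp: crossing_ends_def)
    obtain s' t' where st: "s = \<phi> s'" "t = \<phi> t'"
      using surj by (metis surjD)
    have "t' \<in> crossing_ends K'"
      using s st double by (intro crossing_endsI[of s']) auto
    then show "t \<in> \<phi> ` crossing_ends K'"
      using st by blast
  next
    fix t assume "t \<in> \<phi> ` crossing_ends K'"
    then obtain s' t' where "t = \<phi> t'" "s' \<noteq> t'" "curve K' t' = curve K' s'"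
      by (auto simp: crossing_ends_def)
    then show "t \<in> crossing_ends K"
      using double inj by (intro crossing_endsI[of "\<phi> s'"]) auto
  qed
  have mate: "mate K (\<phi> t) = \<phi> (mate K' t)" if "t \<in> crossing_ends K'" for t
    using K'.mate_works[OF that] double inj by (intro K.mate_eqI) auto
  have sign: "crossing_sign orient K (end_chord K (\<phi> t)) = crossing_sign orient K' (end_chord K' t)"
    if t: "t \<in> crossing_ends K'" for t
  proof -
    have "end_chord K (\<phi> t) = map_prod \<phi> \<phi> (end_chord K' t)"
      using mate[OF t] by (simp add: end_chord_def K'(2))
    moreover obtain s s' where ss: "end_chord K' t = (s, s')"
      by fastforce
    moreover have "curve K' s = curve K' s'"
      using ss K'.mate_works[OF t] by (auto simp: end_chord_def split: if_splits)
    then have "sgn (area_form (curve K' s) (tangent (curve K') s) (tangent (curve K') s'))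
        = sgn (area_form (curve K (\<phi> s)) (tangent (curve K) (\<phi> s)) (tangent (curve K) (\<phi> s')))"
      unfolding K'(1)
      by (intro isotopy_area_form[OF chart orientation K.curve_cylinder K.curve_differentiable _ d\<phi>])
        (use K'.curve_differentiable K'(1) double in auto)
    ultimately show ?thesis
      by (auto simp: crossing_sign_def zero_less_mult_iff sgn_if split: if_splits)
  qed
  have "gauss_prod (\<phi> ` crossing_ends K') (mate K) (over_params K) (crossing_sign orient K \<circ> end_chord K)
      = gauss_prod (crossing_ends K') (mate K') (over_params K') (crossing_sign orient K' \<circ> end_chord K')"
    using mate sign by (intro gauss_prod_reindex mono K'.finite_crossing_ends) (simp_all add: K'(2))
  then show ?thesis
    by (simp add: K.phi_bar_eq K'.phi_bar_eq ends)
qed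

section \<open>Diagrams that agree outside a disc\<close>

lemma same_outside_preimage:
  assumes "same_outside h J K K'"
  shows "curve K t \<in> h ` square \<longleftrightarrow> t \<in> J" "curve K' t \<in> h ` square \<longleftrightarrow> t \<in> J"
proof -
  have "curve K -` (h ` square) = J" "curve K' -` (h ` square) = J"
    using assms by (simp_all only: same_outside_def)
  then show "curve K t \<in> h ` square \<longleftrightarrow> t \<in> J" "curve K' t \<in> h ` square \<longleftrightarrow> t \<in> J"
    by (metis vimage_eq)+
qed

lemma same_outside_agree:
  assumes "same_outside h J K K'" "t \<notin> J"
  shows "curve K t = curve K' t" "t \<in> over_params K \<longleftrightarrow> t \<in> over_params K'"
  using assms by (simp_all add: same_outside_def)

text \<open>Each curve is in the disc exactly at the parameters in the intervals, so the two
  preimages of a double point are both inside or both outside. Outside, the diagrams have the same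
  chords; only the parity of the number of ends in each interval is left to the individual
  moves.\<close>

lemma same_outside_gauss_move:
  assumes "long_knot_diagram p K" "long_knot_diagram p K'"
    and same: "same_outside h (\<Union>i\<in>N. {\<alpha> i..\<beta> i}) K K'"
    and N: "finite N" "\<And>i. i \<in> N \<Longrightarrow> \<alpha> i \<le> \<beta> i" "disjoint_family_on (\<lambda>i. {\<alpha> i..\<beta> i}) N"
    and parity: "\<And>i. i \<in> N \<Longrightarrow> even (card (crossing_ends K \<inter> {\<alpha> i..\<beta> i}))
      \<longleftrightarrow> even (card (crossing_ends K' \<inter> {\<alpha> i..\<beta> i}))"
  shows "gauss_move N \<alpha> \<beta>
    (crossing_ends K) (mate K) (over_params K) (crossing_sign orient K \<circ> end_chord K)
    (crossing_ends K') (mate K') (over_params K') (crossing_sign orient K' \<circ> end_chord K')"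
proof -
  interpret K: long_knot p K by unfold_locales fact
  interpret K': long_knot p K' by unfold_locales fact
  define J where "J = (\<Union>i\<in>N. {\<alpha> i..\<beta> i})"
  have preimage: "curve K t \<in> h ` square \<longleftrightarrow> t \<in> J" "curve K' t \<in> h ` square \<longleftrightarrow> t \<in> J" for t
    using same_outside_preimage[OF same] by (simp_all add: J_def)
  have out: "curve K t = curve K' t" "t \<in> over_params K \<longleftrightarrow> t \<in> over_params K'" if "t \<notin> J" for t
    using same_outside_agree[OF same] that by (simp_all add: J_def)
  have partner: "s \<notin> J" if "curve K t = curve K s \<or> curve K' t = curve K' s" "t \<notin> J" for s t
    using that preimage[of s] preimage[of t] by auto
  have double: "curve K t = curve K s \<longleftrightarrow> curve K' t = curve K' s" if "t \<notin> J" for s t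
    using partner[OF _ that, of s] out(1)[OF that] out(1)[of s] by auto
  have ends: "t \<in> crossing_ends K \<longleftrightarrow> t \<in> crossing_ends K'" if "t \<notin> J" for t
    using double[OF that] by (simp add: crossing_ends_def)
  have mate: "mate K' t = mate K t" "mate K t \<notin> J" if t: "t \<in> crossing_ends K" "t \<notin> J" for t
  proof -
    note m = K.mate_works[OF t(1)]
    have "curve K' t = curve K' (mate K t)"
      using double[OF t(2)] m(2) by metis
    then show "mate K' t = mate K t"
      using m(1) by (rule K'.mate_eqI)
    show "mate K t \<notin> J"
      using partner[OF _ t(2), of "mate K t"] m(2) by simp
  qed
  \<comment> \<open>Closedness makes the two curves agree on a neighbourhood of every outside
    parameter, so that their tangents agree too.\<close>
  have "closed J"
    unfolding J_def using N(1) by (intro closed_UN) auto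
  have tangent: "tangent (curve K) t = tangent (curve K') t" if "t \<notin> J" for t
  proof -
    have "\<forall>\<^sub>F x in nhds t. x \<in> - J"
      using \<open>closed J\<close> that by (intro eventually_nhds_in_open) auto
    then have "\<forall>\<^sub>F x in nhds t. x \<in> UNIV \<longrightarrow> curve K x = curve K' x"
      by eventually_elim (simp add: out)
    then show ?thesis
      unfolding tangent_def by (intro vector_derivative_cong_eq) auto
  qed
  have sign: "crossing_sign orient K' (end_chord K' t) = crossing_sign orient K (end_chord K t)"
    if t: "t \<in> crossing_ends K" "t \<notin> J" for t
    using mate[OF t] out[OF t(2)] out[OF mate(2)[OF t]] tangent[OF t(2)] tangent[OF mate(2)[OF t]]
    by (simp add: end_chord_def crossing_sign_def)
  have change: "interval_change N \<alpha> \<beta> (crossing_ends K) (crossing_ends K')"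
    using N K.finite_crossing_ends K'.finite_crossing_ends ends[unfolded J_def] parity
    by (intro interval_change.intro)
  have agree: "gauss_move_axioms N \<alpha> \<beta>
      (crossing_ends K) (mate K) (over_params K) (crossing_sign orient K \<circ> end_chord K)
      (mate K') (over_params K') (crossing_sign orient K' \<circ> end_chord K')"
  proof (rule gauss_move_axioms.intro)
    fix t assume t: "t \<in> crossing_ends K" "t \<notin> (\<Union>i\<in>N. {\<alpha> i..\<beta> i})"
    note t' = t[folded J_def]
    show "mate K' t = mate K t \<and> mate K t \<notin> (\<Union>i\<in>N. {\<alpha> i..\<beta> i})"
      using mate[OF t'] by (simp add: J_def)
    show "t \<in> over_params K \<longleftrightarrow> t \<in> over_params K'"
      by (rule out(2)[OF t'(2)])
    show "(crossing_sign orient K' \<circ> end_chord K') t = (crossing_sign orient K \<circ> end_chord K) t"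
      using sign[OF t'] by simp
  qed
  show ?thesis
    by (rule gauss_move.intro[OF K.gauss_data K'.gauss_data change agree])
qed

lemma phi_bar_R1:
  assumes K: "long_knot_diagram p K" and K': "long_knot_diagram p K'" and "R1 K K'"
  shows "phi_bar orient K = phi_bar orient K'"
proof -
  interpret K: long_knot p K by unfold_locales fact
  interpret K': long_knot p K' by unfold_locales fact
  obtain h \<alpha> \<beta> where "\<alpha> < \<beta>" and same: "same_outside h {\<alpha>..\<beta>} K K'"
    and inj: "inj_on (curve K) {\<alpha>..\<beta>}"
    and card: "card {(s, t). \<alpha> \<le> s \<and> s < t \<and> t \<le> \<beta> \<and> curve K' s = curve K' t} = 1"
    using assms(3) unfolding R1_def by (elim exE conjE) (rule that)
  have preimage: "curve K t \<in> h ` square \<longleftrightarrow> t \<in> {\<alpha>..\<beta>}" "curve K' t \<in> h ` square \<longleftrightarrow> t \<in> {\<alpha>..\<beta>}" for t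
    using same_outside_preimage[OF same] by simp_all
  have partner: "mate K t \<in> {\<alpha>..\<beta>}" if "t \<in> crossing_ends K" "t \<in> {\<alpha>..\<beta>}" for t
    using preimage(1)[of t] preimage(1)[of "mate K t"] K.mate_works(2)[OF that(1)] that(2) by simp
  have partner': "mate K' t \<in> {\<alpha>..\<beta>}" if "t \<in> crossing_ends K'" "t \<in> {\<alpha>..\<beta>}" for t
    using preimage(2)[of t] preimage(2)[of "mate K' t"] K'.mate_works(2)[OF that(1)] that(2) by simp
  have 1: "crossing_ends K \<inter> {\<alpha>..\<beta>} = {}"
  proof (rule equals0I)
    fix t assume t: "t \<in> crossing_ends K \<inter> {\<alpha>..\<beta>}"
    then have "mate K t = t"
      using partner[of t] K.mate_works(2)[of t] by (intro inj_onD[OF inj]) auto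
    then show False
      using K.mate_works(1)[of t] t by simp
  qed
  obtain s t where st: "{(s, t). \<alpha> \<le> s \<and> s < t \<and> t \<le> \<beta> \<and> curve K' s = curve K' t} = {(s, t)}"
    using card by (auto simp: card_1_singleton_iff)
  then have "(s, t) \<in> {(s, t). \<alpha> \<le> s \<and> s < t \<and> t \<le> \<beta> \<and> curve K' s = curve K' t}"
    by simp
  then have s: "\<alpha> \<le> s" "s < t" "t \<le> \<beta>" "curve K' s = curve K' t"
    by simp_all
  have unique: "u = s \<and> w = t" if "\<alpha> \<le> u" "u < w" "w \<le> \<beta>" "curve K' u = curve K' w" for u w
  proof -
    have "(u, w) \<in> {(s, t)}"
      unfolding st[symmetric] using that by simp
    then show ?thesis by simp
  qed
  have 2: "crossing_ends K' \<inter> {\<alpha>..\<beta>} = {s, t}"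
  proof
    show "crossing_ends K' \<inter> {\<alpha>..\<beta>} \<subseteq> {s, t}"
    proof
      fix u assume u: "u \<in> crossing_ends K' \<inter> {\<alpha>..\<beta>}"
      then have "mate K' u \<noteq> u" "curve K' (mate K' u) = curve K' u" "mate K' u \<in> {\<alpha>..\<beta>}"
        using K'.mate_works partner' by auto
      then show "u \<in> {s, t}"
        using unique[of u "mate K' u"] unique[of "mate K' u" u] u
        by (cases "u < mate K' u") (auto simp: not_less)
    qed
    show "{s, t} \<subseteq> crossing_ends K' \<inter> {\<alpha>..\<beta>}"
      using s crossing_endsI[of s t K'] crossing_endsI[of t s K'] by simp
  qed
  have "gauss_move {0} (\<lambda>_. \<alpha>) (\<lambda>_. \<beta>)
    (crossing_ends K) (mate K) (over_params K) (crossing_sign orient K \<circ> end_chord K)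
    (crossing_ends K') (mate K') (over_params K') (crossing_sign orient K' \<circ> end_chord K')"
    using \<open>\<alpha> < \<beta>\<close> same 1 2 s(2)
    by (intro same_outside_gauss_move[OF K K']) (simp_all add: disjoint_family_on_def)
  moreover have "mate K' s = t"
    using s by (intro K'.mate_eqI) auto
  ultimately show ?thesis
    unfolding K.phi_bar_eq K'.phi_bar_eq using 1 2 s(2)
    by (intro gauss_prod_R1[of 0 "\<lambda>_. \<alpha>" "\<lambda>_. \<beta>" _ _ _ _ _ _ _ _ s t]) simp_all
qed

section \<open>Double points of strands and the second move\<close>

lemma directed_strand_cong:
  assumes "directed_strand h f \<alpha> \<beta> g v \<sigma>" "\<And>t. t \<in> {\<alpha>..\<beta>} \<Longrightarrow> f t = f' t"
  shows "directed_strand h f' \<alpha> \<beta> g v \<sigma>"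
  unfolding directed_strand_def
proof (intro conjI ballI directed_strandD[OF assms(1)])
  fix t assume "t \<in> {\<alpha>..\<beta>}"
  then show "f' t = h (v t, g (v t))"
    using assms(2) directed_strandD(8)[OF assms(1)] by metis
qed

lemma directed_strand_inj:
  assumes "directed_strand h f \<alpha> \<beta> g v \<sigma>" "s \<in> {\<alpha>..\<beta>}" "t \<in> {\<alpha>..\<beta>}"
  shows "v s = v t \<longleftrightarrow> s = t"
  using inj_on_eq_iff[OF bij_betw_imp_inj_on[OF directed_strandD(3)[OF assms(1)]] assms(2,3)] .

lemma directed_strand_surj:
  assumes "directed_strand h f \<alpha> \<beta> g v \<sigma>" "x \<in> {-1..1}"
  obtains t where "t \<in> {\<alpha>..\<beta>}" "v t = x"
proof -
  have "x \<in> v ` {\<alpha>..\<beta>}"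
    using assms(2) bij_betw_imp_surj_on[OF directed_strandD(3)[OF assms(1)]] by simp
  then show ?thesis
    by (elim imageE) (simp add: that)
qed

lemma directed_strand_no_self_crossing:
  assumes "disc_chart h" "directed_strand h f \<alpha> \<beta> g v \<sigma>" "\<And>x. x \<in> {-1..1} \<Longrightarrow> \<bar>g x\<bar> \<le> 1"
    and "s \<in> {\<alpha>..\<beta>}" "t \<in> {\<alpha>..\<beta>}" "f s = f t"
  shows "s = t"
  using iffD1[OF strands_meet[OF assms(1,2,2,3,3,4,5)] assms(6)] directed_strand_inj[OF assms(2,4,5)]
  by simp

text \<open>\<open>crossing_sign\<close> gives -1 to a vanishing area form, so the product formula
  is restricted to transverse crossings.\<close>

lemma crossing_sign_sgn:
  assumes "orient \<in> {1, -1}" "area_form (curve K s) (tangent (curve K) s) (tangent (curve K) t) \<noteq> 0"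
  shows "of_int (crossing_sign orient K (s, t))
    = of_int orient * sgn (area_form (curve K s) (tangent (curve K) s) (tangent (curve K) t))"
  using assms by (auto simp: crossing_sign_def sgn_if)

text \<open>With equal signs, \<open>c * k\<close> would be positive just after \<open>x1\<close>
  and negative just before \<open>x2\<close>, and would vanish in between. This is what makes the
  two crossings of a second move have opposite signs.\<close>

lemma consecutive_simple_zeros:
  fixes k :: "real \<Rightarrow> real"
  assumes k: "\<And>x. (k has_real_derivative k' x) (at x)" and "x1 < x2" "k x1 = 0" "k x2 = 0"
    and nz: "k' x1 \<noteq> 0" "k' x2 \<noteq> 0" and no_zero: "\<And>x. x1 < x \<Longrightarrow> x < x2 \<Longrightarrow> k x \<noteq> 0"
  shows "sgn (k' x2) = - sgn (k' x1)"
proof (rule ccontr)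
  assume neq: "sgn (k' x2) \<noteq> - sgn (k' x1)"
  define c where "c = sgn (k' x1)"
  have c: "c * k' x1 > 0" "c * k' x2 > 0"
    using neq nz by (auto simp: c_def sgn_if split: if_splits)
  have dk: "((\<lambda>x. c * k x) has_real_derivative c * k' x) (at x)" for x
    by (rule DERIV_cmult[OF k])
  obtain d1 where d1: "d1 > 0" "\<And>h. 0 < h \<Longrightarrow> h < d1 \<Longrightarrow> c * k x1 < c * k (x1 + h)"
    using DERIV_pos_inc_right[OF dk c(1)] by blast
  obtain d2 where d2: "d2 > 0" "\<And>h. 0 < h \<Longrightarrow> h < d2 \<Longrightarrow> c * k (x2 - h) < c * k x2"
    using DERIV_pos_inc_left[OF dk c(2)] by blast
  \<comment> \<open>The third keeps \<open>h\<close> strictly below \<open>d1\<close> and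
    \<open>d2\<close> and leaves room between \<open>x1 + h\<close> and
    \<open>x2 - h\<close>.\<close>
  define h where "h = min (min d1 d2) (x2 - x1) / 3"
  have "0 < 3 * h" "3 * h \<le> d1" "3 * h \<le> d2" "3 * h \<le> x2 - x1"
    using d1(1) d2(1) \<open>x1 < x2\<close> by (simp_all add: h_def)
  then have h: "0 < h" "h < d1" "h < d2" "x1 + h < x2 - h"
    by linarith+
  have "\<exists>x. x1 + h \<le> x \<and> x \<le> x2 - h \<and> c * k x = 0"
    using d1(2)[OF h(1,2)] d2(2)[OF h(1,3)] h(4) DERIV_isCont[OF dk] assms(3,4)
    by (intro IVT2) auto
  then obtain x where x: "x1 + h \<le> x" "x \<le> x2 - h" "c * k x = 0"
    by blast
  moreover have "c \<noteq> 0"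
    using c by auto
  ultimately show False
    using no_zero[of x] h(1) by simp
qed

lemma phi_bar_R2:
  assumes K: "long_knot_diagram p K" and K': "long_knot_diagram p K'" and "R2 K K'"
    and orient: "orient \<in> {1, -1}"
  shows "phi_bar orient K = phi_bar orient K'"
proof -
  interpret K: long_knot p K by unfold_locales fact
  interpret K': long_knot p K' by unfold_locales fact
  obtain h \<alpha>1 \<beta>1 \<alpha>2 \<beta>2 g k is_over where
     chart: "disc_chart h" and disjoint: "{\<alpha>1..\<beta>1} \<inter> {\<alpha>2..\<beta>2} = {}"
     and same: "same_outside h ({\<alpha>1..\<beta>1} \<union> {\<alpha>2..\<beta>2}) K K'"
     and g: "\<forall>x\<in>{-1..1}. 0 < g x \<and> g x < 1"
     and k: "smooth_on UNIV k" "\<forall>x\<in>{-1..1}. \<bar>k x\<bar> < 1" and zeros: "card {x\<in>{-1..1}. k x = 0} = 2"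
     and fixed: "\<forall>t\<in>{\<alpha>1..\<beta>1}. curve K t = curve K' t"
     and strands: "graph_strand h (curve K) {\<alpha>1..\<beta>1} (\<lambda>_. 0)"
       "graph_strand h (curve K) {\<alpha>2..\<beta>2} g" "graph_strand h (curve K') {\<alpha>2..\<beta>2} k"
     and over: "\<forall>s\<in>{\<alpha>1..\<beta>1}. \<forall>t\<in>{\<alpha>2..\<beta>2}.
        curve K' s = curve K' t \<longrightarrow> (t \<in> over_params K' \<longleftrightarrow> is_over)"
    using assms(3) unfolding R2_def by (elim exE conjE) (rule that)
  define J where "J = {\<alpha>1..\<beta>1} \<union> {\<alpha>2..\<beta>2}"
  note preimage = same_outside_preimage[OF same, folded J_def]
  have partner: "mate K t \<in> J" if "t \<in> crossing_ends K" "t \<in> J" for t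
    using preimage(1)[of t] preimage(1)[of "mate K t"] K.mate_works(2)[OF that(1)] that(2) by simp
  have partner': "mate K' t \<in> J" if "t \<in> crossing_ends K'" "t \<in> J" for t
    using preimage(2)[of t] preimage(2)[of "mate K' t"] K'.mate_works(2)[OF that(1)] that(2) by simp
  obtain v1 \<sigma>1 where s1: "directed_strand h (curve K) \<alpha>1 \<beta>1 (\<lambda>_. 0) v1 \<sigma>1"
    using directed_strand_exists[OF strands(1)] .
  obtain v2 \<sigma>2 where s2: "directed_strand h (curve K) \<alpha>2 \<beta>2 g v2 \<sigma>2"
    using directed_strand_exists[OF strands(2)] .
  obtain w2 \<tau>2 where s2': "directed_strand h (curve K') \<alpha>2 \<beta>2 k w2 \<tau>2"
    using directed_strand_exists[OF strands(3)] .
  have s1': "directed_strand h (curve K') \<alpha>1 \<beta>1 (\<lambda>_. 0) v1 \<sigma>1"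
    by (rule directed_strand_cong[OF s1]) (rule fixed[rule_format])
  have bound: "\<bar>0 :: real\<bar> \<le> 1" "\<And>x. x \<in> {-1..1} \<Longrightarrow> \<bar>g x\<bar> \<le> 1" "\<And>x. x \<in> {-1..1} \<Longrightarrow> \<bar>k x\<bar> \<le> 1"
    using g k(2) by (auto simp: abs_le_iff dest!: bspec)
  note self = directed_strand_no_self_crossing[OF chart]
  \<comment> \<open>Before the move the second strand stays above the horizontal one, since
    \<open>g\<close> is positive.\<close>
  have apart: False if "s \<in> {\<alpha>1..\<beta>1}" "t \<in> {\<alpha>2..\<beta>2}" "curve K s = curve K t" for s t
    using iffD1[OF strands_meet[OF chart s1 s2 bound(1,2) that(1,2)] that(3)]
      g directed_strandD(9)[OF s1 that(1)] by force
  have 1: "crossing_ends K \<inter> {\<alpha>1..\<beta>1} = {}"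
  proof (rule equals0I)
    fix t assume "t \<in> crossing_ends K \<inter> {\<alpha>1..\<beta>1}"
    then have t: "t \<in> crossing_ends K" "t \<in> {\<alpha>1..\<beta>1}" by auto
    note m = K.mate_works[OF t(1)]
    have "mate K t \<in> {\<alpha>1..\<beta>1} \<or> mate K t \<in> {\<alpha>2..\<beta>2}"
      using partner[OF t(1)] t(2) by (auto simp: J_def)
    then show False
      using self[OF s1 bound(1), of "mate K t" t] apart[of t "mate K t"] m(1,2) t(2) by metis
  qed
  have 2: "crossing_ends K \<inter> {\<alpha>2..\<beta>2} = {}"
  proof (rule equals0I)
    fix t assume "t \<in> crossing_ends K \<inter> {\<alpha>2..\<beta>2}"
    then have t: "t \<in> crossing_ends K" "t \<in> {\<alpha>2..\<beta>2}" by auto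
    note m = K.mate_works[OF t(1)]
    have "mate K t \<in> {\<alpha>1..\<beta>1} \<or> mate K t \<in> {\<alpha>2..\<beta>2}"
      using partner[OF t(1)] t(2) by (auto simp: J_def)
    then show False
      using self[OF s2 bound(2), of "mate K t" t] apart[of "mate K t" t] m(1,2) t(2) by metis
  qed
  obtain x1 x2 where x: "{x\<in>{-1..1}. k x = 0} = {x1, x2}" "x1 < x2"
  proof -
    obtain x y where xy: "{x\<in>{-1..1}. k x = 0} = {x, y}" "x \<noteq> y"
      using zeros by (auto simp: card_2_iff)
    show ?thesis
    proof (cases "x < y")
      case False
      then show ?thesis using xy by (intro that[of y x]) auto
    qed (rule that[OF xy(1)])
  qed
  have zero: "k y = 0 \<longleftrightarrow> y = x1 \<or> y = x2" if "y \<in> {-1..1}" for y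
  proof -
    have "k y = 0 \<longleftrightarrow> y \<in> {x\<in>{-1..1}. k x = 0}"
      using that by simp
    then show ?thesis
      unfolding x(1) by simp
  qed
  have "x1 \<in> {x\<in>{-1..1}. k x = 0}" "x2 \<in> {x\<in>{-1..1}. k x = 0}"
    unfolding x(1) by simp_all
  then have xs: "x1 \<in> {-1..1}" "x2 \<in> {-1..1}" "k x1 = 0" "k x2 = 0"
    by simp_all
  obtain p1 where p1: "p1 \<in> {\<alpha>1..\<beta>1}" "v1 p1 = x1"
    using directed_strand_surj[OF s1 xs(1)] .
  obtain p2 where p2: "p2 \<in> {\<alpha>1..\<beta>1}" "v1 p2 = x2"
    using directed_strand_surj[OF s1 xs(2)] .
  obtain q1 where q1: "q1 \<in> {\<alpha>2..\<beta>2}" "w2 q1 = x1"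
    using directed_strand_surj[OF s2' xs(1)] .
  obtain q2 where q2: "q2 \<in> {\<alpha>2..\<beta>2}" "w2 q2 = x2"
    using directed_strand_surj[OF s2' xs(2)] .
  have meet: "curve K' s = curve K' t \<longleftrightarrow> s = p1 \<and> t = q1 \<or> s = p2 \<and> t = q2"
    if "s \<in> {\<alpha>1..\<beta>1}" "t \<in> {\<alpha>2..\<beta>2}" for s t
  proof -
    have "curve K' s = curve K' t \<longleftrightarrow> v1 s = w2 t \<and> k (v1 s) = 0"
      using strands_meet[OF chart s1' s2' bound(1,3) that] by auto
    also have "\<dots> \<longleftrightarrow> (v1 s = v1 p1 \<and> w2 t = w2 q1) \<or> (v1 s = v1 p2 \<and> w2 t = w2 q2)"
      using zero[OF directed_strandD(9)[OF s1 that(1)]] p1(2) p2(2) q1(2) q2(2) by auto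
    finally show ?thesis
      unfolding directed_strand_inj[OF s1 that(1) p1(1)] directed_strand_inj[OF s1 that(1) p2(1)]
        directed_strand_inj[OF s2' that(2) q1(1)] directed_strand_inj[OF s2' that(2) q2(1)] .
  qed
  have neq: "p1 \<noteq> p2" "q1 \<noteq> q2"
    using p1 p2 q1 q2 x(2) by auto
  have pq: "p1 \<noteq> q1" "p2 \<noteq> q2"
    using p1(1) p2(1) q1(1) q2(1) disjoint by auto
  have double: "curve K' p1 = curve K' q1" "curve K' p2 = curve K' q2"
    using meet[OF p1(1) q1(1)] meet[OF p2(1) q2(1)] by simp_all
  have mate: "mate K' p1 = q1" "mate K' p2 = q2"
    using double pq by (auto intro!: K'.mate_eqI)
  have in_ends: "p1 \<in> crossing_ends K'" "p2 \<in> crossing_ends K'"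
    "q1 \<in> crossing_ends K'" "q2 \<in> crossing_ends K'"
    using double pq by (metis crossing_endsI)+
  have 3: "crossing_ends K' \<inter> {\<alpha>1..\<beta>1} = {p1, p2}"
  proof
    show "crossing_ends K' \<inter> {\<alpha>1..\<beta>1} \<subseteq> {p1, p2}"
    proof
      fix t assume "t \<in> crossing_ends K' \<inter> {\<alpha>1..\<beta>1}"
      then have t: "t \<in> crossing_ends K'" "t \<in> {\<alpha>1..\<beta>1}" by auto
      note m = K'.mate_works[OF t(1)]
      have "mate K' t \<notin> {\<alpha>1..\<beta>1}"
        using self[OF s1' bound(1), of "mate K' t" t] m(1,2) t(2) by metis
      then have "mate K' t \<in> {\<alpha>2..\<beta>2}"
        using partner'[OF t(1)] t(2) by (auto simp: J_def)
      then show "t \<in> {p1, p2}"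
        using meet[OF t(2), of "mate K' t"] m(2) by auto
    qed
  qed (use in_ends p1 p2 in simp)
  have 4: "crossing_ends K' \<inter> {\<alpha>2..\<beta>2} = {q1, q2}"
  proof
    show "crossing_ends K' \<inter> {\<alpha>2..\<beta>2} \<subseteq> {q1, q2}"
    proof
      fix t assume "t \<in> crossing_ends K' \<inter> {\<alpha>2..\<beta>2}"
      then have t: "t \<in> crossing_ends K'" "t \<in> {\<alpha>2..\<beta>2}" by auto
      note m = K'.mate_works[OF t(1)]
      have "mate K' t \<notin> {\<alpha>2..\<beta>2}"
        using self[OF s2' bound(3), of "mate K' t" t] m(1,2) t(2) by metis
      then have "mate K' t \<in> {\<alpha>1..\<beta>1}"
        using partner'[OF t(1)] t(2) by (auto simp: J_def)
      then show "t \<in> {q1, q2}"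
        using meet[of "mate K' t" t] m(2) t(2) by auto
    qed
  qed (use in_ends q1 q2 in simp)
  \<comment> \<open>\<open>is_over\<close> concerns the ends \<open>q1\<close> and \<open>q2\<close>
    on the second strand; their mates on the first strand have the opposite level, so these agree as
    well.\<close>
  have over': "p1 \<in> over_params K' \<longleftrightarrow> p2 \<in> over_params K'"
    using over[rule_format, OF p1(1) q1(1) double(1)] over[rule_format, OF p2(1) q2(1) double(2)]
      K'.over_mate[OF in_ends(1)] K'.over_mate[OF in_ends(2)] mate by auto
  obtain \<epsilon> :: real where \<epsilon>: "\<And>y. y \<in> square \<Longrightarrow> sgn (orientation h y) = \<epsilon>"
    using disc_chart_orientation[OF chart] by metis
  have d: "((\<lambda>_. 0 :: real) has_real_derivative deriv (\<lambda>_. 0) x) (at x)" for x :: real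
    by simp
  note dk = smooth_on_deriv(1)[OF k(1)]
  let ?A = "\<lambda>s t. area_form (curve K' s) (tangent (curve K') s) (tangent (curve K') t)"
  have A: "sgn (?A p1 q1) = \<sigma>1 * \<tau>2 * \<epsilon> * sgn (deriv k x1)"
    "sgn (?A p2 q2) = \<sigma>1 * \<tau>2 * \<epsilon> * sgn (deriv k x2)"
    using strands_area_form[OF chart \<epsilon> s1' s2' bound(1,3) d dk _ _ _ K'.curve_differentiable
        K'.curve_differentiable] p1 p2 q1 q2 double by simp_all
  \<comment> \<open>Transversality of the double points of \<open>K'\<close> is what makes the zeros
    of \<open>k\<close> simple.\<close>
  have nz: "?A p1 q1 \<noteq> 0" "?A p2 q2 \<noteq> 0"
    using K'.transverse double pq by blast+
  then have "deriv k x1 \<noteq> 0" "deriv k x2 \<noteq> 0"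
    using A by (auto simp: sgn_eq_0_iff)
  then have "sgn (deriv k x2) = - sgn (deriv k x1)"
    using zero xs by (intro consecutive_simple_zeros[OF dk x(2) xs(3,4)]) auto
  then have A': "sgn (?A p2 q2) = - sgn (?A p1 q1)"
    by (simp add: A)
  \<comment> \<open>A chord lists its over end first. If \<open>p1\<close> and \<open>p2\<close> are
    the under ends, both area forms change sign, and the two crossing signs remain opposite.\<close>
  have swap: "?A q1 p1 = - ?A p1 q1" "?A q2 p2 = - ?A p2 q2"
    by (simp_all add: double area_form_swap[of _ "tangent (curve K') q1"]
        area_form_swap[of _ "tangent (curve K') q2"])
  have "real_of_int (crossing_sign orient K' (end_chord K' p2))
      = - real_of_int (crossing_sign orient K' (end_chord K' p1))"
    using over' nz A' swap
    by (auto simp: end_chord_def mate crossing_sign_sgn[OF orient] sgn_minus)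
  then have sign: "crossing_sign orient K' (end_chord K' p2) = - crossing_sign orient K' (end_chord K' p1)"
    by linarith
  define \<alpha> \<beta> where "\<alpha> = (\<lambda>i::nat. if i = 0 then \<alpha>1 else \<alpha>2)" and "\<beta> = (\<lambda>i::nat. if i = 0 then \<beta>1 else \<beta>2)"
  have \<alpha>\<beta>: "\<alpha> 0 = \<alpha>1" "\<alpha> 1 = \<alpha>2" "\<beta> 0 = \<beta>1" "\<beta> 1 = \<beta>2"
    by (simp_all add: \<alpha>_def \<beta>_def)
  have "gauss_move {0, 1} \<alpha> \<beta>
    (crossing_ends K) (mate K) (over_params K) (crossing_sign orient K \<circ> end_chord K)
    (crossing_ends K') (mate K') (over_params K') (crossing_sign orient K' \<circ> end_chord K')"
  proof (rule same_outside_gauss_move[OF K K'])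
    show "same_outside h (\<Union>i\<in>{0, 1}. {\<alpha> i..\<beta> i}) K K'"
      using same by (simp add: \<alpha>\<beta> del: One_nat_def)
    show "\<alpha> i \<le> \<beta> i" if "i \<in> {0, 1}" for i
      using that directed_strandD(1)[OF s1] directed_strandD(1)[OF s2] by (auto simp: \<alpha>\<beta> simp del: One_nat_def)
    show "disjoint_family_on (\<lambda>i. {\<alpha> i..\<beta> i}) {0, 1}"
      using disjoint by (auto simp: disjoint_family_on_def \<alpha>\<beta> simp del: One_nat_def)
    show "even (card (crossing_ends K \<inter> {\<alpha> i..\<beta> i})) \<longleftrightarrow> even (card (crossing_ends K' \<inter> {\<alpha> i..\<beta> i}))"
      if "i \<in> {0, 1}" for i
      using that 1 2 3 4 neq by (auto simp: \<alpha>\<beta> simp del: One_nat_def)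
  qed simp
  from gauss_prod_R2[OF this, of p1 p2 q1 q2] show ?thesis
    unfolding K.phi_bar_eq K'.phi_bar_eq \<alpha>\<beta> using 1 2 3 4 neq mate over' sign by simp
qed

section \<open>The third Reidemeister move\<close>

text \<open>Describes either side of the third move: three graphs in the disc, those of
  \<open>\<gamma> i\<close> and \<open>\<gamma> j\<close> meeting only over the abscissa
  \<open>\<xi> i j\<close>. Besides the levels, the comparison of the two sides needs just the
  directions, the order of the abscissae and the slopes.\<close>

locale triangle = long_knot p K for p K +
  fixes h :: "real \<times> real \<Rightarrow> real \<times> complex" and \<alpha> \<beta> :: "nat \<Rightarrow> real"
    and \<gamma> v :: "nat \<Rightarrow> real \<Rightarrow> real" and \<sigma> :: "nat \<Rightarrow> real" and \<xi> :: "nat \<Rightarrow> nat \<Rightarrow> real"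
  assumes chart: "disc_chart h"
    and preimage: "curve K t \<in> h ` square \<longleftrightarrow> t \<in> (\<Union>i\<in>{1..3}. {\<alpha> i..\<beta> i})"
    and disjoint: "disjoint_family_on (\<lambda>i. {\<alpha> i..\<beta> i}) {1..3}"
    and strand: "i \<in> {1..3} \<Longrightarrow> directed_strand h (curve K) (\<alpha> i) (\<beta> i) (\<gamma> i) (v i) (\<sigma> i)"
    and \<gamma>_deriv: "i \<in> {1..3} \<Longrightarrow> (\<gamma> i has_real_derivative deriv (\<gamma> i) x) (at x)"
    and \<gamma>_bound: "i \<in> {1..3} \<Longrightarrow> x \<in> {-1..1} \<Longrightarrow> \<bar>\<gamma> i x\<bar> \<le> 1"
    and \<xi>_mem: "\<xi> i j \<in> {-1..1}" and \<xi>_sym: "\<xi> i j = \<xi> j i"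
    and meet: "i \<in> {1..3} \<Longrightarrow> j \<in> {1..3} \<Longrightarrow> i \<noteq> j \<Longrightarrow> x \<in> {-1..1} \<Longrightarrow>
      \<gamma> i x = \<gamma> j x \<longleftrightarrow> x = \<xi> i j"
begin

definition e :: "nat \<Rightarrow> nat \<Rightarrow> real" where
  "e i j = inv_into {\<alpha> i..\<beta> i} (v i) (\<xi> i j)"

lemma e_works:
  assumes "i \<in> {1..3}"
  shows "e i j \<in> {\<alpha> i..\<beta> i}" "v i (e i j) = \<xi> i j"
proof -
  have "\<xi> i j \<in> v i ` {\<alpha> i..\<beta> i}"
    using \<xi>_mem bij_betw_imp_surj_on[OF directed_strandD(3)[OF strand[OF assms]]] by simp
  then show "e i j \<in> {\<alpha> i..\<beta> i}" "v i (e i j) = \<xi> i j"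
    unfolding e_def by (rule inv_into_into, rule f_inv_into_f)
qed

lemma crossing_iff:
  assumes "i \<in> {1..3}" "j \<in> {1..3}" "i \<noteq> j" "s \<in> {\<alpha> i..\<beta> i}" "t \<in> {\<alpha> j..\<beta> j}"
  shows "f s = f t \<longleftrightarrow> s = e i j \<and> t = e j i"
proof -
  have "f s = f t \<longleftrightarrow> v i s = v j t \<and> \<gamma> i (v i s) = \<gamma> j (v i s)"
    by (rule strands_meet[OF chart strand[OF assms(1)] strand[OF assms(2)] \<gamma>_bound[OF assms(1)]
          \<gamma>_bound[OF assms(2)] assms(4,5)])
  also have "\<dots> \<longleftrightarrow> v i s = v i (e i j) \<and> v j t = v j (e j i)"
    using meet[OF assms(1-3) directed_strandD(9)[OF strand[OF assms(1)] assms(4)]]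
      e_works(2)[OF assms(1), of j] e_works(2)[OF assms(2), of i] \<xi>_sym[of i j] by auto
  also have "\<dots> \<longleftrightarrow> s = e i j \<and> t = e j i"
    unfolding directed_strand_inj[OF strand[OF assms(1)] assms(4) e_works(1)[OF assms(1)]]
      directed_strand_inj[OF strand[OF assms(2)] assms(5) e_works(1)[OF assms(2)]] ..
  finally show ?thesis .
qed

context
  fixes i j k assumes ijk: "{i, j, k} = {1::nat, 2, 3}"
begin

lemma indices: "i \<in> {1..3}" "j \<in> {1..3}" "k \<in> {1..3}"
  using triple_distinct(1-3)[OF ijk] by auto

lemma e_double: "f (e i j) = f (e j i)" "e i j \<noteq> e j i"
proof -
  note ij = indices(1,2) triple_distinct(4)[OF ijk]
  show "f (e i j) = f (e j i)"
    using crossing_iff[OF ij e_works(1)[OF ij(1)] e_works(1)[OF ij(2)], of j i] by simp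
  have "{\<alpha> i..\<beta> i} \<inter> {\<alpha> j..\<beta> j} = {}"
    by (rule disjoint_family_onD[OF disjoint ij])
  then show "e i j \<noteq> e j i"
    using e_works(1)[OF ij(1), of j] e_works(1)[OF ij(2), of i] by (metis disjoint_iff)
qed

lemma mate_e: "mate K (e i j) = e j i"
  using e_double by (intro mate_eqI) auto

lemma e_less: "e i j < e i k \<longleftrightarrow> \<sigma> i * \<xi> i j < \<sigma> i * \<xi> i k"
  using directed_strandD(7)[OF strand[OF indices(1)] e_works(1)[OF indices(1), of j] e_works(1)[OF indices(1), of k]]
  by (simp add: e_works(2)[OF indices(1)])

lemma e_eq: "e i j = e i k \<longleftrightarrow> \<xi> i j = \<xi> i k"
  using directed_strand_inj[OF strand[OF indices(1)] e_works(1)[OF indices(1), of j] e_works(1)[OF indices(1), of k]]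
  by (simp add: e_works(2)[OF indices(1)])

lemma e_area_form:
  assumes "\<And>y. y \<in> square \<Longrightarrow> sgn (orientation h y) = \<epsilon>"
  shows "sgn (area_form (f (e i j)) (tangent f (e i j)) (tangent f (e j i)))
    = \<sigma> i * \<sigma> j * \<epsilon> * sgn (deriv (\<gamma> j) (\<xi> i j) - deriv (\<gamma> i) (\<xi> i j))"
  using strands_area_form[OF chart assms strand[OF indices(1)] strand[OF indices(2)]
      \<gamma>_bound[OF indices(1)] \<gamma>_bound[OF indices(2)] \<gamma>_deriv[OF indices(1)] \<gamma>_deriv[OF indices(2)]
      e_works(1)[OF indices(1)] e_works(1)[OF indices(2)] e_double(1) curve_differentiable
      curve_differentiable]
  by (simp add: e_works(2)[OF indices(1)])

end

lemma crossing_ends_strand: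
  assumes ijk: "{i, j, k} = {1, 2, 3}"
  shows "crossing_ends K \<inter> {\<alpha> i..\<beta> i} = {e i j, e i k}"
proof
  have ikj: "{i, k, j} = {1, 2, 3}"
    using ijk by (simp add: insert_commute)
  note ind = indices[OF ijk] and ne = triple_distinct[OF ijk]
  show "{e i j, e i k} \<subseteq> crossing_ends K \<inter> {\<alpha> i..\<beta> i}"
    using e_works(1)[OF ind(1)] crossing_endsI[of "e j i" "e i j" K] crossing_endsI[of "e k i" "e i k" K]
      e_double[OF ijk] e_double[OF ikj] by auto
  show "crossing_ends K \<inter> {\<alpha> i..\<beta> i} \<subseteq> {e i j, e i k}"
  proof
    fix t assume "t \<in> crossing_ends K \<inter> {\<alpha> i..\<beta> i}"
    then have t: "t \<in> crossing_ends K" "t \<in> {\<alpha> i..\<beta> i}" by auto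
    note m = mate_works[OF t(1)]
    have "f (mate K t) \<in> h ` square"
      using preimage[of t] t(2) ind(1) m(2) by auto
    then obtain l where l: "l \<in> {1..3}" "mate K t \<in> {\<alpha> l..\<beta> l}"
      unfolding preimage by blast
    have "l \<noteq> i"
      using directed_strand_no_self_crossing[OF chart strand[OF ind(1)] \<gamma>_bound[OF ind(1)], of "mate K t" t]
        m(1,2) l(2) t(2) by metis
    then have "t = e i l"
      using crossing_iff[OF ind(1) l(1) _ t(2) l(2)] m(2) by simp
    moreover have "l \<in> {i, j, k}"
      unfolding ijk using l(1) by auto
    ultimately show "t \<in> {e i j, e i k}"
      using \<open>l \<noteq> i\<close> by auto
  qed
qed

end

text \<open>Both sides share the directions \<open>\<sigma>\<close>. Hence reversing the order of
  the abscissae reverses the order of the ends along each strand, whichever way it runs, and equal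
  signs of the slope differences give equal crossing signs.\<close>

lemma triangle_R3:
  assumes "triangle p K h \<alpha> \<beta> \<gamma> v \<sigma> \<xi>" "triangle p K' h \<alpha> \<beta> \<gamma>' v' \<sigma> \<xi>'"
    and same: "same_outside h (\<Union>i\<in>{1..3}. {\<alpha> i..\<beta> i}) K K'"
    and lev: "layered K (\<lambda>i. {\<alpha> i..\<beta> i}) lev" "layered K' (\<lambda>i. {\<alpha> i..\<beta> i}) lev"
    and swapped: "\<And>i j k. {i, j, k} = {1, 2, 3} \<Longrightarrow> \<xi> i j < \<xi> i k \<longleftrightarrow> \<xi>' i k < \<xi>' i j"
    and distinct: "\<And>i j k. {i, j, k} = {1, 2, 3} \<Longrightarrow> \<xi> i j \<noteq> \<xi> i k"
    and slopes: "\<And>i j k. {i, j, k} = {1, 2, 3} \<Longrightarrow>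
      sgn (deriv (\<gamma> j) (\<xi> i j) - deriv (\<gamma> i) (\<xi> i j))
        = sgn (deriv (\<gamma>' j) (\<xi>' i j) - deriv (\<gamma>' i) (\<xi>' i j))"
    and orient: "orient \<in> {1, -1}"
  shows "phi_bar orient K = phi_bar orient K'"
proof -
  interpret K: triangle p K h \<alpha> \<beta> \<gamma> v \<sigma> \<xi> by fact
  interpret K': triangle p K' h \<alpha> \<beta> \<gamma>' v' \<sigma> \<xi>' by fact
  have distinct': "\<xi>' i j \<noteq> \<xi>' i k" if "{i, j, k} = {1, 2, 3}" for i j k
  proof -
    have "{i, k, j} = {1, 2, 3}" using that by (simp add: insert_commute)
    then show ?thesis
      using swapped[OF that] swapped[of i k j] distinct[OF that] by (metis less_irrefl linorder_neqE)
  qed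
  obtain \<epsilon> :: real where \<epsilon>: "\<And>y. y \<in> square \<Longrightarrow> sgn (orientation h y) = \<epsilon>"
    using disc_chart_orientation[OF K.chart] by metis
  have move: "gauss_move {1..3} \<alpha> \<beta>
    (crossing_ends K) (mate K) (over_params K) (crossing_sign orient K \<circ> end_chord K)
    (crossing_ends K') (mate K') (over_params K') (crossing_sign orient K' \<circ> end_chord K')"
  proof (rule same_outside_gauss_move[OF K.long_knot K'.long_knot same])
    fix i :: nat assume i: "i \<in> {1..3}"
    show "\<alpha> i \<le> \<beta> i"
      using directed_strandD(1)[OF K.strand[OF i]] by simp
    obtain j k where ijk: "{i, j, k} = {1, 2, 3}"
      using triple_exists[OF i] .
    show "even (card (crossing_ends K \<inter> {\<alpha> i..\<beta> i})) \<longleftrightarrow> even (card (crossing_ends K' \<inter> {\<alpha> i..\<beta> i}))"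
      unfolding K.crossing_ends_strand[OF ijk] K'.crossing_ends_strand[OF ijk]
      using K.e_eq[OF ijk] K'.e_eq[OF ijk] distinct[OF ijk] distinct'[OF ijk] by simp
  qed (simp, rule K.disjoint)
  have over: "K.e i j \<in> over_params K \<longleftrightarrow> lev j < lev i" "K'.e i j \<in> over_params K' \<longleftrightarrow> lev j < lev i"
    if ijk: "{i, j, k} = {1, 2, 3}" for i j k
    using lev[unfolded layered_def, rule_format, OF K.indices(1,2)[OF ijk]
        K.e_works(1)[OF K.indices(1)[OF ijk]] K.e_works(1)[OF K.indices(2)[OF ijk]], of j i]
      lev(2)[unfolded layered_def, rule_format, OF K.indices(1,2)[OF ijk]
        K'.e_works(1)[OF K.indices(1)[OF ijk]] K'.e_works(1)[OF K.indices(2)[OF ijk]], of j i]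
      K.e_double(1)[OF ijk] K'.e_double(1)[OF ijk] triple_distinct(4)[OF ijk] by simp_all
  have area: "sgn (area_form (curve K (K.e i j)) (tangent (curve K) (K.e i j)) (tangent (curve K) (K.e j i)))
      = sgn (area_form (curve K' (K'.e i j)) (tangent (curve K') (K'.e i j)) (tangent (curve K') (K'.e j i)))"
    if ijk: "{i, j, k} = {1, 2, 3}" for i j k
    using K.e_area_form[OF ijk \<epsilon>] K'.e_area_form[OF ijk \<epsilon>] slopes[OF ijk] by simp
  have sign: "crossing_sign orient K (K.e i j, K.e j i) = crossing_sign orient K' (K'.e i j, K'.e j i)"
    if ijk: "{i, j, k} = {1, 2, 3}" for i j k
  proof -
    have "real_of_int (crossing_sign orient K (K.e i j, K.e j i))
        = real_of_int (crossing_sign orient K' (K'.e i j, K'.e j i))"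
      using area[OF ijk] K.transverse[OF K.e_double(2)[OF ijk] K.e_double(1)[OF ijk]]
        K'.transverse[OF K'.e_double(2)[OF ijk] K'.e_double(1)[OF ijk]]
      by (simp add: crossing_sign_sgn[OF orient])
    then show ?thesis by simp
  qed
  have "gauss_R3_axioms \<alpha> \<beta> (crossing_ends K) (mate K) (over_params K) (crossing_sign orient K \<circ> end_chord K)
    (crossing_ends K') (mate K') (over_params K') (crossing_sign orient K' \<circ> end_chord K') K.e K'.e"
  proof (rule gauss_R3_axioms.intro)
    fix i j k :: nat assume ijk: "{i, j, k} = {1, 2, 3}"
    have jik: "{j, i, k} = {1, 2, 3}" using ijk by (simp add: insert_commute)
    show "crossing_ends K \<inter> {\<alpha> i..\<beta> i} = {K.e i j, K.e i k}"
      "crossing_ends K' \<inter> {\<alpha> i..\<beta> i} = {K'.e i j, K'.e i k}"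
      by (rule K.crossing_ends_strand[OF ijk], rule K'.crossing_ends_strand[OF ijk])
    show "K.e i j \<noteq> K.e i k" "K'.e i j \<noteq> K'.e i k"
      using K.e_eq[OF ijk] K'.e_eq[OF ijk] distinct[OF ijk] distinct'[OF ijk] by simp_all
    have "\<sigma> i \<in> {1, -1}"
      by (rule directed_strandD(2)[OF K.strand[OF K.indices(1)[OF ijk]]])
    moreover have "{i, k, j} = {1, 2, 3}" using ijk by (simp add: insert_commute)
    ultimately show "K.e i j < K.e i k \<longleftrightarrow> K'.e i k < K'.e i j"
      using K.e_less[OF ijk] K'.e_less[of i k j] swapped[OF ijk] swapped[of i k j] by auto
    show "mate K (K.e i j) = K.e j i \<and> mate K' (K'.e i j) = K'.e j i"
      using K.mate_e[OF ijk] K'.mate_e[OF ijk] by simp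
    show "K.e i j \<in> over_params K \<longleftrightarrow> K'.e i j \<in> over_params K'"
      using over[OF ijk] by simp
    then show "(crossing_sign orient K \<circ> end_chord K) (K.e i j) = (crossing_sign orient K' \<circ> end_chord K') (K'.e i j)"
      using sign[OF ijk] sign[OF jik] K.mate_e[OF ijk] K'.mate_e[OF ijk] by (simp add: end_chord_def)
  qed
  from gauss_R3.gauss_prod_eq[OF gauss_R3.intro[OF move this]] show ?thesis
    by (simp add: K.phi_bar_eq K'.phi_bar_eq)
qed

text \<open>By the bound on the slope, \<open>u\<close> increases from -1/2 to 1/2, so it has one
  zero, which lies on the side of the origin opposite to the sign of \<open>u 0 = - c * g 0\<close>.
  The parameter \<open>c\<close> treats the lines \<open>y = x/2\<close> and \<open>y = -x/2\<close>
  together.\<close>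

lemma unique_crossing:
  fixes g :: "real \<Rightarrow> real"
  assumes g: "\<And>x. (g has_real_derivative deriv g x) (at x)"
    and slope: "\<And>x. x \<in> {-1..1} \<Longrightarrow> \<bar>deriv g x\<bar> < 1/2"
    and ends: "g (-1) = 0" "g 1 = 0" and c: "c \<in> {1, -1}"
  obtains x where "x \<in> {-1..1}" "\<And>y. y \<in> {-1..1} \<Longrightarrow> g y = c * y / 2 \<longleftrightarrow> y = x"
    "sgn x = c * sgn (g 0)"
proof -
  define u where "u = (\<lambda>y. y / 2 - c * g y)"
  have du: "(u has_real_derivative 1/2 - c * deriv g x) (at x)" for x
    unfolding u_def by (auto intro!: derivative_eq_intros g)
  have incr: "u x < u y" if "x \<in> {-1..1}" "y \<in> {-1..1}" "x < y" for x y
  proof (rule DERIV_pos_imp_increasing[OF that(3)])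
    fix z assume "x \<le> z" "z \<le> y"
    then have "1/2 - c * deriv g z > 0"
      using slope[of z] that c by auto
    then show "\<exists>d. (u has_real_derivative d) (at z) \<and> 0 < d"
      using du by blast
  qed
  have less: "x < y \<longleftrightarrow> u x < u y" if "x \<in> {-1..1}" "y \<in> {-1..1}" for x y
    using incr[of x y] incr[of y x] that by (cases x y rule: linorder_cases) auto
  have "\<exists>x. -1 \<le> x \<and> x \<le> 1 \<and> u x = 0"
    using DERIV_isCont[OF du] by (intro IVT) (auto simp: u_def ends)
  then obtain x where x: "x \<in> {-1..1}" "u x = 0"
    by auto
  have zero: "g y = c * y / 2 \<longleftrightarrow> u y = 0" for y
    using c by (auto simp: u_def)
  show ?thesis
  proof
    show "x \<in> {-1..1}" by fact
    show "g y = c * y / 2 \<longleftrightarrow> y = x" if "y \<in> {-1..1}" for y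
      using less[OF that x(1)] less[OF x(1) that] x(2) unfolding zero by auto
    have "u 0 = - c * g 0"
      by (simp add: u_def)
    then show "sgn x = c * sgn (g 0)"
      using less[of 0 x] less[of x 0] x c by (auto simp: sgn_if zero_less_mult_iff)
  qed
qed

text \<open>The mean value theorem from the end -1 gives the bound \<open>(x + 1) / 2\<close>. It
  keeps the third strand in the square, where the chart is injective and its Jacobian has a constant
  sign.\<close>

lemma slope_bound:
  fixes g :: "real \<Rightarrow> real"
  assumes g: "\<And>x. (g has_real_derivative deriv g x) (at x)"
    and slope: "\<And>x. x \<in> {-1..1} \<Longrightarrow> \<bar>deriv g x\<bar> < 1/2" and "g (-1) = 0" and x: "x \<in> {-1..1}"
  shows "\<bar>g x\<bar> \<le> 1"
proof (cases "x = -1")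
  case False
  then have "-1 < x" using x by simp
  obtain z where z: "-1 < z" "z < x" "g x - g (-1) = (x - (-1)) * deriv g z"
    using MVT2[OF \<open>-1 < x\<close> g] by blast
  have "\<bar>g x\<bar> = (x + 1) * \<bar>deriv g z\<bar>"
    using z assms(3) x by (simp add: abs_mult)
  also have "\<dots> \<le> 2 * (1/2)"
    using slope[of z] z x by (intro mult_mono) auto
  finally show ?thesis by simp
qed (use assms in simp)

definition R3_strand :: "(real \<Rightarrow> real) \<Rightarrow> nat \<Rightarrow> real \<Rightarrow> real" where
  "R3_strand g i = (if i = 1 then (\<lambda>x. x / 2) else if i = 2 then (\<lambda>x. - x / 2) else g)"

text \<open>The unordered pair makes the symmetry evident. Strands 1 and 2 cross over 0; for index
  pairs that are not crossings the same 0 is a filler, as a value in \<open>{-1..1}\<close> is asked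
  for all indices.\<close>

definition R3_abscissa :: "real \<Rightarrow> real \<Rightarrow> nat \<Rightarrow> nat \<Rightarrow> real" where
  "R3_abscissa x13 x23 i j = (if {i, j} = {1, 3} then x13 else if {i, j} = {2, 3} then x23 else 0)"

lemma R3_abscissa_simps:
  "R3_abscissa x13 x23 1 2 = 0" "R3_abscissa x13 x23 2 1 = 0"
  "R3_abscissa x13 x23 1 3 = x13" "R3_abscissa x13 x23 3 1 = x13"
  "R3_abscissa x13 x23 2 3 = x23" "R3_abscissa x13 x23 3 2 = x23"
  by (simp_all add: R3_abscissa_def doubleton_eq_iff)

lemma R3_strand_simps:
  "R3_strand g 1 = (\<lambda>x. x / 2)" "R3_strand g 2 = (\<lambda>x. - x / 2)" "R3_strand g 3 = g"
  by (simp_all add: R3_strand_def)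

lemma three_cases:
  assumes "i \<in> {1..3::nat}"
  obtains "i = 1" | "i = 2" | "i = 3"
  using assms that by fastforce

lemma triple_cases:
  assumes "{i, j, k} = {1::nat, 2, 3}"
  obtains "i = 1" "j = 2" "k = 3" | "i = 1" "j = 3" "k = 2" | "i = 2" "j = 1" "k = 3"
    | "i = 2" "j = 3" "k = 1" | "i = 3" "j = 1" "k = 2" | "i = 3" "j = 2" "k = 1"
  using triple_distinct[OF assms] that by (elim insertE) simp_all

lemma deriv_linear: "deriv (\<lambda>x. x / 2) x = (1/2 :: real)" "deriv (\<lambda>x. - x / 2) x = (-1/2 :: real)"
  "deriv (\<lambda>x. - (x / 2)) x = (-1/2 :: real)"
  by (rule DERIV_imp_deriv, auto intro!: derivative_eq_intros)+

lemma triangle_graphs: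
  assumes "long_knot_diagram p K" "disc_chart h"
    and "\<And>t. curve K t \<in> h ` square \<longleftrightarrow> t \<in> (\<Union>i\<in>{1..3}. {\<alpha> i..\<beta> i})"
    and "disjoint_family_on (\<lambda>i. {\<alpha> i..\<beta> i}) {1..3}"
    and "\<And>i. i \<in> {1..3} \<Longrightarrow> directed_strand h (curve K) (\<alpha> i) (\<beta> i) (R3_strand g i) (v i) (\<sigma> i)"
    and g: "\<And>x. (g has_real_derivative deriv g x) (at x)"
    and slope: "\<And>x. x \<in> {-1..1} \<Longrightarrow> \<bar>deriv g x\<bar> < 1/2" and "g (-1) = 0"
    and x13: "x13 \<in> {-1..1}" "\<And>y. y \<in> {-1..1} \<Longrightarrow> g y = y / 2 \<longleftrightarrow> y = x13"
    and x23: "x23 \<in> {-1..1}" "\<And>y. y \<in> {-1..1} \<Longrightarrow> g y = - y / 2 \<longleftrightarrow> y = x23"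
  shows "triangle p K h \<alpha> \<beta> (R3_strand g) v \<sigma> (R3_abscissa x13 x23)"
proof -
  have "triangle_axioms K h \<alpha> \<beta> (R3_strand g) v \<sigma> (R3_abscissa x13 x23)"
  proof (rule triangle_axioms.intro[OF assms(2-5)])
    fix i :: nat and x :: real assume i: "i \<in> {1..3}"
    show "(R3_strand g i has_real_derivative deriv (R3_strand g i) x) (at x)"
      using i g by (cases rule: three_cases)
        (auto simp: R3_strand_simps deriv_linear simp del: One_nat_def intro!: derivative_eq_intros)
    show "\<bar>R3_strand g i x\<bar> \<le> 1" if x: "x \<in> {-1..1}"
      using i slope_bound[OF g slope assms(8) x] x by (cases rule: three_cases)
        (auto simp: R3_strand_simps simp del: One_nat_def)
    fix j :: nat assume j: "j \<in> {1..3}" and "i \<noteq> j" and x: "x \<in> {-1..1}"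
    show "R3_strand g i x = R3_strand g j x \<longleftrightarrow> x = R3_abscissa x13 x23 i j"
      using \<open>i \<noteq> j\<close> x13(2)[OF x] x23(2)[OF x]
      by (cases rule: three_cases[OF i]; cases rule: three_cases[OF j])
        (auto simp: R3_strand_simps R3_abscissa_simps simp del: One_nat_def)
  next
    fix i j :: nat
    show "R3_abscissa x13 x23 i j \<in> {-1..1}"
      using x13(1) x23(1) by (simp add: R3_abscissa_def)
    show "R3_abscissa x13 x23 i j = R3_abscissa x13 x23 j i"
      by (simp add: R3_abscissa_def insert_commute)
  qed
  then show ?thesis
    using assms(1) by (intro triangle.intro long_knot.intro)
qed

text \<open>The two diagrams coincide just before the parameter \<open>\<alpha> l\<close>, the other
  intervals being closed and disjoint from this one, so by continuity the strand enters the disc at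
  the same point in both. The abscissa of the entry point is minus the direction.\<close>

lemma same_direction:
  assumes "disc_chart h" "disjoint_family_on (\<lambda>i. {\<alpha> i..\<beta> i}) N" "finite N" "l \<in> N"
    and same: "same_outside h (\<Union>i\<in>N. {\<alpha> i..\<beta> i}) K K'"
    and 1: "directed_strand h (curve K) (\<alpha> l) (\<beta> l) g v \<sigma>"
    and 2: "directed_strand h (curve K') (\<alpha> l) (\<beta> l) g' v' \<sigma>'"
    and bound: "\<And>x. x \<in> {-1..1} \<Longrightarrow> \<bar>g x\<bar> \<le> 1" "\<And>x. x \<in> {-1..1} \<Longrightarrow> \<bar>g' x\<bar> \<le> 1"
    and cont: "isCont (curve K) (\<alpha> l)" "isCont (curve K') (\<alpha> l)"
  shows "\<sigma> = \<sigma>'"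
proof -
  have mem: "\<alpha> l \<in> {\<alpha> l..\<beta> l}"
    using directed_strandD(1)[OF 1] by simp
  define F where "F = (\<Union>i\<in>N - {l}. {\<alpha> i..\<beta> i})"
  have "closed F"
    unfolding F_def using assms(3) by (intro closed_UN) auto
  moreover have "\<alpha> l \<notin> F"
    using mem disjoint_family_onD[OF assms(2) assms(4)] unfolding F_def by blast
  ultimately have "\<forall>\<^sub>F t in nhds (\<alpha> l). t \<in> - F"
    by (intro eventually_nhds_in_open) auto
  then have "\<forall>\<^sub>F t in at_left (\<alpha> l). t \<in> - F"
    unfolding eventually_at_filter by (rule eventually_mono) simp
  moreover have "\<forall>\<^sub>F t in at_left (\<alpha> l). t < \<alpha> l"
    by (simp add: eventually_at_filter)
  ultimately have "\<forall>\<^sub>F t in at_left (\<alpha> l). curve K t = curve K' t"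
  proof eventually_elim
    case (elim t)
    then have "t \<notin> (\<Union>i\<in>N. {\<alpha> i..\<beta> i})"
      by (auto simp: F_def)
    then show ?case
      by (rule same_outside_agree(1)[OF same])
  qed
  moreover have "(curve K \<longlongrightarrow> curve K (\<alpha> l)) (at_left (\<alpha> l))" "(curve K' \<longlongrightarrow> curve K' (\<alpha> l)) (at_left (\<alpha> l))"
    using cont by (simp_all add: isCont_def filterlim_at_split)
  ultimately have "curve K (\<alpha> l) = curve K' (\<alpha> l)"
    using tendsto_cong tendsto_unique[OF trivial_limit_at_left_real] by blast
  then have "v (\<alpha> l) = v' (\<alpha> l)"
    using strands_meet[OF assms(1) 1 2 bound mem mem] by simp
  then show ?thesis
    using directed_strandD(4)[OF 1] directed_strandD(4)[OF 2] by simp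
qed

lemma phi_bar_R3:
  assumes K: "long_knot_diagram p K" and K': "long_knot_diagram p K'" and "R3 K K'"
    and orient: "orient \<in> {1, -1}"
  shows "phi_bar orient K = phi_bar orient K'"
proof -
  interpret K: long_knot p K by unfold_locales fact
  interpret K': long_knot p K' by unfold_locales fact
  obtain h \<alpha> \<beta> I lev g k where chart: "disc_chart h" and I: "I = (\<lambda>i::nat. {\<alpha> i..\<beta> i})"
     and disjoint: "disjoint_family_on I {1..3}"
     and same: "same_outside h (\<Union>i\<in>{1..3}. I i) K K'"
     and g: "smooth_on UNIV g" "\<forall>x\<in>{-1..1}. \<bar>deriv g x\<bar> < 1/2" "g (-1) = 0" "g 1 = 0" "g 0 > 0"
     and k: "smooth_on UNIV k" "\<forall>x\<in>{-1..1}. \<bar>deriv k x\<bar> < 1/2" "k (-1) = 0" "k 1 = 0" "k 0 < 0"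
     and fixed: "\<forall>t \<in> I 1 \<union> I 2. curve K t = curve K' t"
     and strands: "graph_strand h (curve K) (I 1) (\<lambda>x. x/2)" "graph_strand h (curve K) (I 2) (\<lambda>x. - x/2)"
       "graph_strand h (curve K) (I 3) g" "graph_strand h (curve K') (I 3) k"
     and lev: "layered K I lev" "layered K' I lev"
    using assms(3) unfolding R3_def by (elim exE conjE) (rule that)
  note disjoint = disjoint[unfolded I] and same = same[unfolded I] and fixed = fixed[unfolded I]
    and strands = strands[unfolded I] and lev = lev[unfolded I]
  note dg = smooth_on_deriv(1)[OF g(1)] and dk = smooth_on_deriv(1)[OF k(1)]
  note slope = g(2)[rule_format] k(2)[rule_format]
  obtain v1 \<sigma>1 where s1: "directed_strand h (curve K) (\<alpha> 1) (\<beta> 1) (\<lambda>x. x/2) v1 \<sigma>1"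
    using directed_strand_exists[OF strands(1)] .
  obtain v2 \<sigma>2 where s2: "directed_strand h (curve K) (\<alpha> 2) (\<beta> 2) (\<lambda>x. - x/2) v2 \<sigma>2"
    using directed_strand_exists[OF strands(2)] .
  obtain v3 \<sigma>3 where s3: "directed_strand h (curve K) (\<alpha> 3) (\<beta> 3) g v3 \<sigma>3"
    using directed_strand_exists[OF strands(3)] .
  obtain w3 \<tau>3 where s3': "directed_strand h (curve K') (\<alpha> 3) (\<beta> 3) k w3 \<tau>3"
    using directed_strand_exists[OF strands(4)] .
  have s1': "directed_strand h (curve K') (\<alpha> 1) (\<beta> 1) (\<lambda>x. x/2) v1 \<sigma>1"
    by (rule directed_strand_cong[OF s1]) (use fixed in blast)
  have s2': "directed_strand h (curve K') (\<alpha> 2) (\<beta> 2) (\<lambda>x. - x/2) v2 \<sigma>2"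
    by (rule directed_strand_cong[OF s2]) (use fixed in blast)
  \<comment> \<open>The third strand is parametrized separately in the two diagrams, each time in an
    unspecified direction; continuity at its entry into the disc identifies the directions.\<close>
  have "\<tau>3 = \<sigma>3"
    using slope_bound[OF dg slope(1) g(3)] slope_bound[OF dk slope(2) k(3)]
      differentiable_imp_continuous_within[OF K.curve_differentiable]
      differentiable_imp_continuous_within[OF K'.curve_differentiable]
    by (intro same_direction[OF chart disjoint _ _ same s3 s3', symmetric]) simp_all
  note s3' = s3'[unfolded this]
  define v where "v = (\<lambda>i::nat. if i = 1 then v1 else if i = 2 then v2 else v3)"
  define v' where "v' = (\<lambda>i::nat. if i = 1 then v1 else if i = 2 then v2 else w3)"
  define \<sigma> where "\<sigma> = (\<lambda>i::nat. if i = 1 then \<sigma>1 else if i = 2 then \<sigma>2 else \<sigma>3)"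
  have s: "directed_strand h (curve K) (\<alpha> i) (\<beta> i) (R3_strand g i) (v i) (\<sigma> i)"
    "directed_strand h (curve K') (\<alpha> i) (\<beta> i) (R3_strand k i) (v' i) (\<sigma> i)" if "i \<in> {1..3}" for i
    using that s1 s2 s3 s1' s2' s3' by (cases rule: three_cases;
        simp add: R3_strand_simps v_def v'_def \<sigma>_def del: One_nat_def)+
  obtain x13 where x13: "x13 \<in> {-1..1}" "\<And>y. y \<in> {-1..1} \<Longrightarrow> g y = 1 * y / 2 \<longleftrightarrow> y = x13"
      "sgn x13 = 1 * sgn (g 0)"
    using unique_crossing[OF dg slope(1) g(3,4), of 1] by blast
  obtain x23 where x23: "x23 \<in> {-1..1}" "\<And>y. y \<in> {-1..1} \<Longrightarrow> g y = (-1) * y / 2 \<longleftrightarrow> y = x23"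
      "sgn x23 = (-1) * sgn (g 0)"
    using unique_crossing[OF dg slope(1) g(3,4), of "-1"] by blast
  obtain y13 where y13: "y13 \<in> {-1..1}" "\<And>y. y \<in> {-1..1} \<Longrightarrow> k y = 1 * y / 2 \<longleftrightarrow> y = y13"
      "sgn y13 = 1 * sgn (k 0)"
    using unique_crossing[OF dk slope(2) k(3,4), of 1] by blast
  obtain y23 where y23: "y23 \<in> {-1..1}" "\<And>y. y \<in> {-1..1} \<Longrightarrow> k y = (-1) * y / 2 \<longleftrightarrow> y = y23"
      "sgn y23 = (-1) * sgn (k 0)"
    using unique_crossing[OF dk slope(2) k(3,4), of "-1"] by blast
  \<comment> \<open>The third strand passes over the origin of the square before the move and under
    it afterwards, so its crossings with the two lines change sides.\<close>
  have signs: "x13 > 0" "x23 < 0" "y13 < 0" "y23 > 0"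
    using x13(3) x23(3) y13(3) y23(3) g(5) k(5) by (simp_all add: sgn_if split: if_splits)
  note preimage = same_outside_preimage[OF same]
  have T: "triangle p K h \<alpha> \<beta> (R3_strand g) v \<sigma> (R3_abscissa x13 x23)"
    using x13(2) x23(2)
    by (intro triangle_graphs[OF K chart preimage(1) disjoint s(1) dg slope(1) g(3) x13(1) _ x23(1)]) simp_all
  have T': "triangle p K' h \<alpha> \<beta> (R3_strand k) v' \<sigma> (R3_abscissa y13 y23)"
    using y13(2) y23(2)
    by (intro triangle_graphs[OF K' chart preimage(2) disjoint s(2) dk slope(2) k(3) y13(1) _ y23(1)]) simp_all
  show ?thesis
  proof (rule triangle_R3[OF T T' same lev _ _ _ orient])
    fix i j k' :: nat assume ijk: "{i, j, k'} = {1, 2, 3}"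
    show "R3_abscissa x13 x23 i j < R3_abscissa x13 x23 i k'
        \<longleftrightarrow> R3_abscissa y13 y23 i k' < R3_abscissa y13 y23 i j"
      "R3_abscissa x13 x23 i j \<noteq> R3_abscissa x13 x23 i k'"
      using signs by (cases rule: triple_cases[OF ijk]; simp add: R3_abscissa_simps del: One_nat_def)+
    \<comment> \<open>The slope of the third strand stays strictly between those of the two lines,
      so every slope difference has the same sign before and after the move.\<close>
    have "\<bar>deriv g x13\<bar> < 1/2" "\<bar>deriv g x23\<bar> < 1/2" "\<bar>deriv k y13\<bar> < 1/2" "\<bar>deriv k y23\<bar> < 1/2"
      using slope x13(1) x23(1) y13(1) y23(1) by blast+
    then show "sgn (deriv (R3_strand g j) (R3_abscissa x13 x23 i j) - deriv (R3_strand g i) (R3_abscissa x13 x23 i j))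
      = sgn (deriv (R3_strand k j) (R3_abscissa y13 y23 i j) - deriv (R3_strand k i) (R3_abscissa y13 y23 i j))"
      by (cases rule: triple_cases[OF ijk])
        (auto simp: R3_abscissa_simps R3_strand_simps deriv_linear sgn_if abs_less_iff simp del: One_nat_def)
  qed
qed

lemma phi_bar_elementary_move:
  assumes "elementary_move p K K'" "orient \<in> {1, -1}"
  shows "phi_bar orient K = phi_bar orient K'"
proof -
  have K: "long_knot_diagram p K" "long_knot_diagram p K'"
    and "planar_isotopic K K' \<or> R1 K K' \<or> R2 K K' \<or> R3 K K'"
    using assms(1) by (simp_all add: elementary_move_def)
  then show ?thesis
    using phi_bar_planar_isotopic[OF K _ assms(2)] phi_bar_R1[OF K] phi_bar_R2[OF K _ assms(2)]
      phi_bar_R3[OF K _ assms(2)] by blast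
qed

theorem theorem4p1:
  fixes p :: complex and orient :: int and K K' :: diagram
  assumes "cmod p = 1"
    and "orient \<in> {1, -1}"
    and "long_knot_diagram p K"
    and "long_knot_diagram p K'"
    and "equivalent_diagrams p K K'"
  shows "phi_bar orient K = phi_bar orient K'"
  using assms(5) unfolding equivalent_diagrams_def
  by (induction rule: equivclp_induct) (auto dest: phi_bar_elementary_move[OF _ assms(2)])

end
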